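(* Let $({\rm X},{\sf d},\mathfrak m)$ be a metric measure space and $q\in(1,\infty]$, with $p$ the conjugate exponent. Then for every $\delta\in L^q_{\rm Sob}(T{\rm X})$ there exists a unique ${\rm I}(\delta)\in L^q(T{\rm X})$ such that $\mathrm d f({\rm I}(\delta))=\delta(f)$ for every $f\in W^{1,p}({\rm X})$. Moreover, the resulting map ${\rm I}\colon L^q_{\rm Sob}(T{\rm X})\to L^q(T{\rm X})$ is an isomorphism of $L^q(\mathfrak m)$-Banach $L^\infty(\mathfrak m)$-modules.
   Context: A metric measure space is a complete separable metric space $({\rm X},{\sf d})$ with a nonnegative Borel measure $\mathfrak m$ finite on bounded Borel sets. For $p\in[1,\infty)$, a Borel $\rho\ge0$ with $\int\rho^pd\mathfrak m<\infty$ is a weak $p$-upper gradient of an $\mathfrak m$-measurable $f$ if $|f(\gamma(b))-f(\gamma(a))|\le\int_\gamma\rho\,ds$ for all nonconstant rectifiable curves outside a family of zero $p$-modulus (${\rm Mod}_p(\Gamma)=\inf\{\int\rho^pd\mathfrak m:\int_\gamma\rho\,ds\ge1\ \forall\gamma\in\Gamma\}$); $|Df|$ is the minimal one. $W^{1,p}({\rm X})$ is the space of $\mathfrak m$-a.e. classes of $p$-integrable functions with a weak $p$-upper gradient, and $D^{1,p}_{\mathfrak m}({\rm X})$ the analogous space without integrability of $f$. An $L^r(\mathfrak m)$-Banach $L^\infty(\mathfrak m)$-module is a module $\mathscr M$ over $L^\infty(\mathfrak m)$ with a pointwise norm $|\cdot|\colon\mathscr M\to L^r(\mathfrak m)^+$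 such that $|v|=0$ only for $v=0$, $|v+w|\le|v|+|w|$, $|hv|=|h||v|$, $\|v\|=\||v|\|_{L^r}$ is a complete norm, and (gluing) for every countable Borel partition $(E_n)$ and $(v_n)\subseteq\mathscr M$ with $(\|\mathbf 1_{E_n}v_n\|)_n\in\ell^r$ there is $v$ with $\mathbf 1_{E_n}v=\mathbf 1_{E_n}v_n$ for all $n$. An isomorphism of such modules is a bijective $L^\infty(\mathfrak m)$-linear map $T$ with $|T(v)|=|v|$. The cotangent module $L^p(T^*{\rm X})$ with differential $\mathrm d\colon D^{1,p}_{\mathfrak m}({\rm X})\to L^p(T^*{\rm X})$ is the (unique up to unique isomorphism) $L^p(\mathfrak m)$-Banach $L^\infty(\mathfrak m)$-module with a linear map $\mathrm d$ satisfying $|\mathrm d f|=|Df|$ such that the $L^\infty$-glued countable sums $\sum_n\mathbf 1_{E_n}\omega_n$ with $\omega_n$ in the linear span of $\{\mathrm df\}$ are dense. The tangent module $L^q(T{\rm X})$ is the set of $L^\infty(\mathfrak m)$-linear maps $v\colon L^p(T^*{\rm X})\to L^1(\mathfrak m)$ for which there is $g\in L^q(\mathfrak m)^+$ with $|v(\omega)|\le g|\omega|$; its pointwise norm $|v|$ is the smallest such $g$, and one writes $\omega(v)$ for $v(\omega)$. A Sobolev $q$-derivation is a linear map $\delta\colon W^{1,p}({\rm X})\to L^1(\mathfrak m)$ such that $|\delta(f)|\le g|Df|$ for all $f$, for some $g\in L^q(\mathfrak m)^+$; $|\delta|$ is the smallest such $g$; $L^q_{\rm Sob}(T{\rm X})$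 is the set of these, an $L^q(\mathfrak m)$-Banach $L^\infty(\mathfrak m)$-module with pointwise operations $(h\delta)(f)=h\,\delta(f)$. *)

theory Defs
  imports "HOL-Analysis.Analysis"
begin

definition epowr :: "ennreal \<Rightarrow> real \<Rightarrow> ennreal" where
  "epowr x p = (if x = \<infinity> then \<infinity> else ennreal (enn2real x powr p))"

definition curve_len :: "(real \<Rightarrow> 'a::metric_space) \<Rightarrow> real \<Rightarrow> real \<Rightarrow> ennreal" where
  "curve_len \<gamma> a b =
     (SUP nt \<in> {(n, t). t 0 = a \<and> t n = b \<and> (\<forall>i<n. t i \<le> t (Suc i))}.
        ennreal (\<Sum>i<fst nt. dist (\<gamma> (snd nt i)) (\<gamma> (snd nt (Suc i)))))"

definition rect_curve :: "real \<times> real \<times> (real \<Rightarrow> 'a::metric_space) \<Rightarrow> bool" where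
  "rect_curve c = (case c of (a, b, \<gamma>) \<Rightarrow>
      a < b \<and> continuous_on {a..b} \<gamma> \<and> curve_len \<gamma> a b < \<infinity>)"

definition nonconst_curve :: "real \<times> real \<times> (real \<Rightarrow> 'a) \<Rightarrow> bool" where
  "nonconst_curve c = (case c of (a, b, \<gamma>) \<Rightarrow> (\<exists>s\<in>{a..b}. \<gamma> s \<noteq> \<gamma> a))"

text \<open>Line integral with respect to arc length, as the integral against the
  Lebesgue--Stieltjes measure of the length function of the curve.\<close>

definition line_int :: "('a::metric_space \<Rightarrow> ennreal) \<Rightarrow> real \<times> real \<times> (real \<Rightarrow> 'a) \<Rightarrow> ennreal" where
  "line_int \<rho> c = (case c of (a, b, \<gamma>) \<Rightarrow>
      \<integral>\<^sup>+ t. \<rho> (\<gamma> t) * indicator {a..b} t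
        \<partial>(interval_measure (\<lambda>t. enn2real (curve_len \<gamma> a (min b (max a t))))))"

definition Mod :: "'a::metric_space measure \<Rightarrow> real \<Rightarrow> (real \<times> real \<times> (real \<Rightarrow> 'a)) set \<Rightarrow> ennreal" where
  "Mod m p \<Gamma> = (INF \<rho> \<in> {\<rho> :: 'a \<Rightarrow> ennreal. \<rho> \<in> borel_measurable borel \<and> (\<forall>c\<in>\<Gamma>. 1 \<le> line_int \<rho> c)}.
       \<integral>\<^sup>+ x. epowr (\<rho> x) p \<partial>m)"

definition wug :: "'a::metric_space measure \<Rightarrow> real \<Rightarrow> ('a \<Rightarrow> real) \<Rightarrow> ('a \<Rightarrow> ennreal) \<Rightarrow> bool" where
  "wug m p f \<rho> \<longleftrightarrow> \<rho> \<in> borel_measurable borel \<and> (\<integral>\<^sup>+ x. epowr (\<rho> x) p \<partial>m) < \<infinity> \<and>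
     (\<exists>\<Gamma>. Mod m p \<Gamma> = 0 \<and>
        (\<forall>a b \<gamma>. rect_curve (a, b, \<gamma>) \<and> nonconst_curve (a, b, \<gamma>) \<and> (a, b, \<gamma>) \<notin> \<Gamma> \<longrightarrow>
            ennreal \<bar>f (\<gamma> b) - f (\<gamma> a)\<bar> \<le> line_int \<rho> (a, b, \<gamma>)))"

text \<open>Weak upper gradient of the m-a.e. class of f: of some m-measurable representative.\<close>
definition cwug :: "'a::metric_space measure \<Rightarrow> real \<Rightarrow> ('a \<Rightarrow> real) \<Rightarrow> ('a \<Rightarrow> ennreal) \<Rightarrow> bool" where
  "cwug m p f \<rho> \<longleftrightarrow> (\<exists>f'. f' \<in> borel_measurable (completion m) \<and> (AE x in m. f' x = f x) \<and> wug m p f' \<rho>)"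

definition min_wug :: "'a::metric_space measure \<Rightarrow> real \<Rightarrow> ('a \<Rightarrow> real) \<Rightarrow> ('a \<Rightarrow> ennreal) \<Rightarrow> bool" where
  "min_wug m p f G \<longleftrightarrow> cwug m p f G \<and> (\<forall>\<rho>. cwug m p f \<rho> \<longrightarrow> (AE x in m. G x \<le> \<rho> x))"

definition Dsp :: "'a::metric_space measure \<Rightarrow> real \<Rightarrow> ('a \<Rightarrow> real) \<Rightarrow> bool" where
  "Dsp m p f \<longleftrightarrow> f \<in> borel_measurable (completion m) \<and> (\<exists>\<rho>. cwug m p f \<rho>)"

definition Wsp :: "'a::metric_space measure \<Rightarrow> real \<Rightarrow> ('a \<Rightarrow> real) \<Rightarrow> bool" where
  "Wsp m p f \<longleftrightarrow> Dsp m p f \<and> (\<integral>\<^sup>+ x. ennreal (\<bar>f x\<bar> powr p) \<partial>completion m) < \<infinity>"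

definition Linf :: "'a measure \<Rightarrow> ('a \<Rightarrow> real) \<Rightarrow> bool" where
  "Linf m h \<longleftrightarrow> h \<in> borel_measurable m \<and> (\<exists>C. AE x in m. \<bar>h x\<bar> \<le> C)"

definition Lq_pos :: "'a measure \<Rightarrow> ennreal \<Rightarrow> ('a \<Rightarrow> real) \<Rightarrow> bool" where
  "Lq_pos m q g \<longleftrightarrow> g \<in> borel_measurable m \<and> (AE x in m. 0 \<le> g x) \<and>
     (if q = \<infinity> then (\<exists>C. AE x in m. g x \<le> C)
      else (\<integral>\<^sup>+ x. ennreal (\<bar>g x\<bar> powr enn2real q) \<partial>m) < \<infinity>)"

definition mnorm :: "'a measure \<Rightarrow> real \<Rightarrow> ('v \<Rightarrow> 'a \<Rightarrow> real) \<Rightarrow> 'v \<Rightarrow> real" where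
  "mnorm m r pn v = (\<integral> x. \<bar>pn v x\<bar> powr r \<partial>m) powr (1 / r)"

definition msub :: "('v \<Rightarrow> 'v \<Rightarrow> 'v) \<Rightarrow> (('a \<Rightarrow> real) \<Rightarrow> 'v \<Rightarrow> 'v) \<Rightarrow> 'v \<Rightarrow> 'v \<Rightarrow> 'v" where
  "msub add mul v w = add v (mul (\<lambda>_. -1) w)"

definition borel_partition :: "'a measure \<Rightarrow> (nat \<Rightarrow> 'a set) \<Rightarrow> bool" where
  "borel_partition m E \<longleftrightarrow> (\<forall>n. E n \<in> sets m) \<and> disjoint_family E \<and> (\<Union>n. E n) = space m"

definition Linf_module ::
  "'a measure \<Rightarrow> real \<Rightarrow> ('v \<Rightarrow> 'v \<Rightarrow> 'v) \<Rightarrow> 'v \<Rightarrow> (('a \<Rightarrow> real) \<Rightarrow> 'v \<Rightarrow> 'v) \<Rightarrow> ('v \<Rightarrow> 'a \<Rightarrow> real) \<Rightarrow> bool" where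
  "Linf_module m r add zero mul pn \<longleftrightarrow>
     (\<forall>u v w. add (add u v) w = add u (add v w)) \<and>
     (\<forall>u v. add u v = add v u) \<and>
     (\<forall>v. add v zero = v) \<and>
     (\<forall>v. add v (mul (\<lambda>_. -1) v) = zero) \<and>
     (\<forall>h k v. Linf m h \<longrightarrow> Linf m k \<longrightarrow> mul (\<lambda>x. h x + k x) v = add (mul h v) (mul k v)) \<and>
     (\<forall>h v w. Linf m h \<longrightarrow> mul h (add v w) = add (mul h v) (mul h w)) \<and>
     (\<forall>h k v. Linf m h \<longrightarrow> Linf m k \<longrightarrow> mul (\<lambda>x. h x * k x) v = mul h (mul k v)) \<and>
     (\<forall>v. mul (\<lambda>_. 1) v = v) \<and>
     (\<forall>h k v. Linf m h \<longrightarrow> Linf m k \<longrightarrow> (AE x in m. h x = k x) \<longrightarrow> mul h v = mul k v) \<and>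
     (\<forall>v. Lq_pos m (ennreal r) (pn v)) \<and>
     (\<forall>v. (AE x in m. pn v x = 0) \<longrightarrow> v = zero) \<and>
     (\<forall>v w. AE x in m. pn (add v w) x \<le> pn v x + pn w x) \<and>
     (\<forall>h v. Linf m h \<longrightarrow> (AE x in m. pn (mul h v) x = \<bar>h x\<bar> * pn v x)) \<and>
     (\<forall>vs :: nat \<Rightarrow> 'v. (\<forall>e>0. \<exists>N. \<forall>i\<ge>N. \<forall>j\<ge>N. mnorm m r pn (msub add mul (vs i) (vs j)) < e) \<longrightarrow>
        (\<exists>v. (\<lambda>i. mnorm m r pn (msub add mul (vs i) v)) \<longlonglongrightarrow> 0)) \<and>
     (\<forall>E vs. borel_partition m E \<longrightarrow>
        summable (\<lambda>n. mnorm m r pn (mul (indicator (E n)) (vs n)) powr r) \<longrightarrow>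
        (\<exists>v. \<forall>n. mul (indicator (E n)) v = mul (indicator (E n)) (vs n)))"

fun msum :: "('v \<Rightarrow> 'v \<Rightarrow> 'v) \<Rightarrow> 'v \<Rightarrow> (nat \<Rightarrow> 'v) \<Rightarrow> nat \<Rightarrow> 'v" where
  "msum add zero w 0 = zero"
| "msum add zero w (Suc k) = add (msum add zero w k) (w k)"

definition in_dspan where
  "in_dspan m p add zero mul d \<omega> \<longleftrightarrow>
     (\<exists>k c fs. (\<forall>i<k. Dsp m p (fs i)) \<and> \<omega> = msum add zero (\<lambda>i. mul (\<lambda>_. c i) (d (fs i))) k)"

definition glued_dspan where
  "glued_dspan m p add zero mul d w \<longleftrightarrow>
     (\<exists>E \<omega>s. borel_partition m E \<and> (\<forall>n. in_dspan m p add zero mul d (\<omega>s n)) \<and>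
        (\<forall>n. mul (indicator (E n)) w = mul (indicator (E n)) (\<omega>s n)))"

definition cotangent_module ::
  "'a::metric_space measure \<Rightarrow> real \<Rightarrow> ('v \<Rightarrow> 'v \<Rightarrow> 'v) \<Rightarrow> 'v \<Rightarrow> (('a \<Rightarrow> real) \<Rightarrow> 'v \<Rightarrow> 'v) \<Rightarrow>
    ('v \<Rightarrow> 'a \<Rightarrow> real) \<Rightarrow> (('a \<Rightarrow> real) \<Rightarrow> 'v) \<Rightarrow> bool" where
  "cotangent_module m p add zero mul pn d \<longleftrightarrow>
     Linf_module m p add zero mul pn \<and>
     (\<forall>f g. Dsp m p f \<longrightarrow> Dsp m p g \<longrightarrow> d (\<lambda>x. f x + g x) = add (d f) (d g)) \<and>
     (\<forall>f c. Dsp m p f \<longrightarrow> d (\<lambda>x. c * f x) = mul (\<lambda>_. c) (d f)) \<and>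
     (\<forall>f g. Dsp m p f \<longrightarrow> Dsp m p g \<longrightarrow> (AE x in m. f x = g x) \<longrightarrow> d f = d g) \<and>
     (\<forall>f. Dsp m p f \<longrightarrow> (\<exists>G. min_wug m p f G \<and> (AE x in m. ennreal (pn (d f) x) = G x))) \<and>
     (\<forall>v e. e > 0 \<longrightarrow> (\<exists>w. glued_dspan m p add zero mul d w \<and> mnorm m p pn (msub add mul v w) < e))"

definition tangent ::
  "'a measure \<Rightarrow> ennreal \<Rightarrow> ('v \<Rightarrow> 'v \<Rightarrow> 'v) \<Rightarrow> (('a \<Rightarrow> real) \<Rightarrow> 'v \<Rightarrow> 'v) \<Rightarrow> ('v \<Rightarrow> 'a \<Rightarrow> real) \<Rightarrow>
    ('v \<Rightarrow> 'a \<Rightarrow> real) \<Rightarrow> bool" where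
  "tangent m q add mul pn v \<longleftrightarrow>
     (\<forall>\<omega>. integrable m (v \<omega>)) \<and>
     (\<forall>\<omega> \<eta>. AE x in m. v (add \<omega> \<eta>) x = v \<omega> x + v \<eta> x) \<and>
     (\<forall>h \<omega>. Linf m h \<longrightarrow> (AE x in m. v (mul h \<omega>) x = h x * v \<omega> x)) \<and>
     (\<exists>g. Lq_pos m q g \<and> (\<forall>\<omega>. AE x in m. \<bar>v \<omega> x\<bar> \<le> g x * pn \<omega> x))"

definition tan_pnorm where
  "tan_pnorm m q pn v g \<longleftrightarrow>
     Lq_pos m q g \<and> (\<forall>\<omega>. AE x in m. \<bar>v \<omega> x\<bar> \<le> g x * pn \<omega> x) \<and>
     (\<forall>g'. Lq_pos m q g' \<and> (\<forall>\<omega>. AE x in m. \<bar>v \<omega> x\<bar> \<le> g' x * pn \<omega> x) \<longrightarrow> (AE x in m. g x \<le> g' x))"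

definition tan_eq :: "'a measure \<Rightarrow> ('v \<Rightarrow> 'a \<Rightarrow> real) \<Rightarrow> ('v \<Rightarrow> 'a \<Rightarrow> real) \<Rightarrow> bool" where
  "tan_eq m v w \<longleftrightarrow> (\<forall>\<omega>. AE x in m. v \<omega> x = w \<omega> x)"

definition sobder :: "'a::metric_space measure \<Rightarrow> real \<Rightarrow> ennreal \<Rightarrow> (('a \<Rightarrow> real) \<Rightarrow> 'a \<Rightarrow> real) \<Rightarrow> bool" where
  "sobder m p q \<delta> \<longleftrightarrow>
     (\<forall>f. Wsp m p f \<longrightarrow> integrable m (\<delta> f)) \<and>
     (\<forall>f g. Wsp m p f \<longrightarrow> Wsp m p g \<longrightarrow> (AE x in m. \<delta> (\<lambda>y. f y + g y) x = \<delta> f x + \<delta> g x)) \<and>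
     (\<forall>f c. Wsp m p f \<longrightarrow> (AE x in m. \<delta> (\<lambda>y. c * f y) x = c * \<delta> f x)) \<and>
     (\<forall>f g. Wsp m p f \<longrightarrow> Wsp m p g \<longrightarrow> (AE x in m. f x = g x) \<longrightarrow> (AE x in m. \<delta> f x = \<delta> g x)) \<and>
     (\<exists>g. Lq_pos m q g \<and> (\<forall>f G. Wsp m p f \<longrightarrow> min_wug m p f G \<longrightarrow>
        (AE x in m. ennreal \<bar>\<delta> f x\<bar> \<le> ennreal (g x) * G x)))"

definition der_pnorm where
  "der_pnorm m p q \<delta> g \<longleftrightarrow>
     Lq_pos m q g \<and> (\<forall>f G. Wsp m p f \<longrightarrow> min_wug m p f G \<longrightarrow>
        (AE x in m. ennreal \<bar>\<delta> f x\<bar> \<le> ennreal (g x) * G x)) \<and>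
     (\<forall>g'. Lq_pos m q g' \<and> (\<forall>f G. Wsp m p f \<longrightarrow> min_wug m p f G \<longrightarrow>
        (AE x in m. ennreal \<bar>\<delta> f x\<bar> \<le> ennreal (g' x) * G x)) \<longrightarrow> (AE x in m. g x \<le> g' x))"

definition der_eq where
  "der_eq m p \<delta> \<delta>' \<longleftrightarrow> (\<forall>f. Wsp m p f \<longrightarrow> (AE x in m. \<delta> f x = \<delta>' f x))"

definition der_to_tan_iso where
  "der_to_tan_iso m p q add mul pn I \<longleftrightarrow>
     (\<forall>\<delta>. sobder m p q \<delta> \<longrightarrow> tangent m q add mul pn (I \<delta>)) \<and>
     (\<forall>\<delta> \<delta>'. sobder m p q \<delta> \<longrightarrow> sobder m p q \<delta>' \<longrightarrow> der_eq m p \<delta> \<delta>' \<longrightarrow> tan_eq m (I \<delta>) (I \<delta>')) \<and>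
     (\<forall>\<delta> \<delta>'. sobder m p q \<delta> \<longrightarrow> sobder m p q \<delta>' \<longrightarrow>
        tan_eq m (I (\<lambda>f x. \<delta> f x + \<delta>' f x)) (\<lambda>\<omega> x. I \<delta> \<omega> x + I \<delta>' \<omega> x)) \<and>
     (\<forall>\<delta> h. sobder m p q \<delta> \<longrightarrow> Linf m h \<longrightarrow>
        tan_eq m (I (\<lambda>f x. h x * \<delta> f x)) (\<lambda>\<omega> x. h x * I \<delta> \<omega> x)) \<and>
     (\<forall>\<delta> \<delta>'. sobder m p q \<delta> \<longrightarrow> sobder m p q \<delta>' \<longrightarrow> tan_eq m (I \<delta>) (I \<delta>') \<longrightarrow> der_eq m p \<delta> \<delta>') \<and>
     (\<forall>v. tangent m q add mul pn v \<longrightarrow> (\<exists>\<delta>. sobder m p q \<delta> \<and> tan_eq m (I \<delta>) v)) \<and>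
     (\<forall>\<delta> g. sobder m p q \<delta> \<longrightarrow> (der_pnorm m p q \<delta> g \<longleftrightarrow> tan_pnorm m q pn (I \<delta>) g))"

end

theory Submission
  imports Defs
begin

text \<open>Truncating a function of \<open>D\<^sup>1\<^sup>,\<^sup>p\<close> at the height of a cone gives a function of
  \<open>W\<^sup>1\<^sup>,\<^sup>p\<close>; as the minimal weak upper gradient of \<open>h\<close> vanishes on \<open>{h = 0}\<close>, the two
  differentials agree where the functions do. Hence the differentials of \<open>W\<^sup>1\<^sup>,\<^sup>p\<close> functions
  are pointwise dense: for every \<open>\<omega>\<close> there are countably many \<open>f\<^sub>i\<close> with
  \<open>inf\<^sub>i |\<omega> - df\<^sub>i| = 0\<close> almost everywhere. A derivation \<open>\<delta>\<close> with \<open>|\<delta>(f)| \<le> g |Df|\<close> satisfies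
  \<open>|\<delta>(f) - \<delta>(h)| \<le> g |df - dh|\<close>, so it extends by the McShane formula
  \<open>v(\<omega>) = inf\<^sub>i (\<delta>(f\<^sub>i) + g |\<omega> - df\<^sub>i|)\<close>, and \<open>v(\<omega>)\<close> is the only function with
  \<open>|v(\<omega>) - \<delta>(f)| \<le> g |\<omega> - df|\<close> for all \<open>f\<close>. Uniqueness, linearity over \<open>L\<^sup>\<infinity>\<close> and the
  equality of the pointwise norms follow from this estimate and pointwise density.\<close>

section \<open>Length of curves\<close>

text \<open>The cotangent module is generated by differentials of \<open>Dsp\<close>, while a
  derivation sees only \<open>Wsp\<close>; truncation bridges the gap. A cone is convenient because
  truncating needs only |F x - F y| \<le> |f x - f y| + |\<eta> x - \<eta> y| and no Leibniz rule.
  Locality must come from curves: \<open>min_wug\<close> is defined by minimality, so \<rho> cut off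
  to {f \<noteq> 0} has to be exhibited as a weak upper gradient. For that, the increment of f along
  a curve is charged to the part before the first and after the last zero. This requires the
  inequality on all subcurves outside one null family, and a length measure without atoms, hence the
  continuity of arc length. Defining v on glued sums and passing to the limit would call for a check
  of well-definedness; the McShane infimum needs none, at the price that even additivity must be
  recovered from the estimate. Linearity over L^\<infinity> is not assumed of \<delta>: at a fixed x
  the multiplier h is replaced by rational constants tending to h x.\<close>

lemma polygon_le_curve_len:
  assumes "t 0 = a" "t n = b" "\<forall>i<n. t i \<le> t (Suc i)"
  shows "ennreal (\<Sum>i<n. dist (\<gamma> (t i)) (\<gamma> (t (Suc i)))) \<le> curve_len \<gamma> a b"
  unfolding curve_len_def
  by (rule SUP_upper2[where i="(n, t)"]) (use assms in auto)

lemma curve_len_least: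
  assumes "\<And>n t. t 0 = a \<Longrightarrow> t n = b \<Longrightarrow> \<forall>i<n. t i \<le> t (Suc i) \<Longrightarrow>
    ennreal (\<Sum>i<n. dist (\<gamma> (t i)) (\<gamma> (t (Suc i)))) \<le> B"
  shows "curve_len \<gamma> a b \<le> B"
  unfolding curve_len_def
  by (rule SUP_least) (use assms in auto)

lemma partition_mono:
  fixes t :: "nat \<Rightarrow> real"
  assumes "\<forall>i<n. t i \<le> t (Suc i)" "i \<le> j" "j \<le> n"
  shows "t i \<le> t j"
  using assms(2,3)
proof (induction j rule: dec_induct)
  case (step k)
  then show ?case using assms(1) by (meson Suc_le_lessD order_trans less_imp_le)
qed simp

text \<open>Clamping a partition of [a, b] from above and from below at s yields partitions of the
  two halves. Only an interval straddling s is really cut, and there the triangle inequality through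
  \<gamma> s applies.\<close>

lemma curve_len_split_le:
  assumes "a \<le> s" "s \<le> b"
  shows "curve_len \<gamma> a b \<le> curve_len \<gamma> a s + curve_len \<gamma> s b"
proof (rule curve_len_least)
  fix n and t :: "nat \<Rightarrow> real"
  assume t: "t 0 = a" "t n = b" "\<forall>i<n. t i \<le> t (Suc i)"
  let ?l = "\<lambda>i. min s (t i)" and ?r = "\<lambda>i. max s (t i)"
  have tri: "dist (\<gamma> (t i)) (\<gamma> (t (Suc i))) \<le> dist (\<gamma> (?l i)) (\<gamma> (?l (Suc i))) + dist (\<gamma> (?r i)) (\<gamma> (?r (Suc i)))" if "i < n" for i
    using t(3) that dist_triangle[of "\<gamma> (t i)" "\<gamma> (t (Suc i))" "\<gamma> s"]
    by (cases "t i \<le> s"; cases "t (Suc i) \<le> s") (auto simp: min_def max_def)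
  have "ennreal (\<Sum>i<n. dist (\<gamma> (t i)) (\<gamma> (t (Suc i))))
      \<le> ennreal ((\<Sum>i<n. dist (\<gamma> (?l i)) (\<gamma> (?l (Suc i)))) + (\<Sum>i<n. dist (\<gamma> (?r i)) (\<gamma> (?r (Suc i)))))"
    unfolding sum.distrib[symmetric] by (intro ennreal_leI sum_mono tri) auto
  also have "\<dots> = ennreal (\<Sum>i<n. dist (\<gamma> (?l i)) (\<gamma> (?l (Suc i)))) + ennreal (\<Sum>i<n. dist (\<gamma> (?r i)) (\<gamma> (?r (Suc i))))"
    by (intro ennreal_plus sum_nonneg) auto
  also have "\<dots> \<le> curve_len \<gamma> a s + curve_len \<gamma> s b"
    by (intro add_mono polygon_le_curve_len) (use t assms in \<open>auto intro: min.coboundedI2 max.coboundedI2\<close>)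
  finally show "ennreal (\<Sum>i<n. dist (\<gamma> (t i)) (\<gamma> (t (Suc i)))) \<le> curve_len \<gamma> a s + curve_len \<gamma> s b" .
qed

text \<open>Partitions of the two halves concatenate. Both sets of partitions are nonempty, which is
  what lets the two suprema be pulled out of the sum in \<open>ennreal\<close>.\<close>

lemma curve_len_split_ge:
  assumes "a \<le> s" "s \<le> b"
  shows "curve_len \<gamma> a s + curve_len \<gamma> s b \<le> curve_len \<gamma> a b"
proof -
  define P where "P a b = {(n::nat, t::nat \<Rightarrow> real). t 0 = a \<and> t n = b \<and> (\<forall>i<n. t i \<le> t (Suc i))}" for a b
  define S where "S nt = ennreal (\<Sum>i<fst nt. dist (\<gamma> (snd nt i)) (\<gamma> (snd nt (Suc i))))" for nt :: "nat \<times> (nat \<Rightarrow> real)"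
  have len: "curve_len \<gamma> a b = (SUP nt\<in>P a b. S nt)" for a b
    by (simp add: curve_len_def P_def S_def)
  have ne: "P x y \<noteq> {}" if "x \<le> y" for x y
    using that by (auto simp: P_def intro!: exI[of _ 1] exI[of _ "\<lambda>i. if i = 0 then x else y"])
  have concat: "S nt + S nt' \<le> curve_len \<gamma> a b" if "nt \<in> P a s" "nt' \<in> P s b" for nt nt'
  proof -
    obtain n t n' t' where nt: "nt = (n, t)" "nt' = (n', t')" by (metis surj_pair)
    with that have t: "t 0 = a" "t n = s" "\<forall>i<n. t i \<le> t (Suc i)"
      and t': "t' 0 = s" "t' n' = b" "\<forall>i<n'. t' i \<le> t' (Suc i)" by (auto simp: P_def)
    \<comment> \<open>The node with index n is shared: \<open>t n\<close> and \<open>t' 0\<close>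
      are both s, so the second partition continues at n without a repeated point.\<close>
    define u where "u i = (if i \<le> n then t i else t' (i - n))" for i
    have u': "u (n + i) = t' i" for i using t t' by (auto simp: u_def)
    have split: "(\<Sum>i<n+k. f i) = (\<Sum>i<n. f i) + (\<Sum>i<k. f (n + i))" for k and f :: "nat \<Rightarrow> real"
      by (induction k) auto
    have le: "u i \<le> u (Suc i)" if "i < n + n'" for i
    proof (cases "i < n")
      case True then show ?thesis using t by (auto simp: u_def)
    next
      case False
      then obtain k where "i = n + k" by (metis le_add_diff_inverse not_less)
      then show ?thesis using u'[of k] u'[of "Suc k"] t'(3) that by auto
    qed
    have "S nt + S nt' = ennreal (\<Sum>i<n+n'. dist (\<gamma> (u i)) (\<gamma> (u (Suc i))))"
      unfolding split u' add_Suc_right[symmetric]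
      by (subst ennreal_plus) (auto simp: S_def nt u_def sum_nonneg)
    also have "\<dots> \<le> curve_len \<gamma> a b"
      using le t t' u'[of n'] by (intro polygon_le_curve_len) (auto simp: u_def)
    finally show ?thesis .
  qed
  have "curve_len \<gamma> a s + curve_len \<gamma> s b = (SUP nt\<in>P a s. S nt + curve_len \<gamma> s b)"
    unfolding len[of a s] by (rule ennreal_SUP_add_left[OF ne[OF assms(1)], symmetric])
  also have "\<dots> = (SUP nt\<in>P a s. SUP nt'\<in>P s b. S nt + S nt')"
    unfolding len[of s b] by (simp only: ennreal_SUP_add_right[OF ne[OF assms(2)]])
  also have "\<dots> \<le> curve_len \<gamma> a b"
    by (intro SUP_least concat)
  finally show ?thesis .
qed

lemma curve_len_additive:
  assumes "a \<le> s" "s \<le> b"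
  shows "curve_len \<gamma> a b = curve_len \<gamma> a s + curve_len \<gamma> s b"
  using curve_len_split_le curve_len_split_ge assms by (intro antisym)

lemma curve_len_mono:
  assumes "a \<le> s" "s \<le> t" "t \<le> b"
  shows "curve_len \<gamma> s t \<le> curve_len \<gamma> a b"
proof -
  have "curve_len \<gamma> a b = curve_len \<gamma> a s + (curve_len \<gamma> s t + curve_len \<gamma> t b)"
    using assms by (simp add: curve_len_additive[of a s b] curve_len_additive[of s t b])
  then show ?thesis
    by (metis add.left_commute le_iff_add)
qed

lemma rect_subcurve:
  assumes "rect_curve (a, b, \<gamma>)" "a \<le> s" "s < t" "t \<le> b"
  shows "rect_curve (s, t, \<gamma>)"
  using assms curve_len_mono[of a s t b \<gamma>]
  by (auto simp: rect_curve_def intro: continuous_on_subset elim: order.strict_trans1)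

lemma real_curve_len_additive:
  assumes "curve_len \<gamma> a b < \<infinity>" "a \<le> r" "r \<le> s" "s \<le> t" "t \<le> b"
  shows "enn2real (curve_len \<gamma> r t) = enn2real (curve_len \<gamma> r s) + enn2real (curve_len \<gamma> s t)"
proof -
  have "curve_len \<gamma> r s < \<infinity>" "curve_len \<gamma> s t < \<infinity>"
    using curve_len_mono[of a r s b \<gamma>] curve_len_mono[of a s t b \<gamma>] assms by (auto elim: order.strict_trans1)
  then show ?thesis
    using assms by (simp add: curve_len_additive[of r s t] enn2real_plus less_top)
qed

text \<open>If the length is below e, the target is negative and \<open>ennreal\<close> would
  truncate it to 0; there the two-point partition serves. Otherwise the target is nonnegative and
  cannot bound the supremum.\<close>

lemma exists_near_optimal_partition:
  assumes "curve_len \<gamma> a b < \<infinity>" "a \<le> b" "0 < e"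
  obtains n t where "t 0 = a" "t n = b" "\<forall>i<n. t i \<le> t (Suc i)"
    "enn2real (curve_len \<gamma> a b) - e < (\<Sum>i<n. dist (\<gamma> (t i)) (\<gamma> (t (Suc i))))"
proof (cases "enn2real (curve_len \<gamma> a b) < e")
  case True
  then show thesis
    using assms(2) zero_le_dist[of "\<gamma> a" "\<gamma> b"]
    by (intro that[of "\<lambda>i. if i = 0 then a else b" 1]) (auto simp del: zero_le_dist)
next
  case False
  have "\<not> curve_len \<gamma> a b \<le> ennreal (enn2real (curve_len \<gamma> a b) - e)"
  proof
    assume "curve_len \<gamma> a b \<le> ennreal (enn2real (curve_len \<gamma> a b) - e)"
    then have "enn2real (curve_len \<gamma> a b) \<le> enn2real (ennreal (enn2real (curve_len \<gamma> a b) - e))"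
      by (intro enn2real_mono) auto
    then show False using assms False by simp
  qed
  then obtain n t where "t 0 = a" "t n = b" "\<forall>i<n. t i \<le> t (Suc i)"
    "\<not> ennreal (\<Sum>i<n. dist (\<gamma> (t i)) (\<gamma> (t (Suc i)))) \<le> ennreal (enn2real (curve_len \<gamma> a b) - e)"
    using curve_len_least[of a b \<gamma> "ennreal (enn2real (curve_len \<gamma> a b) - e)"] by blast
  then show thesis
    using ennreal_leI by (intro that[of t n]) (auto simp: not_le[symmetric])
qed

text \<open>Clamping the parameter makes arc length constant outside [a, b], hence a monotone
  function on the whole line; it is the integrator inside \<open>line_int\<close>.\<close>

definition arc_fun :: "(real \<Rightarrow> 'a::metric_space) \<Rightarrow> real \<Rightarrow> real \<Rightarrow> real \<Rightarrow> real" where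
  "arc_fun \<gamma> a b u = enn2real (curve_len \<gamma> a (min b (max a u)))"

lemma arc_fun_diff:
  assumes "rect_curve (a, b, \<gamma>)" "a \<le> s" "s \<le> t" "t \<le> b"
  shows "arc_fun \<gamma> a b t - arc_fun \<gamma> a b s = enn2real (curve_len \<gamma> s t)"
  using real_curve_len_additive[of \<gamma> a b a s t] assms
  by (auto simp: arc_fun_def rect_curve_def)

lemma arc_fun_clamp: "a \<le> b \<Longrightarrow> arc_fun \<gamma> a b (min b (max a u)) = arc_fun \<gamma> a b u"
  by (simp add: arc_fun_def)

lemma arc_fun_mono:
  assumes "rect_curve (a, b, \<gamma>)" "u \<le> v"
  shows "arc_fun \<gamma> a b u \<le> arc_fun \<gamma> a b v"
proof -
  have ab: "a \<le> b" using assms by (simp add: rect_curve_def)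
  have "arc_fun \<gamma> a b (min b (max a v)) - arc_fun \<gamma> a b (min b (max a u)) \<ge> 0"
    using assms(2) ab by (subst arc_fun_diff[OF assms(1)]) auto
  then show ?thesis unfolding arc_fun_clamp[OF ab] by simp
qed

text \<open>For a fixed partition the polygonal length of the curve clamped to \<open>[v, b]\<close> (or \<open>[a, v]\<close>)
  is continuous in \<open>v\<close>, so length is lower semicontinuous in the endpoint; together with
  additivity this excludes jumps.\<close>

lemma curve_len_small_right:
  assumes c: "rect_curve (a, b, \<gamma>)" and s: "a \<le> s" "s \<le> b" and e: "0 < e"
  shows "\<exists>d>0. \<forall>v. s \<le> v \<and> v \<le> b \<and> v < s + d \<longrightarrow> enn2real (curve_len \<gamma> s v) < e"
proof -
  have cont: "continuous_on {a..b} \<gamma>" and fin: "curve_len \<gamma> s b < \<infinity>"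
    using c curve_len_mono[of a s b b \<gamma>] s by (auto simp: rect_curve_def elim: order.strict_trans1)
  obtain n t where t: "t 0 = s" "t n = b" "\<forall>i<n. t i \<le> t (Suc i)"
    and sum: "enn2real (curve_len \<gamma> s b) - e < (\<Sum>i<n. dist (\<gamma> (t i)) (\<gamma> (t (Suc i))))"
    using exists_near_optimal_partition[OF fin s(2) e] by blast
  have tb: "s \<le> t i \<and> t i \<le> b" if "i \<le> n" for i
    using partition_mono[of n t 0 i] partition_mono[of n t i n] t that by auto
  define \<phi> where "\<phi> v = (\<Sum>i<n. dist (\<gamma> (max v (t i))) (\<gamma> (max v (t (Suc i)))))" for v
  have "continuous_on {s..b} (\<lambda>v. \<gamma> (max v (t i)))" if "i \<le> n" for i
    using tb[OF that] s by (intro continuous_on_compose2[OF cont] continuous_intros) auto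
  then have cont_\<phi>: "continuous_on {s..b} \<phi>"
    unfolding \<phi>_def by (intro continuous_on_sum continuous_on_dist) simp_all
  have "\<phi> s = (\<Sum>i<n. dist (\<gamma> (t i)) (\<gamma> (t (Suc i))))"
    unfolding \<phi>_def by (intro sum.cong) (simp_all add: max_absorb2 tb)
  then have pos: "0 < \<phi> s - (enn2real (curve_len \<gamma> s b) - e)" using sum by simp
  have "s \<in> {s..b}" using s by simp
  from cont_\<phi>[unfolded continuous_on_iff, THEN bspec, OF this, THEN spec, THEN mp, OF pos]
  obtain d where d: "d > 0"
    "\<forall>v\<in>{s..b}. dist v s < d \<longrightarrow> dist (\<phi> v) (\<phi> s) < \<phi> s - (enn2real (curve_len \<gamma> s b) - e)"
    by blast
  show ?thesis
  proof (intro exI[of _ d] conjI allI impI d(1))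
    fix v assume v: "s \<le> v \<and> v \<le> b \<and> v < s + d"
    then have "\<phi> v > enn2real (curve_len \<gamma> s b) - e"
      using d(2)[rule_format, of v] by (auto simp: dist_real_def)
    moreover have "ennreal (\<phi> v) \<le> curve_len \<gamma> v b"
      unfolding \<phi>_def by (intro polygon_le_curve_len) (use t v in \<open>auto intro: max.coboundedI2\<close>)
    then have "\<phi> v \<le> enn2real (curve_len \<gamma> v b)"
      using curve_len_mono[of s v b b \<gamma>] v fin enn2real_mono[of "ennreal (\<phi> v)" "curve_len \<gamma> v b"]
      by (auto simp: \<phi>_def sum_nonneg order.strict_trans1)
    ultimately show "enn2real (curve_len \<gamma> s v) < e"
      using real_curve_len_additive[of \<gamma> s b s v b] fin v by auto
  qed
qed

lemma curve_len_small_left: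
  assumes c: "rect_curve (a, b, \<gamma>)" and s: "a \<le> s" "s \<le> b" and e: "0 < e"
  shows "\<exists>d>0. \<forall>v. a \<le> v \<and> v \<le> s \<and> s - d < v \<longrightarrow> enn2real (curve_len \<gamma> v s) < e"
proof -
  have cont: "continuous_on {a..b} \<gamma>" and fin: "curve_len \<gamma> a s < \<infinity>"
    using c curve_len_mono[of a a s b \<gamma>] s by (auto simp: rect_curve_def elim: order.strict_trans1)
  obtain n t where t: "t 0 = a" "t n = s" "\<forall>i<n. t i \<le> t (Suc i)"
    and sum: "enn2real (curve_len \<gamma> a s) - e < (\<Sum>i<n. dist (\<gamma> (t i)) (\<gamma> (t (Suc i))))"
    using exists_near_optimal_partition[OF fin s(1) e] by blast
  have tb: "a \<le> t i \<and> t i \<le> s" if "i \<le> n" for i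
    using partition_mono[of n t 0 i] partition_mono[of n t i n] t that by auto
  define \<phi> where "\<phi> v = (\<Sum>i<n. dist (\<gamma> (min v (t i))) (\<gamma> (min v (t (Suc i)))))" for v
  have "continuous_on {a..s} (\<lambda>v. \<gamma> (min v (t i)))" if "i \<le> n" for i
    using tb[OF that] s by (intro continuous_on_compose2[OF cont] continuous_intros) auto
  then have cont_\<phi>: "continuous_on {a..s} \<phi>"
    unfolding \<phi>_def by (intro continuous_on_sum continuous_on_dist) simp_all
  have "\<phi> s = (\<Sum>i<n. dist (\<gamma> (t i)) (\<gamma> (t (Suc i))))"
    unfolding \<phi>_def by (intro sum.cong) (simp_all add: min_absorb2 tb)
  then have pos: "0 < \<phi> s - (enn2real (curve_len \<gamma> a s) - e)" using sum by simp
  have "s \<in> {a..s}" using s by simp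
  from cont_\<phi>[unfolded continuous_on_iff, THEN bspec, OF this, THEN spec, THEN mp, OF pos]
  obtain d where d: "d > 0"
    "\<forall>v\<in>{a..s}. dist v s < d \<longrightarrow> dist (\<phi> v) (\<phi> s) < \<phi> s - (enn2real (curve_len \<gamma> a s) - e)"
    by blast
  show ?thesis
  proof (intro exI[of _ d] conjI allI impI d(1))
    fix v assume v: "a \<le> v \<and> v \<le> s \<and> s - d < v"
    then have "\<phi> v > enn2real (curve_len \<gamma> a s) - e"
      using d(2)[rule_format, of v] by (auto simp: dist_real_def)
    moreover have "ennreal (\<phi> v) \<le> curve_len \<gamma> a v"
      unfolding \<phi>_def by (intro polygon_le_curve_len) (use t v in \<open>auto intro: min.coboundedI2\<close>)
    then have "\<phi> v \<le> enn2real (curve_len \<gamma> a v)"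
      using curve_len_mono[of a a v s \<gamma>] v fin enn2real_mono[of "ennreal (\<phi> v)" "curve_len \<gamma> a v"]
      by (auto simp: \<phi>_def sum_nonneg order.strict_trans1)
    ultimately show "enn2real (curve_len \<gamma> v s) < e"
      using real_curve_len_additive[of \<gamma> a s a v s] fin v by auto
  qed
qed

text \<open>Continuity serves twice: from the right it makes the Stieltjes measure of
  \<open>{x<..y}\<close> equal to the increment, and in full it excludes atoms.\<close>

lemma continuous_arc_fun:
  assumes c: "rect_curve (a, b, \<gamma>)"
  shows "continuous_on UNIV (arc_fun \<gamma> a b)"
proof -
  have ab: "a \<le> b" using c by (simp add: rect_curve_def)
  have "continuous_on {a..b} (arc_fun \<gamma> a b)"
    unfolding continuous_on_iff
  proof (intro ballI allI impI)
    fix s e :: real assume s: "s \<in> {a..b}" and e: "0 < e"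
    obtain d1 where d1: "d1 > 0" "\<And>v. s \<le> v \<Longrightarrow> v \<le> b \<Longrightarrow> v < s + d1 \<Longrightarrow> enn2real (curve_len \<gamma> s v) < e"
      using curve_len_small_right[OF c _ _ e, of s] s by auto
    obtain d2 where d2: "d2 > 0" "\<And>v. a \<le> v \<Longrightarrow> v \<le> s \<Longrightarrow> s - d2 < v \<Longrightarrow> enn2real (curve_len \<gamma> v s) < e"
      using curve_len_small_left[OF c _ _ e, of s] s by auto
    have "dist (arc_fun \<gamma> a b v) (arc_fun \<gamma> a b s) < e" if "v \<in> {a..b}" "dist v s < min d1 d2" for v
      using arc_fun_diff[OF c, of s v] arc_fun_diff[OF c, of v s] d1(2)[of v] d2(2)[of v] that s
      by (cases "s \<le> v") (auto simp: dist_real_def abs_minus_commute)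
    then show "\<exists>d>0. \<forall>v\<in>{a..b}. dist v s < d \<longrightarrow> dist (arc_fun \<gamma> a b v) (arc_fun \<gamma> a b s) < e"
      using d1(1) d2(1) by (intro exI[of _ "min d1 d2"]) auto
  qed
  then have "continuous_on UNIV (\<lambda>u. arc_fun \<gamma> a b (min b (max a u)))"
    by (rule continuous_on_compose2) (use ab in \<open>auto intro!: continuous_intros\<close>)
  then show ?thesis unfolding arc_fun_clamp[OF ab] .
qed

section \<open>The arc-length measure of a curve and of its subcurves\<close>

definition arc_measure :: "(real \<Rightarrow> 'a::metric_space) \<Rightarrow> real \<Rightarrow> real \<Rightarrow> real measure" where
  "arc_measure \<gamma> a b = interval_measure (arc_fun \<gamma> a b)"

lemma sets_arc_measure [simp, measurable_cong]: "sets (arc_measure \<gamma> a b) = sets borel"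
  and space_arc_measure [simp]: "space (arc_measure \<gamma> a b) = UNIV"
  by (simp_all add: arc_measure_def)

lemma emeasure_arc_measure_Ioc:
  assumes "rect_curve (a, b, \<gamma>)" "x \<le> y"
  shows "emeasure (arc_measure \<gamma> a b) {x<..y} = ennreal (arc_fun \<gamma> a b y - arc_fun \<gamma> a b x)"
proof -
  have "continuous (at_right x) (arc_fun \<gamma> a b)" for x
  proof -
    have "continuous (at x) (arc_fun \<gamma> a b)"
      using continuous_arc_fun[OF assms(1)] by (simp add: continuous_on_eq_continuous_at)
    then show ?thesis by (rule continuous_at_imp_continuous_within)
  qed
  then show ?thesis
    unfolding arc_measure_def using assms
    by (intro emeasure_interval_measure_Ioc arc_fun_mono)
qed

lemma emeasure_arc_measure_singleton:
  assumes "rect_curve (a, b, \<gamma>)"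
  shows "emeasure (arc_measure \<gamma> a b) {x} = 0"
  using emeasure_interval_measure_Icc[of x x "arc_fun \<gamma> a b"] continuous_arc_fun[OF assms] arc_fun_mono[OF assms]
  by (simp add: arc_measure_def)

text \<open>The line integral over a subcurve is defined with its own integrator; this puts all
  subcurves of a curve on one measure. Half-open intervals are an intersection-stable generator, and
  on them both measures give the length between clamped endpoints.\<close>

lemma arc_measure_subcurve:
  assumes c: "rect_curve (a, b, \<gamma>)" and st: "a \<le> s" "s < t" "t \<le> b"
  shows "arc_measure \<gamma> s t = density (arc_measure \<gamma> a b) (indicator {s<..t})"
proof (rule measure_eqI_generator_eq[where E="range (\<lambda>(x, y). {x<..y})" and \<Omega>=UNIV
      and A="\<lambda>n. {- real n<..real n}"])
  have c': "rect_curve (s, t, \<gamma>)" using rect_subcurve[OF c st] .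
  show "Int_stable (range (\<lambda>(x, y). {x<..y::real}))"
    by (auto simp: Int_stable_def)
  show "emeasure (arc_measure \<gamma> s t) X = emeasure (density (arc_measure \<gamma> a b) (indicator {s<..t})) X"
    if X: "X \<in> range (\<lambda>(x, y). {x<..y})" for X
  proof -
    obtain x y where xy: "X = {x<..y}" using X by auto
    show ?thesis
    proof (cases "x \<le> y")
      case True
      \<comment> \<open>Clamping the endpoints to [s, t] intersects \<open>{x<..y}\<close> with
        \<open>{s<..t}\<close>; for disjoint intervals the clamped endpoints coincide and the result
        is empty.\<close>
      let ?cl = "\<lambda>u. min t (max s u)"
      have "?cl x \<le> ?cl y" using True by auto
      have "emeasure (density (arc_measure \<gamma> a b) (indicator {s<..t})) X = emeasure (arc_measure \<gamma> a b) ({s<..t} \<inter> {x<..y})"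
        unfolding xy by (subst emeasure_density) (auto simp: indicator_inter_arith[symmetric])
      also have "{s<..t} \<inter> {x<..y} = {?cl x<..?cl y}" using st by (auto simp: min_def max_def)
      also have "emeasure (arc_measure \<gamma> a b) \<dots> = ennreal (arc_fun \<gamma> a b (?cl y) - arc_fun \<gamma> a b (?cl x))"
        using \<open>?cl x \<le> ?cl y\<close> by (intro emeasure_arc_measure_Ioc c)
      also have "arc_fun \<gamma> a b (?cl y) - arc_fun \<gamma> a b (?cl x) = enn2real (curve_len \<gamma> (?cl x) (?cl y))"
        using st \<open>?cl x \<le> ?cl y\<close> by (intro arc_fun_diff c) auto
      also have "\<dots> = arc_fun \<gamma> s t (?cl y) - arc_fun \<gamma> s t (?cl x)"
        using st \<open>?cl x \<le> ?cl y\<close> by (intro arc_fun_diff[symmetric] c') auto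
      also have "\<dots> = arc_fun \<gamma> s t y - arc_fun \<gamma> s t x" using st by (simp add: arc_fun_clamp)
      also have "ennreal \<dots> = emeasure (arc_measure \<gamma> s t) X"
        unfolding xy by (rule emeasure_arc_measure_Ioc[OF c' True, symmetric])
      finally show ?thesis by simp
    qed (simp add: xy)
  qed
  show "(\<Union>n. {- real n<..real n}) = UNIV"
  proof (rule UNIV_eq_I[symmetric])
    fix x :: real
    obtain n where "\<bar>x\<bar> < real n" using reals_Archimedean2 by blast
    then have "x \<in> {- real n<..real n}" by auto
    then show "x \<in> (\<Union>n. {- real n<..real n})" by (rule UN_I[OF UNIV_I])
  qed
  show "emeasure (arc_measure \<gamma> s t) {- real n<..real n} \<noteq> \<infinity>" for n
    by (subst emeasure_arc_measure_Ioc[OF c']) auto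
qed (auto simp: borel_sigma_sets_Ioc)

lemma line_int_arc_measure:
  "line_int \<rho> (a, b, \<gamma>) = (\<integral>\<^sup>+ t. \<rho> (\<gamma> t) * indicator {a..b} t \<partial>arc_measure \<gamma> a b)"
  by (simp add: line_int_def arc_measure_def arc_fun_def[abs_def])

text \<open>Outside \<open>{a..b}\<close> the curve is an arbitrary function, so measurability is
  available only after the cut-off; this is why the integrands carry an indicator.\<close>

lemma measurable_along_curve:
  fixes a b :: real
  assumes "continuous_on {a..b} \<gamma>" "\<rho> \<in> borel_measurable borel"
  shows "(\<lambda>t. \<rho> (\<gamma> t) * indicator {a..b} t :: ennreal) \<in> borel_measurable borel"
proof -
  have "(\<lambda>t. \<rho> (\<gamma> t)) \<in> borel_measurable (restrict_space borel {a..b})"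
    using borel_measurable_continuous_on_restrict[OF assms(1)] assms(2)
    by (rule measurable_compose)
  then show ?thesis by (subst (asm) borel_measurable_restrict_space_iff_ennreal) (simp_all add: closed_atLeastAtMost borel_closed)
qed

lemma line_int_subcurve:
  assumes c: "rect_curve (a, b, \<gamma>)" and st: "a \<le> s" "s < t" "t \<le> b"
    and \<rho>: "\<rho> \<in> borel_measurable borel"
  shows "line_int \<rho> (s, t, \<gamma>) = (\<integral>\<^sup>+ u. \<rho> (\<gamma> u) * indicator {s..t} u \<partial>arc_measure \<gamma> a b)"
proof -
  have "continuous_on {s..t} \<gamma>"
    using rect_subcurve[OF c st] by (simp add: rect_curve_def)
  from measurable_along_curve[OF this \<rho>]
  have [measurable]: "(\<lambda>u. \<rho> (\<gamma> u) * indicator {s..t} u) \<in> borel_measurable borel" .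
  have "line_int \<rho> (s, t, \<gamma>) = (\<integral>\<^sup>+ u. indicator {s<..t} u * (\<rho> (\<gamma> u) * indicator {s..t} u) \<partial>arc_measure \<gamma> a b)"
    unfolding line_int_arc_measure arc_measure_subcurve[OF c st]
    by (rule nn_integral_density) auto
  also have "\<dots> = (\<integral>\<^sup>+ u. \<rho> (\<gamma> u) * indicator {s..t} u \<partial>arc_measure \<gamma> a b)"
  proof (rule nn_integral_cong_AE)
    \<comment> \<open>The density lives on \<open>{s<..t}\<close> and the integrand on
      \<open>{s..t}\<close>; they differ only at s, which carries no arc length.\<close>
    have "AE u in arc_measure \<gamma> a b. u \<noteq> s"
      using emeasure_arc_measure_singleton[OF c, of s] by (intro AE_I[where N="{s}"]) auto
    then show "AE u in arc_measure \<gamma> a b. indicator {s<..t} u * (\<rho> (\<gamma> u) * indicator {s..t} u) = \<rho> (\<gamma> u) * indicator {s..t} u"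
      by eventually_elim (auto simp: indicator_def)
  qed
  finally show ?thesis .
qed

section \<open>Modulus of curve families\<close>

lemma epowr_mono: "x \<le> y \<Longrightarrow> 0 \<le> p \<Longrightarrow> epowr x p \<le> epowr y p"
  by (auto simp: epowr_def top_unique less_top intro!: ennreal_leI powr_mono2 enn2real_mono)

lemma epowr_0 [simp]: "epowr 0 p = 0"
  by (simp add: epowr_def)

lemma epowr_measurable [measurable (raw)]:
  assumes [measurable]: "f \<in> borel_measurable M"
  shows "(\<lambda>x. epowr (f x) p) \<in> borel_measurable M"
  unfolding epowr_def by measurable

lemma epowr_max_le: "epowr (max x y) p \<le> epowr x p + epowr y p"
  by (simp add: max_def)

lemma epowr_cmult:
  assumes "0 < c" 
  shows "epowr (ennreal c * x) p = ennreal (c powr p) * epowr x p"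
proof (cases x)
  case (real r)
  then have "ennreal c * x = ennreal (c * r)" using assms by (simp add: ennreal_mult)
  then have "epowr (ennreal c * x) p = ennreal (c powr p * r powr p)"
    using assms real by (simp add: epowr_def powr_mult)
  also have "\<dots> = ennreal (c powr p) * epowr x p"
    using real by (simp add: epowr_def ennreal_mult)
  finally show ?thesis .
next
  case top
  moreover have "ennreal c * top = top" "ennreal (c powr p) * top = top"
    using assms by (simp_all add: ennreal_mult_top)
  ultimately show ?thesis by (simp add: epowr_def)
qed

text \<open>A crude substitute for convexity, through \<open>x + y \<le> 2 * max x y\<close>. The
  constant is irrelevant, since the bound is used only for finiteness.\<close>

lemma epowr_add_le:
  assumes "0 \<le> p"
  shows "epowr (x + y) p \<le> ennreal (2 powr p) * (epowr x p + epowr y p)"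
proof -
  have "x + y \<le> ennreal 2 * max x y"
    by (simp add: mult_2 add_mono)
  then have "epowr (x + y) p \<le> epowr (ennreal 2 * max x y) p"
    using assms by (rule epowr_mono)
  also have "\<dots> = ennreal (2 powr p) * epowr (max x y) p" by (rule epowr_cmult) simp
  also have "\<dots> \<le> ennreal (2 powr p) * (epowr x p + epowr y p)"
    by (intro mult_left_mono epowr_max_le) simp
  finally show ?thesis .
qed

section \<open>Families of curves of zero modulus\<close>

lemma Mod_null_iff:
  "Mod m p \<Gamma> = 0 \<longleftrightarrow> (\<forall>e>0. \<exists>\<rho>\<in>borel_measurable borel. (\<forall>c\<in>\<Gamma>. 1 \<le> line_int \<rho> c) \<and> (\<integral>\<^sup>+x. epowr (\<rho> x) p \<partial>m) < e)"
proof -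
  have "Mod m p \<Gamma> = 0 \<longleftrightarrow> (\<forall>e>0. Mod m p \<Gamma> < e)"
    by (metis not_gr_zero order_less_irrefl)
  then show ?thesis unfolding Mod_def INF_less_iff by blast
qed

lemma line_int_mono:
  assumes "\<And>x. \<rho> x \<le> \<sigma> x"
  shows "line_int \<rho> c \<le> line_int \<sigma> c"
  by (cases c) (auto simp: line_int_arc_measure intro!: nn_integral_mono mult_right_mono assms)

lemma line_int_cmult:
  assumes "rect_curve c" "\<rho> \<in> borel_measurable borel"
  shows "line_int (\<lambda>x. k * \<rho> x) c = k * line_int \<rho> c"
proof -
  obtain a b \<gamma> where c: "c = (a, b, \<gamma>)" by (cases c)
  then have "continuous_on {a..b} \<gamma>" using assms by (simp add: rect_curve_def)
  from measurable_along_curve[OF this assms(2)] show ?thesis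
    unfolding c line_int_arc_measure by (simp add: mult.assoc nn_integral_cmult)
qed

text \<open>The maximum of one density for each family is admissible for the union, and its energy
  is at most the sum of the two.\<close>

lemma Mod_null_Un:
  assumes m: "sets m = sets borel" and "Mod m p \<Gamma>1 = 0" "Mod m p \<Gamma>2 = 0"
  shows "Mod m p (\<Gamma>1 \<union> \<Gamma>2) = 0"
  unfolding Mod_null_iff
proof (intro allI impI)
  note [measurable_cong] = m
  fix e :: ennreal assume "0 < e"
  then have e2: "0 < e / 2" by (simp add: ennreal_zero_less_divide)
  obtain \<rho>1 where r1[measurable]: "\<rho>1 \<in> borel_measurable borel" and 1: "\<forall>c\<in>\<Gamma>1. 1 \<le> line_int \<rho>1 c" "(\<integral>\<^sup>+x. epowr (\<rho>1 x) p \<partial>m) < e / 2"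
    using assms(2) e2 unfolding Mod_null_iff by blast
  obtain \<rho>2 where r2[measurable]: "\<rho>2 \<in> borel_measurable borel" and 2: "\<forall>c\<in>\<Gamma>2. 1 \<le> line_int \<rho>2 c" "(\<integral>\<^sup>+x. epowr (\<rho>2 x) p \<partial>m) < e / 2"
    using assms(3) e2 unfolding Mod_null_iff by blast
  have "(\<integral>\<^sup>+x. epowr (max (\<rho>1 x) (\<rho>2 x)) p \<partial>m) \<le> (\<integral>\<^sup>+x. epowr (\<rho>1 x) p + epowr (\<rho>2 x) p \<partial>m)"
    by (intro nn_integral_mono epowr_max_le)
  also have "\<dots> = (\<integral>\<^sup>+x. epowr (\<rho>1 x) p \<partial>m) + (\<integral>\<^sup>+x. epowr (\<rho>2 x) p \<partial>m)"
    by (intro nn_integral_add) measurable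
  also have "\<dots> < e / 2 + e / 2" using 1 2 by (intro add_strict_mono)
  also have "\<dots> = e" by (cases e) (auto simp: ennreal_divide_numeral ennreal_top_divide simp flip: ennreal_plus)
  finally have "(\<integral>\<^sup>+x. epowr (max (\<rho>1 x) (\<rho>2 x)) p \<partial>m) < e" .
  moreover have "\<forall>c\<in>\<Gamma>1 \<union> \<Gamma>2. 1 \<le> line_int (\<lambda>x. max (\<rho>1 x) (\<rho>2 x)) c"
    using 1 2 line_int_mono[of \<rho>1 "\<lambda>x. max (\<rho>1 x) (\<rho>2 x)"] line_int_mono[of \<rho>2 "\<lambda>x. max (\<rho>1 x) (\<rho>2 x)"]
    by (auto intro: order_trans)
  ultimately show "\<exists>\<rho>\<in>borel_measurable borel. (\<forall>c\<in>\<Gamma>1 \<union> \<Gamma>2. 1 \<le> line_int \<rho> c) \<and> (\<integral>\<^sup>+x. epowr (\<rho> x) p \<partial>m) < e"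
    by (intro bexI[of _ "\<lambda>x. max (\<rho>1 x) (\<rho>2 x)"]) auto
qed

text \<open>Every positive multiple of \<rho> is admissible for this family, and small multiples
  have arbitrarily small energy.\<close>

lemma Mod_null_line_int_infinite:
  assumes m: "sets m = sets borel" and p: "0 < p"
    and \<rho>[measurable]: "\<rho> \<in> borel_measurable borel" and fin: "(\<integral>\<^sup>+x. epowr (\<rho> x) p \<partial>m) < \<infinity>"
  shows "Mod m p {c. rect_curve c \<and> line_int \<rho> c = \<infinity>} = 0"
  unfolding Mod_null_iff
proof (intro allI impI)
  note [measurable_cong] = m
  fix e :: ennreal assume e: "0 < e"
  define I where "I = (\<integral>\<^sup>+x. epowr (\<rho> x) p \<partial>m)"
  obtain r where r: "I = ennreal r" "0 \<le> r" using fin by (cases I) (auto simp: I_def)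
  obtain e' where e': "0 < e'" "ennreal e' \<le> e"
    using e by (cases e) (auto intro: that[of 1])
  \<comment> \<open>Chosen so that \<open>k powr p\<close> times the energy r stays below e';
    dividing by r + 1 covers r = 0 and makes the inequality strict.\<close>
  define k where "k = (e' / (r + 1)) powr (1/p)"
  have k: "0 < k" using r e' by (auto simp: k_def)
  have kp: "k powr p = e' / (r + 1)" using p r e' by (simp add: k_def powr_powr)
  have "(\<integral>\<^sup>+x. epowr (ennreal k * \<rho> x) p \<partial>m) = ennreal (k powr p) * I"
    unfolding epowr_cmult[OF k] I_def by (intro nn_integral_cmult) measurable
  also have "\<dots> = ennreal (e' / (r + 1) * r)"
    unfolding kp r(1) using r(2) e'(1) by (intro ennreal_mult[symmetric]) simp_all
  also have "\<dots> < ennreal e'"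
    using r e' by (intro ennreal_lessI) (auto simp: field_simps)
  finally have "(\<integral>\<^sup>+x. epowr (ennreal k * \<rho> x) p \<partial>m) < e" using e' by simp
  moreover have "1 \<le> line_int (\<lambda>x. ennreal k * \<rho> x) c" if "rect_curve c" "line_int \<rho> c = \<infinity>" for c
    using that k by (simp add: line_int_cmult ennreal_mult_top)
  ultimately show "\<exists>\<rho>'\<in>borel_measurable borel. (\<forall>c\<in>{c. rect_curve c \<and> line_int \<rho> c = \<infinity>}. 1 \<le> line_int \<rho>' c) \<and> (\<integral>\<^sup>+x. epowr (\<rho>' x) p \<partial>m) < e"
    by (intro bexI[of _ "\<lambda>x. ennreal k * \<rho> x"]) auto
qed

text \<open>The density \<infinity> on N and 0 elsewhere has zero energy, yet infinite line integral
  along each curve that spends positive length in N.\<close>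

lemma Mod_null_null_set:
  assumes m: "sets m = sets borel" and N: "N \<in> null_sets m"
  shows "Mod m p {c. rect_curve c \<and> line_int (indicator N) c \<noteq> 0} = 0"
  unfolding Mod_null_iff
proof (intro allI impI)
  note [measurable_cong] = m
  fix e :: ennreal assume e: "0 < e"
  have N'[measurable]: "N \<in> sets borel" using N m by auto
  have "AE x in m. x \<notin> N" using N by (rule AE_not_in)
  then have "(\<integral>\<^sup>+x. epowr (\<infinity> * indicator N x) p \<partial>m) = (\<integral>\<^sup>+x. 0 \<partial>m)"
    by (intro nn_integral_cong_AE) auto
  moreover have "1 \<le> line_int (\<lambda>x. \<infinity> * indicator N x) c" if "rect_curve c" "line_int (indicator N) c \<noteq> 0" for c
  proof -
    have "line_int (\<lambda>x. \<infinity> * indicator N x) c = \<infinity> * line_int (indicator N) c"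
      using that(1) by (rule line_int_cmult) simp
    then show ?thesis using that(2) by (simp only: ennreal_top_mult infinity_ennreal_def if_False top_greatest)
  qed
  moreover have "(\<lambda>x. \<infinity> * indicator N x :: ennreal) \<in> borel_measurable borel" by measurable
  ultimately show "\<exists>\<rho>\<in>borel_measurable borel. (\<forall>c\<in>{c. rect_curve c \<and> line_int (indicator N) c \<noteq> 0}. 1 \<le> line_int \<rho> c) \<and> (\<integral>\<^sup>+x. epowr (\<rho> x) p \<partial>m) < e"
    using e by (intro bexI[of _ "\<lambda>x. \<infinity> * indicator N x"]) auto
qed

text \<open>A density admissible for a subcurve is admissible for the whole curve, because the line
  integral can only grow. This upgrades an inequality between endpoints to one between all pairs of
  parameters.\<close>

lemma Mod_null_subcurves:
  assumes "Mod m p \<Gamma> = 0"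
  shows "Mod m p {(a, b, \<gamma>). rect_curve (a, b, \<gamma>) \<and> (\<exists>s t. a \<le> s \<and> s < t \<and> t \<le> b \<and> (s, t, \<gamma>) \<in> \<Gamma>)} = 0"
  unfolding Mod_null_iff
proof (intro allI impI)
  fix e :: ennreal assume "0 < e"
  then obtain \<rho> where \<rho>: "\<rho> \<in> borel_measurable borel" "\<forall>c\<in>\<Gamma>. 1 \<le> line_int \<rho> c" "(\<integral>\<^sup>+x. epowr (\<rho> x) p \<partial>m) < e"
    using assms unfolding Mod_null_iff by blast
  have "1 \<le> line_int \<rho> (a, b, \<gamma>)"
    if c: "rect_curve (a, b, \<gamma>)" and st: "a \<le> s" "s < t" "t \<le> b" and "(s, t, \<gamma>) \<in> \<Gamma>" for a b s t and \<gamma> :: "real \<Rightarrow> 'a"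
  proof -
    have "1 \<le> line_int \<rho> (s, t, \<gamma>)" using \<rho> that by auto
    also have "\<dots> \<le> line_int \<rho> (a, b, \<gamma>)"
      using st by (subst line_int_subcurve[OF c st \<rho>(1)], subst line_int_arc_measure, intro nn_integral_mono) (auto simp: indicator_def)
    finally show ?thesis .
  qed
  then show "\<exists>\<rho>\<in>borel_measurable borel. (\<forall>c\<in>{(a, b, \<gamma>). rect_curve (a, b, \<gamma>) \<and> (\<exists>s t. a \<le> s \<and> s < t \<and> t \<le> b \<and> (s, t, \<gamma>) \<in> \<Gamma>)}.
      1 \<le> line_int \<rho> c) \<and> (\<integral>\<^sup>+x. epowr (\<rho> x) p \<partial>m) < e"
    using \<rho> by (intro bexI[of _ \<rho>]) auto
qed

text \<open>Unlike \<^const>\<open>wug\<close>, the following notion controls all subcurves simultaneously and does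
  not ask for \<open>p\<close>-integrability, so that it also applies to the constant gradient 1.\<close>

definition path_wug :: "'a::metric_space measure \<Rightarrow> real \<Rightarrow> ('a \<Rightarrow> real) \<Rightarrow> ('a \<Rightarrow> ennreal) \<Rightarrow> bool" where
  "path_wug m p f \<rho> \<longleftrightarrow> \<rho> \<in> borel_measurable borel \<and>
     (\<exists>\<Gamma>. Mod m p \<Gamma> = 0 \<and> (\<forall>a b \<gamma>. rect_curve (a, b, \<gamma>) \<longrightarrow> (a, b, \<gamma>) \<notin> \<Gamma> \<longrightarrow>
        line_int \<rho> (a, b, \<gamma>) < \<infinity> \<and>
        (\<forall>s t. a \<le> s \<longrightarrow> s \<le> t \<longrightarrow> t \<le> b \<longrightarrow>
          ennreal \<bar>f (\<gamma> t) - f (\<gamma> s)\<bar> \<le> (\<integral>\<^sup>+ u. \<rho> (\<gamma> u) * indicator {s..t} u \<partial>arc_measure \<gamma> a b))))"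

text \<open>The exceptional family is replaced by the curves of infinite line integral together with
  those having a subcurve in \<Gamma>. Degenerate or constant pieces, about which \<open>wug\<close>
  is silent, have zero increment.\<close>

lemma wug_imp_path_wug:
  assumes m: "sets m = sets borel" and p: "0 < p" and w: "wug m p f \<rho>"
  shows "path_wug m p f \<rho>"
proof -
  have \<rho>: "\<rho> \<in> borel_measurable borel" and fin: "(\<integral>\<^sup>+ x. epowr (\<rho> x) p \<partial>m) < \<infinity>"
    using w by (auto simp: wug_def)
  obtain \<Gamma> where \<Gamma>: "Mod m p \<Gamma> = 0"
    and ug: "\<And>a b \<gamma>. rect_curve (a, b, \<gamma>) \<Longrightarrow> nonconst_curve (a, b, \<gamma>) \<Longrightarrow> (a, b, \<gamma>) \<notin> \<Gamma> \<Longrightarrow>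
            ennreal \<bar>f (\<gamma> b) - f (\<gamma> a)\<bar> \<le> line_int \<rho> (a, b, \<gamma>)"
    using w unfolding wug_def by blast
  let ?\<Gamma>1 = "{c. rect_curve c \<and> line_int \<rho> c = \<infinity>}"
  let ?\<Gamma>2 = "{(a, b, \<gamma>). rect_curve (a, b, \<gamma>) \<and> (\<exists>s t. a \<le> s \<and> s < t \<and> t \<le> b \<and> (s, t, \<gamma>) \<in> \<Gamma>)}"
  have "Mod m p (?\<Gamma>1 \<union> ?\<Gamma>2) = 0"
    by (intro Mod_null_Un m Mod_null_line_int_infinite p \<rho> fin Mod_null_subcurves \<Gamma>)
  moreover have "ennreal \<bar>f (\<gamma> t) - f (\<gamma> s)\<bar> \<le> (\<integral>\<^sup>+ u. \<rho> (\<gamma> u) * indicator {s..t} u \<partial>arc_measure \<gamma> a b)"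
    if c: "rect_curve (a, b, \<gamma>)" "(a, b, \<gamma>) \<notin> ?\<Gamma>1 \<union> ?\<Gamma>2" and st: "a \<le> s" "s \<le> t" "t \<le> b" for a b s t \<gamma>
  proof (cases "s < t \<and> nonconst_curve (s, t, \<gamma>)")
    case True
    then have "(s, t, \<gamma>) \<notin> \<Gamma>" "rect_curve (s, t, \<gamma>)" using c st rect_subcurve[OF c(1), of s t] by auto
    then show ?thesis
      using ug[of s t \<gamma>] True line_int_subcurve[OF c(1) st(1) _ st(3) \<rho>] by simp
  next
    case False
    have "nonconst_curve (s, t, \<gamma>)" if "\<gamma> t \<noteq> \<gamma> s"
      unfolding nonconst_curve_def prod.case using st that by (intro bexI[of _ t]) auto
    then have "\<gamma> t = \<gamma> s" using False st by (metis order_le_less)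
    then show ?thesis by simp
  qed
  moreover have "line_int \<rho> (a, b, \<gamma>) < \<infinity>" if "rect_curve (a, b, \<gamma>)" "(a, b, \<gamma>) \<notin> ?\<Gamma>1 \<union> ?\<Gamma>2" for a b \<gamma>
    using that by (auto simp: less_top)
  ultimately show ?thesis
    unfolding path_wug_def using \<rho> by (intro conjI exI[of _ "?\<Gamma>1 \<union> ?\<Gamma>2"]) blast+
qed

lemma path_wug_imp_wug:
  assumes w: "path_wug m p f \<rho>" and fin: "(\<integral>\<^sup>+ x. epowr (\<rho> x) p \<partial>m) < \<infinity>"
  shows "wug m p f \<rho>"
proof -
  obtain \<Gamma> where \<rho>: "\<rho> \<in> borel_measurable borel" and \<Gamma>: "Mod m p \<Gamma> = 0"
    and ug: "\<And>a b \<gamma> s t. rect_curve (a, b, \<gamma>) \<Longrightarrow> (a, b, \<gamma>) \<notin> \<Gamma> \<Longrightarrow> a \<le> s \<Longrightarrow> s \<le> t \<Longrightarrow> t \<le> b \<Longrightarrow>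
            ennreal \<bar>f (\<gamma> t) - f (\<gamma> s)\<bar> \<le> (\<integral>\<^sup>+ u. \<rho> (\<gamma> u) * indicator {s..t} u \<partial>arc_measure \<gamma> a b)"
    using w unfolding path_wug_def by blast
  have "ennreal \<bar>f (\<gamma> b) - f (\<gamma> a)\<bar> \<le> line_int \<rho> (a, b, \<gamma>)" if "rect_curve (a, b, \<gamma>)" "(a, b, \<gamma>) \<notin> \<Gamma>" for a b \<gamma>
    using ug[OF that, of a b] that by (simp add: line_int_arc_measure rect_curve_def)
  then show ?thesis unfolding wug_def using \<rho> fin \<Gamma> by blast
qed

text \<open>The hypothesis on h concerns increments only, so that it covers the pointwise sum as
  well as the truncation of f by a cone.\<close>

lemma path_wug_add:
  assumes m: "sets m = sets borel" and f: "path_wug m p f \<rho>" and g: "path_wug m p g \<sigma>"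
    and h: "\<And>x y. \<bar>h x - h y\<bar> \<le> \<bar>f x - f y\<bar> + \<bar>g x - g y\<bar>"
  shows "path_wug m p h (\<lambda>x. \<rho> x + \<sigma> x)"
proof -
  obtain \<Gamma>1 where \<rho>: "\<rho> \<in> borel_measurable borel" and \<Gamma>1: "Mod m p \<Gamma>1 = 0"
    and fin1: "\<And>a b \<gamma>. rect_curve (a, b, \<gamma>) \<Longrightarrow> (a, b, \<gamma>) \<notin> \<Gamma>1 \<Longrightarrow> line_int \<rho> (a, b, \<gamma>) < \<infinity>"
    and ug1: "\<And>a b \<gamma> s t. rect_curve (a, b, \<gamma>) \<Longrightarrow> (a, b, \<gamma>) \<notin> \<Gamma>1 \<Longrightarrow> a \<le> s \<Longrightarrow> s \<le> t \<Longrightarrow> t \<le> b \<Longrightarrow>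
            ennreal \<bar>f (\<gamma> t) - f (\<gamma> s)\<bar> \<le> (\<integral>\<^sup>+ u. \<rho> (\<gamma> u) * indicator {s..t} u \<partial>arc_measure \<gamma> a b)"
    using f unfolding path_wug_def by blast
  obtain \<Gamma>2 where \<sigma>: "\<sigma> \<in> borel_measurable borel" and \<Gamma>2: "Mod m p \<Gamma>2 = 0"
    and fin2: "\<And>a b \<gamma>. rect_curve (a, b, \<gamma>) \<Longrightarrow> (a, b, \<gamma>) \<notin> \<Gamma>2 \<Longrightarrow> line_int \<sigma> (a, b, \<gamma>) < \<infinity>"
    and ug2: "\<And>a b \<gamma> s t. rect_curve (a, b, \<gamma>) \<Longrightarrow> (a, b, \<gamma>) \<notin> \<Gamma>2 \<Longrightarrow> a \<le> s \<Longrightarrow> s \<le> t \<Longrightarrow> t \<le> b \<Longrightarrow>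
            ennreal \<bar>g (\<gamma> t) - g (\<gamma> s)\<bar> \<le> (\<integral>\<^sup>+ u. \<sigma> (\<gamma> u) * indicator {s..t} u \<partial>arc_measure \<gamma> a b)"
    using g unfolding path_wug_def by blast
  have sum: "(\<integral>\<^sup>+ u. (\<rho> (\<gamma> u) + \<sigma> (\<gamma> u)) * indicator {s..t} u \<partial>arc_measure \<gamma> a b)
      = (\<integral>\<^sup>+ u. \<rho> (\<gamma> u) * indicator {s..t} u \<partial>arc_measure \<gamma> a b) + (\<integral>\<^sup>+ u. \<sigma> (\<gamma> u) * indicator {s..t} u \<partial>arc_measure \<gamma> a b)"
    if "rect_curve (a, b, \<gamma>)" "a \<le> s" "t \<le> b" for a b s t \<gamma>
  proof -
    have "continuous_on {s..t} \<gamma>"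
      using that by (auto simp: rect_curve_def intro: continuous_on_subset)
    from measurable_along_curve[OF this \<rho>] measurable_along_curve[OF this \<sigma>]
    show ?thesis by (simp add: distrib_right nn_integral_add)
  qed
  have "ennreal \<bar>h (\<gamma> t) - h (\<gamma> s)\<bar> \<le> (\<integral>\<^sup>+ u. (\<rho> (\<gamma> u) + \<sigma> (\<gamma> u)) * indicator {s..t} u \<partial>arc_measure \<gamma> a b)"
    if c: "rect_curve (a, b, \<gamma>)" "(a, b, \<gamma>) \<notin> \<Gamma>1 \<union> \<Gamma>2" and st: "a \<le> s" "s \<le> t" "t \<le> b" for a b s t \<gamma>
  proof -
    have "ennreal \<bar>h (\<gamma> t) - h (\<gamma> s)\<bar> \<le> ennreal \<bar>f (\<gamma> t) - f (\<gamma> s)\<bar> + ennreal \<bar>g (\<gamma> t) - g (\<gamma> s)\<bar>"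
      using h by (simp add: ennreal_leI flip: ennreal_plus)
    also have "\<dots> \<le> (\<integral>\<^sup>+ u. (\<rho> (\<gamma> u) + \<sigma> (\<gamma> u)) * indicator {s..t} u \<partial>arc_measure \<gamma> a b)"
      unfolding sum[OF c(1) st(1,3)] using c st by (intro add_mono ug1 ug2) auto
    finally show ?thesis .
  qed
  moreover have "line_int (\<lambda>x. \<rho> x + \<sigma> x) (a, b, \<gamma>) < \<infinity>" if "rect_curve (a, b, \<gamma>)" "(a, b, \<gamma>) \<notin> \<Gamma>1 \<union> \<Gamma>2" for a b \<gamma>
    using fin1[of a b \<gamma>] fin2[of a b \<gamma>] sum[of a b \<gamma> a b] that by (simp add: line_int_arc_measure)
  moreover have "(\<lambda>x. \<rho> x + \<sigma> x) \<in> borel_measurable borel" using \<rho> \<sigma> by measurable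
  ultimately show ?thesis
    unfolding path_wug_def using Mod_null_Un[OF m \<Gamma>1 \<Gamma>2]
    by (intro conjI exI[of _ "\<Gamma>1 \<union> \<Gamma>2"]) blast+
qed

lemma path_wug_cmult:
  assumes f: "path_wug m p f \<rho>" and k: "0 \<le> k" and h: "\<And>x y. \<bar>h x - h y\<bar> \<le> k * \<bar>f x - f y\<bar>"
  shows "path_wug m p h (\<lambda>x. ennreal k * \<rho> x)"
proof -
  obtain \<Gamma> where \<rho>: "\<rho> \<in> borel_measurable borel" and \<Gamma>: "Mod m p \<Gamma> = 0"
    and fin: "\<And>a b \<gamma>. rect_curve (a, b, \<gamma>) \<Longrightarrow> (a, b, \<gamma>) \<notin> \<Gamma> \<Longrightarrow> line_int \<rho> (a, b, \<gamma>) < \<infinity>"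
    and ug: "\<And>a b \<gamma> s t. rect_curve (a, b, \<gamma>) \<Longrightarrow> (a, b, \<gamma>) \<notin> \<Gamma> \<Longrightarrow> a \<le> s \<Longrightarrow> s \<le> t \<Longrightarrow> t \<le> b \<Longrightarrow>
            ennreal \<bar>f (\<gamma> t) - f (\<gamma> s)\<bar> \<le> (\<integral>\<^sup>+ u. \<rho> (\<gamma> u) * indicator {s..t} u \<partial>arc_measure \<gamma> a b)"
    using f unfolding path_wug_def by blast
  have "ennreal \<bar>h (\<gamma> t) - h (\<gamma> s)\<bar> \<le> (\<integral>\<^sup>+ u. ennreal k * \<rho> (\<gamma> u) * indicator {s..t} u \<partial>arc_measure \<gamma> a b)"
    if c: "rect_curve (a, b, \<gamma>)" "(a, b, \<gamma>) \<notin> \<Gamma>" and st: "a \<le> s" "s \<le> t" "t \<le> b" for a b s t \<gamma>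
  proof -
    have "continuous_on {s..t} \<gamma>"
      using c st by (auto simp: rect_curve_def intro: continuous_on_subset)
    note meas = measurable_along_curve[OF this \<rho>]
    have "ennreal \<bar>h (\<gamma> t) - h (\<gamma> s)\<bar> \<le> ennreal k * ennreal \<bar>f (\<gamma> t) - f (\<gamma> s)\<bar>"
      using h k by (simp add: ennreal_leI flip: ennreal_mult)
    also have "\<dots> \<le> ennreal k * (\<integral>\<^sup>+ u. \<rho> (\<gamma> u) * indicator {s..t} u \<partial>arc_measure \<gamma> a b)"
      by (intro mult_left_mono ug c st) simp
    also have "\<dots> = (\<integral>\<^sup>+ u. ennreal k * \<rho> (\<gamma> u) * indicator {s..t} u \<partial>arc_measure \<gamma> a b)"
      using meas by (simp add: mult.assoc nn_integral_cmult)
    finally show ?thesis .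
  qed
  moreover have "line_int (\<lambda>x. ennreal k * \<rho> x) (a, b, \<gamma>) < \<infinity>" if "rect_curve (a, b, \<gamma>)" "(a, b, \<gamma>) \<notin> \<Gamma>" for a b \<gamma>
    using fin[OF that] line_int_cmult[OF that(1) \<rho>] by (simp add: ennreal_mult_less_top)
  moreover have "(\<lambda>x. ennreal k * \<rho> x) \<in> borel_measurable borel" using \<rho> by measurable
  ultimately show ?thesis
    unfolding path_wug_def using \<Gamma> by (intro conjI exI[of _ "\<Gamma>"]) blast+
qed

lemma dist_le_curve_len:
  assumes "s \<le> t"
  shows "ennreal (dist (\<gamma> t) (\<gamma> s)) \<le> curve_len \<gamma> s t"
  using polygon_le_curve_len[of "\<lambda>i. if i = 0 then s else t" s 1 t \<gamma>] assms by (simp add: dist_commute)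

lemma emeasure_arc_measure_Icc:
  assumes c: "rect_curve (a, b, \<gamma>)" and st: "a \<le> s" "s \<le> t" "t \<le> b"
  shows "emeasure (arc_measure \<gamma> a b) {s..t} = curve_len \<gamma> s t"
proof -
  have "emeasure (arc_measure \<gamma> a b) {s..t} = ennreal (enn2real (curve_len \<gamma> s t))"
    unfolding arc_fun_diff[OF c st, symmetric] arc_measure_def
    using st c by (intro emeasure_interval_measure_Icc arc_fun_mono continuous_arc_fun)
  moreover have "curve_len \<gamma> s t < \<infinity>"
    using c curve_len_mono[OF st, of \<gamma>] by (auto simp: rect_curve_def elim: order.strict_trans1)
  ultimately show ?thesis by simp
qed

lemma Mod_empty: "Mod m p {} = 0"
  unfolding Mod_null_iff by (auto intro!: bexI[of _ "\<lambda>_. 0"])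

text \<open>No curve is exceptional: integrating 1 against arc length gives the length of the piece,
  which dominates the distance of its endpoints and is finite by rectifiability.\<close>

lemma path_wug_lipschitz:
  assumes "\<And>x y. \<bar>f x - f y\<bar> \<le> dist x y"
  shows "path_wug m p f (\<lambda>_. 1)"
proof -
  have int: "(\<integral>\<^sup>+ u. 1 * indicator {s..t} u \<partial>arc_measure \<gamma> a b) = curve_len \<gamma> s t"
    if "rect_curve (a, b, \<gamma>)" "a \<le> s" "s \<le> t" "t \<le> b" for a b s t and \<gamma> :: "real \<Rightarrow> 'a"
    using emeasure_arc_measure_Icc[OF that] by simp
  have "ennreal \<bar>f (\<gamma> t) - f (\<gamma> s)\<bar> \<le> (\<integral>\<^sup>+ u. 1 * indicator {s..t} u \<partial>arc_measure \<gamma> a b)"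
    if "rect_curve (a, b, \<gamma>)" "a \<le> s" "s \<le> t" "t \<le> b" for a b s t \<gamma>
    unfolding int[OF that]
    using dist_le_curve_len[OF that(3), of \<gamma>] assms by (meson ennreal_leI order_trans)
  moreover have "line_int (\<lambda>_. 1) (a, b, \<gamma>) < \<infinity>" if "rect_curve (a, b, \<gamma>)" for a b and \<gamma> :: "real \<Rightarrow> 'a"
    using int[OF that, of a b] that unfolding line_int_arc_measure by (simp add: rect_curve_def)
  ultimately show ?thesis
    unfolding path_wug_def using Mod_empty[of m p] by (intro conjI exI[of _ "{}"]) auto
qed

section \<open>Locality of weak upper gradients\<close>

text \<open>Cut the interval at the first and at the last zero of \<open>h\<close>.\<close>

lemma increment_off_zeros:
  fixes h :: "real \<Rightarrow> real"
  assumes ab: "a \<le> b" and \<nu>: "sets \<nu> = sets borel" and fin: "emeasure \<nu> {a..b} < \<infinity>"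
    and atom: "\<And>x. emeasure \<nu> {x} = 0"
    and h: "\<And>s t. a \<le> s \<Longrightarrow> s \<le> t \<Longrightarrow> t \<le> b \<Longrightarrow> ennreal \<bar>h t - h s\<bar> \<le> emeasure \<nu> {s..t}"
  shows "\<exists>A\<in>sets borel. A \<subseteq> {a..b} \<and> (\<forall>u\<in>A. h u \<noteq> 0) \<and> ennreal \<bar>h b - h a\<bar> \<le> emeasure \<nu> A"
proof (cases "\<exists>z\<in>{a..b}. h z = 0")
  case False
  then show ?thesis using h[of a b] ab by (intro bexI[of _ "{a..b}"]) auto
next
  case True
  note [measurable_cong] = \<nu>
  define Z where "Z = {z\<in>{a..b}. h z = 0}"
  have Z: "Z \<noteq> {}" "Z \<subseteq> {a..b}" using True by (auto simp: Z_def)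
  then have bdd: "bdd_below Z" "bdd_above Z" by (auto intro: bdd_below_mono bdd_above_mono)
  define s where "s = Inf Z"
  define t where "t = Sup Z"
  have sz: "s \<le> z \<and> z \<le> t" if "z \<in> Z" for z
    unfolding s_def t_def using bdd that by (auto intro: cInf_lower cSup_upper)
  obtain z where "z \<in> Z" using Z by blast
  then have "s \<le> t" using sz by (meson order_trans)
  moreover have "a \<le> s" "t \<le> b"
    using Z unfolding s_def t_def by (auto intro!: cInf_greatest cSup_least)
  ultimately have st: "a \<le> s" "s \<le> t" "t \<le> b" by auto
  have fin': "emeasure \<nu> B \<noteq> \<infinity>" if "B \<subseteq> {a..b}" for B
    using emeasure_mono[OF that, of \<nu>] fin \<nu> by (auto simp: top_unique)
  \<comment> \<open>Zeros z close to s bound |h a| by the mass of \<open>{a..z}\<close>. These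
    intervals shrink to \<open>{a..s}\<close>, finiteness gives continuity from above, and the
    absence of atoms removes s. The value of h at s itself is not consulted.\<close>
  have left: "ennreal \<bar>h a\<bar> \<le> emeasure \<nu> {a..<s}"
  proof -
    define B where "B n = {a..min b (s + 1 / real (Suc n))}" for n
    have "ennreal \<bar>h a\<bar> \<le> emeasure \<nu> (B n)" for n
    proof -
      obtain z where z: "z \<in> Z" "z < s + 1 / real (Suc n)"
        using cInf_lessD[OF Z(1), of "s + 1 / real (Suc n)"] unfolding s_def by auto
      then have "ennreal \<bar>h a\<bar> \<le> emeasure \<nu> {a..z}"
        using h[of a z] by (auto simp: Z_def)
      also have "\<dots> \<le> emeasure \<nu> (B n)"
        using z \<nu> by (intro emeasure_mono) (auto simp: B_def Z_def)
      finally show ?thesis .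
    qed
    moreover have "(\<lambda>n. emeasure \<nu> (B n)) \<longlonglongrightarrow> emeasure \<nu> (\<Inter>n. B n)"
    proof (rule Lim_emeasure_decseq)
      show "decseq B"
        unfolding decseq_def
      proof (intro allI impI)
        fix i n :: nat assume "i \<le> n"
        then have "1 / real (Suc n) \<le> 1 / real (Suc i)" by (intro frac_le) auto
        then show "B n \<subseteq> B i" by (auto simp: B_def simp del: of_nat_Suc)
      qed
      show "emeasure \<nu> (B i) \<noteq> \<infinity>" for i by (rule fin') (auto simp: B_def)
    qed (auto simp: B_def \<nu>)
    moreover have "(\<Inter>n. B n) \<subseteq> {a..s}"
    proof
      fix x assume x: "x \<in> (\<Inter>n. B n)"
      then have "x \<le> s + 1 / real (Suc n)" "a \<le> x" for n by (auto simp: B_def)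
      moreover have "(\<lambda>n. s + 1 / real (Suc n)) \<longlonglongrightarrow> s + 0"
        by (intro tendsto_intros LIMSEQ_Suc[OF lim_1_over_n])
      ultimately show "x \<in> {a..s}" by (auto intro: LIMSEQ_le_const)
    qed
    then have "emeasure \<nu> (\<Inter>n. B n) \<le> emeasure \<nu> {a..s}" by (intro emeasure_mono) (auto simp: \<nu>)
    ultimately have "ennreal \<bar>h a\<bar> \<le> emeasure \<nu> {a..s}"
      by (meson LIMSEQ_le_const order_trans)
    also have "{a..s} = {a..<s} \<union> {s}" using st by auto
    also have "emeasure \<nu> \<dots> \<le> emeasure \<nu> {a..<s} + emeasure \<nu> {s}"
      by (intro emeasure_subadditive) (auto simp: \<nu>)
    finally show ?thesis by (simp add: atom)
  qed
  have right: "ennreal \<bar>h b\<bar> \<le> emeasure \<nu> {t<..b}"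
  proof -
    define B where "B n = {max a (t - 1 / real (Suc n))..b}" for n
    have "ennreal \<bar>h b\<bar> \<le> emeasure \<nu> (B n)" for n
    proof -
      obtain z where z: "z \<in> Z" "t - 1 / real (Suc n) < z"
        using less_cSupD[OF Z(1), of "t - 1 / real (Suc n)"] unfolding t_def by auto
      then have "ennreal \<bar>h b\<bar> \<le> emeasure \<nu> {z..b}"
        using h[of z b] by (auto simp: Z_def)
      also have "\<dots> \<le> emeasure \<nu> (B n)"
        using z \<nu> by (intro emeasure_mono) (auto simp: B_def Z_def)
      finally show ?thesis .
    qed
    moreover have "(\<lambda>n. emeasure \<nu> (B n)) \<longlonglongrightarrow> emeasure \<nu> (\<Inter>n. B n)"
    proof (rule Lim_emeasure_decseq)
      show "decseq B"
        unfolding decseq_def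
      proof (intro allI impI)
        fix i n :: nat assume "i \<le> n"
        then have "1 / real (Suc n) \<le> 1 / real (Suc i)" by (intro frac_le) auto
        then show "B n \<subseteq> B i" by (auto simp: B_def simp del: of_nat_Suc)
      qed
      show "emeasure \<nu> (B i) \<noteq> \<infinity>" for i by (rule fin') (auto simp: B_def)
    qed (auto simp: B_def \<nu>)
    moreover have "(\<Inter>n. B n) \<subseteq> {t..b}"
    proof
      fix x assume x: "x \<in> (\<Inter>n. B n)"
      then have "t - 1 / real (Suc n) \<le> x" "x \<le> b" for n by (auto simp: B_def)
      moreover have "(\<lambda>n. t - 1 / real (Suc n)) \<longlonglongrightarrow> t - 0"
        by (intro tendsto_intros LIMSEQ_Suc[OF lim_1_over_n])
      ultimately show "x \<in> {t..b}" by (auto intro: LIMSEQ_le_const2)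
    qed
    then have "emeasure \<nu> (\<Inter>n. B n) \<le> emeasure \<nu> {t..b}" by (intro emeasure_mono) (auto simp: \<nu>)
    ultimately have "ennreal \<bar>h b\<bar> \<le> emeasure \<nu> {t..b}"
      by (meson LIMSEQ_le_const order_trans)
    also have "{t..b} = {t<..b} \<union> {t}" using st by auto
    also have "emeasure \<nu> \<dots> \<le> emeasure \<nu> {t<..b} + emeasure \<nu> {t}"
      by (intro emeasure_subadditive) (auto simp: \<nu>)
    finally show ?thesis by (simp add: atom)
  qed
  show ?thesis
  proof (intro bexI[of _ "{a..<s} \<union> {t<..b}"] conjI)
    show "\<forall>u\<in>{a..<s} \<union> {t<..b}. h u \<noteq> 0"
    proof (intro ballI notI)
      fix u assume "u \<in> {a..<s} \<union> {t<..b}" "h u = 0"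
      moreover from this have "u \<in> Z" using st(1-3) by (auto simp: Z_def)
      ultimately show False using sz[of u] by auto
    qed
    \<comment> \<open>Splitting the increment at the value 0 charges nothing between the first and
      the last zero, however h behaves there.\<close>
    have "ennreal \<bar>h b - h a\<bar> \<le> ennreal \<bar>h a\<bar> + ennreal \<bar>h b\<bar>"
      by (simp add: ennreal_leI flip: ennreal_plus)
    also have "\<dots> \<le> emeasure \<nu> {a..<s} + emeasure \<nu> {t<..b}" by (intro add_mono left right)
    also have "\<dots> = emeasure \<nu> ({a..<s} \<union> {t<..b})"
      using st by (intro plus_emeasure) (auto simp: \<nu>)
    finally show "ennreal \<bar>h b - h a\<bar> \<le> emeasure \<nu> ({a..<s} \<union> {t<..b})" .
  qed (use st in auto)
qed

text \<open>The pieces of a curve before the first and after the last zero of \<open>f\<close> lie in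
  \<open>E \<union> N\<close>, and almost every curve spends no length in the null set \<open>N\<close>.\<close>

lemma path_wug_localize:
  fixes m :: "'a::metric_space measure"
  assumes m: "sets m = sets borel" and f: "path_wug m p f \<rho>"
    and E: "E \<in> sets borel" and N: "N \<in> null_sets m" and supp: "\<And>x. f x \<noteq> 0 \<Longrightarrow> x \<in> E \<union> N"
    and fin: "(\<integral>\<^sup>+ x. epowr (\<rho> x * indicator E x) p \<partial>m) < \<infinity>"
  shows "wug m p f (\<lambda>x. \<rho> x * indicator E x)"
proof -
  obtain \<Gamma> where \<rho>: "\<rho> \<in> borel_measurable borel" and \<Gamma>: "Mod m p \<Gamma> = 0"
    and fin1: "\<And>a b \<gamma>. rect_curve (a, b, \<gamma>) \<Longrightarrow> (a, b, \<gamma>) \<notin> \<Gamma> \<Longrightarrow> line_int \<rho> (a, b, \<gamma>) < \<infinity>"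
    and ug: "\<And>a b \<gamma> s t. rect_curve (a, b, \<gamma>) \<Longrightarrow> (a, b, \<gamma>) \<notin> \<Gamma> \<Longrightarrow> a \<le> s \<Longrightarrow> s \<le> t \<Longrightarrow> t \<le> b \<Longrightarrow>
            ennreal \<bar>f (\<gamma> t) - f (\<gamma> s)\<bar> \<le> (\<integral>\<^sup>+ u. \<rho> (\<gamma> u) * indicator {s..t} u \<partial>arc_measure \<gamma> a b)"
    using f unfolding path_wug_def by blast
  have N': "N \<in> sets borel" using N m by auto
  let ?\<Gamma> = "\<Gamma> \<union> {c. rect_curve c \<and> line_int (indicator N) c \<noteq> 0}"
  have "ennreal \<bar>f (\<gamma> b) - f (\<gamma> a)\<bar> \<le> line_int (\<lambda>x. \<rho> x * indicator E x) (a, b, \<gamma>)"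
    if c: "rect_curve (a, b, \<gamma>)" and "(a, b, \<gamma>) \<notin> ?\<Gamma>" for a b \<gamma>
  proof -
    have n\<Gamma>: "(a, b, \<gamma>) \<notin> \<Gamma>" and N0: "line_int (indicator N) (a, b, \<gamma>) = 0" using that by auto
    have ab: "a \<le> b" and cont: "continuous_on {a..b} \<gamma>" using c by (auto simp: rect_curve_def)
    define \<mu> where "\<mu> = arc_measure \<gamma> a b"
    have [simp, measurable_cong]: "sets \<mu> = sets borel" by (simp add: \<mu>_def)
    define r where "r u = \<rho> (\<gamma> u) * indicator {a..b} u" for u
    have r[measurable]: "r \<in> borel_measurable borel"
      unfolding r_def by (rule measurable_along_curve[OF cont \<rho>])
    have iN[measurable]: "(\<lambda>u. indicator N (\<gamma> u) * indicator {a..b} u :: ennreal) \<in> borel_measurable borel"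
      by (rule measurable_along_curve[OF cont]) (use N' in simp)
    \<comment> \<open>Arc length weighted by \<rho>: for this measure the inequality on subcurves is
      the increment hypothesis of \<open>increment_off_zeros\<close> for f along \<gamma>, and
      finiteness is that of the line integral.\<close>
    define \<nu> where "\<nu> = density \<mu> r"
    have e\<nu>: "emeasure \<nu> A = (\<integral>\<^sup>+ u. r u * indicator A u \<partial>\<mu>)" if "A \<in> sets borel" for A
      unfolding \<nu>_def using that by (intro emeasure_density) auto
    have sub: "(\<integral>\<^sup>+ u. \<rho> (\<gamma> u) * indicator {s..t} u \<partial>\<mu>) = emeasure \<nu> {s..t}" if "a \<le> s" "t \<le> b" for s t
      using that by (subst e\<nu>) (auto simp: r_def indicator_def intro!: nn_integral_cong)
    have "\<exists>A\<in>sets borel. A \<subseteq> {a..b} \<and> (\<forall>u\<in>A. f (\<gamma> u) \<noteq> 0) \<and> ennreal \<bar>f (\<gamma> b) - f (\<gamma> a)\<bar> \<le> emeasure \<nu> A"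
    proof (rule increment_off_zeros[OF ab])
      show "emeasure \<nu> {a..b} < \<infinity>"
        using fin1[OF c n\<Gamma>] sub[of a b] by (simp add: line_int_arc_measure \<mu>_def)
      show "emeasure \<nu> {x} = 0" for x
      proof -
        have "AE u in \<mu>. u \<noteq> x"
          using emeasure_arc_measure_singleton[OF c, of x] by (intro AE_I[where N="{x}"]) (auto simp: \<mu>_def)
        then have "(\<integral>\<^sup>+ u. r u * indicator {x} u \<partial>\<mu>) = (\<integral>\<^sup>+ u. 0 \<partial>\<mu>)"
          by (intro nn_integral_cong_AE) (auto elim!: eventually_mono)
        then show ?thesis by (simp add: e\<nu>)
      qed
      show "ennreal \<bar>f (\<gamma> t) - f (\<gamma> s)\<bar> \<le> emeasure \<nu> {s..t}" if "a \<le> s" "s \<le> t" "t \<le> b" for s t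
        using ug[OF c n\<Gamma> that] sub[OF that(1,3)] by (simp add: \<mu>_def)
    qed (simp add: \<nu>_def)
    then obtain A where A: "A \<in> sets borel" "A \<subseteq> {a..b}" "\<forall>u\<in>A. f (\<gamma> u) \<noteq> 0"
      and le: "ennreal \<bar>f (\<gamma> b) - f (\<gamma> a)\<bar> \<le> emeasure \<nu> A" by blast
    have "AE u in \<mu>. indicator N (\<gamma> u) * indicator {a..b} u = (0::ennreal)"
      using N0 iN unfolding line_int_arc_measure \<mu>_def[symmetric] by (subst (asm) nn_integral_0_iff_AE) auto
    then have "(\<integral>\<^sup>+ u. r u * indicator A u \<partial>\<mu>) \<le> (\<integral>\<^sup>+ u. \<rho> (\<gamma> u) * indicator E (\<gamma> u) * indicator {a..b} u \<partial>\<mu>)"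
    proof (intro nn_integral_mono_AE, eventually_elim)
      case (elim u)
      show ?case
      proof (cases "u \<in> A")
        case True
        then have "u \<in> {a..b}" "f (\<gamma> u) \<noteq> 0" using A by auto
        moreover from this elim have "\<gamma> u \<notin> N" by (auto simp: indicator_def split: if_splits)
        ultimately have "\<gamma> u \<in> E" using supp by blast
        then show ?thesis using True by (simp add: r_def)
      qed simp
    qed
    with le show ?thesis unfolding e\<nu>[OF A(1)] line_int_arc_measure \<mu>_def by simp
  qed
  moreover have "(\<lambda>x. \<rho> x * indicator E x) \<in> borel_measurable borel" using \<rho> E by measurable
  moreover have "Mod m p ?\<Gamma> = 0" by (intro Mod_null_Un m \<Gamma> Mod_null_null_set N)
  ultimately show ?thesis unfolding wug_def using fin by blast
qed

section \<open>Vector space structure of the Sobolev classes\<close>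

lemma cwug_add:
  assumes m: "sets m = sets borel" and p: "0 < p" and f: "cwug m p f \<rho>" and g: "cwug m p g \<sigma>"
  shows "cwug m p (\<lambda>x. f x + g x) (\<lambda>x. \<rho> x + \<sigma> x)"
proof -
  note [measurable_cong] = m
  obtain f' where f': "f' \<in> borel_measurable (completion m)" "AE x in m. f' x = f x" "wug m p f' \<rho>"
    using f unfolding cwug_def by blast
  obtain g' where g': "g' \<in> borel_measurable (completion m)" "AE x in m. g' x = g x" "wug m p g' \<sigma>"
    using g unfolding cwug_def by blast
  have [measurable]: "\<rho> \<in> borel_measurable borel" "\<sigma> \<in> borel_measurable borel"
    and fin: "(\<integral>\<^sup>+ x. epowr (\<rho> x) p \<partial>m) < \<infinity>" "(\<integral>\<^sup>+ x. epowr (\<sigma> x) p \<partial>m) < \<infinity>"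
    using f' g' by (auto simp: wug_def)
  have "(\<integral>\<^sup>+ x. epowr (\<rho> x + \<sigma> x) p \<partial>m) \<le> (\<integral>\<^sup>+ x. ennreal (2 powr p) * (epowr (\<rho> x) p + epowr (\<sigma> x) p) \<partial>m)"
    using p by (intro nn_integral_mono epowr_add_le) simp
  also have "\<dots> = ennreal (2 powr p) * ((\<integral>\<^sup>+ x. epowr (\<rho> x) p \<partial>m) + (\<integral>\<^sup>+ x. epowr (\<sigma> x) p \<partial>m))"
    by (subst nn_integral_cmult) (auto simp: nn_integral_add)
  also have "\<dots> < \<infinity>" using fin by (simp add: ennreal_mult_less_top)
  finally have "(\<integral>\<^sup>+ x. epowr (\<rho> x + \<sigma> x) p \<partial>m) < \<infinity>" .
  moreover have "path_wug m p (\<lambda>x. f' x + g' x) (\<lambda>x. \<rho> x + \<sigma> x)"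
    using f'(3) g'(3) by (intro path_wug_add[OF m wug_imp_path_wug wug_imp_path_wug] m p) auto
  ultimately have "wug m p (\<lambda>x. f' x + g' x) (\<lambda>x. \<rho> x + \<sigma> x)" by (intro path_wug_imp_wug)
  moreover have "(\<lambda>x. f' x + g' x) \<in> borel_measurable (completion m)" using f' g' by measurable
  moreover have "AE x in m. f' x + g' x = f x + g x" using f'(2) g'(2) by eventually_elim simp
  ultimately show ?thesis unfolding cwug_def by blast
qed

lemma cwug_cmult:
  assumes m: "sets m = sets borel" and p: "0 < p" and f: "cwug m p f \<rho>"
  shows "\<exists>\<sigma>. cwug m p (\<lambda>x. c * f x) \<sigma>"
proof -
  note [measurable_cong] = m
  obtain f' where f': "f' \<in> borel_measurable (completion m)" "AE x in m. f' x = f x" "wug m p f' \<rho>"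
    using f unfolding cwug_def by blast
  have [measurable]: "\<rho> \<in> borel_measurable borel" and fin: "(\<integral>\<^sup>+ x. epowr (\<rho> x) p \<partial>m) < \<infinity>"
    using f' by (auto simp: wug_def)
  \<comment> \<open>The summand 1 keeps k positive when c = 0, as \<open>epowr_cmult\<close>
    requires; only the existence of some gradient is at stake.\<close>
  define k where "k = \<bar>c\<bar> + 1"
  have k: "0 < k" by (simp add: k_def)
  have "(\<integral>\<^sup>+ x. epowr (ennreal k * \<rho> x) p \<partial>m) = ennreal (k powr p) * (\<integral>\<^sup>+ x. epowr (\<rho> x) p \<partial>m)"
    unfolding epowr_cmult[OF k] by (intro nn_integral_cmult) measurable
  then have "(\<integral>\<^sup>+ x. epowr (ennreal k * \<rho> x) p \<partial>m) < \<infinity>" using fin by (simp add: ennreal_mult_less_top)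
  moreover have "\<bar>c * f' x - c * f' y\<bar> \<le> k * \<bar>f' x - f' y\<bar>" for x y
    unfolding right_diff_distrib[symmetric] abs_mult by (intro mult_right_mono) (auto simp: k_def)
  then have "path_wug m p (\<lambda>x. c * f' x) (\<lambda>x. ennreal k * \<rho> x)"
    using k by (intro path_wug_cmult[OF wug_imp_path_wug[OF m p f'(3)]]) auto
  ultimately have "wug m p (\<lambda>x. c * f' x) (\<lambda>x. ennreal k * \<rho> x)" by (intro path_wug_imp_wug)
  moreover have "(\<lambda>x. c * f' x) \<in> borel_measurable (completion m)" using f' by measurable
  moreover have "AE x in m. c * f' x = c * f x" using f'(2) by eventually_elim simp
  ultimately show ?thesis unfolding cwug_def by blast
qed

lemma Dsp_add:
  assumes "sets m = sets borel" "0 < p" "Dsp m p f" "Dsp m p g"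
  shows "Dsp m p (\<lambda>x. f x + g x)"
  using assms cwug_add[of m p f _ g] unfolding Dsp_def by (auto intro: borel_measurable_add)

lemma Dsp_cmult:
  assumes "sets m = sets borel" "0 < p" "Dsp m p f"
  shows "Dsp m p (\<lambda>x. c * f x)"
  using assms cwug_cmult[of m p f _ c] unfolding Dsp_def by (auto intro: borel_measurable_times)

lemma Wsp_cmult:
  assumes "sets m = sets borel" "0 < p" "Wsp m p f"
  shows "Wsp m p (\<lambda>x. c * f x)"
proof -
  have [measurable]: "f \<in> borel_measurable (completion m)" using assms by (simp add: Wsp_def Dsp_def)
  have "(\<integral>\<^sup>+ x. ennreal (\<bar>c * f x\<bar> powr p) \<partial>completion m) = (\<integral>\<^sup>+ x. ennreal (\<bar>c\<bar> powr p) * ennreal (\<bar>f x\<bar> powr p) \<partial>completion m)"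
    by (simp add: abs_mult powr_mult ennreal_mult)
  also have "\<dots> = ennreal (\<bar>c\<bar> powr p) * (\<integral>\<^sup>+ x. ennreal (\<bar>f x\<bar> powr p) \<partial>completion m)"
    by (intro nn_integral_cmult) measurable
  also have "\<dots> < \<infinity>" using assms by (simp add: Wsp_def ennreal_mult_less_top)
  finally show ?thesis using assms Dsp_cmult[of m p f c] by (simp add: Wsp_def)
qed

lemma Wsp_add:
  assumes "sets m = sets borel" "0 < p" "Wsp m p f" "Wsp m p g"
  shows "Wsp m p (\<lambda>x. f x + g x)"
proof -
  have [measurable]: "f \<in> borel_measurable (completion m)" "g \<in> borel_measurable (completion m)"
    using assms by (simp_all add: Wsp_def Dsp_def)
  have epow: "ennreal (\<bar>r\<bar> powr p) = epowr (ennreal \<bar>r\<bar>) p" for r by (simp add: epowr_def)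
  have "ennreal (\<bar>r + s\<bar> powr p) \<le> ennreal (2 powr p) * (ennreal (\<bar>r\<bar> powr p) + ennreal (\<bar>s\<bar> powr p))" for r s
  proof -
    have "epowr (ennreal \<bar>r + s\<bar>) p \<le> epowr (ennreal \<bar>r\<bar> + ennreal \<bar>s\<bar>) p"
      using assms(2) by (intro epowr_mono) (simp_all add: ennreal_leI flip: ennreal_plus)
    also have "\<dots> \<le> ennreal (2 powr p) * (epowr (ennreal \<bar>r\<bar>) p + epowr (ennreal \<bar>s\<bar>) p)"
      using assms(2) by (intro epowr_add_le) simp
    finally show ?thesis unfolding epow .
  qed
  then have "(\<integral>\<^sup>+ x. ennreal (\<bar>f x + g x\<bar> powr p) \<partial>completion m)
      \<le> (\<integral>\<^sup>+ x. ennreal (2 powr p) * (ennreal (\<bar>f x\<bar> powr p) + ennreal (\<bar>g x\<bar> powr p)) \<partial>completion m)"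
    by (intro nn_integral_mono)
  also have "\<dots> = ennreal (2 powr p) * ((\<integral>\<^sup>+ x. ennreal (\<bar>f x\<bar> powr p) \<partial>completion m) + (\<integral>\<^sup>+ x. ennreal (\<bar>g x\<bar> powr p) \<partial>completion m))"
    by (subst nn_integral_cmult) (auto simp: nn_integral_add)
  also have "\<dots> < \<infinity>" using assms by (simp add: Wsp_def ennreal_mult_less_top)
  finally show ?thesis using assms Dsp_add[of m p f g] by (simp add: Wsp_def)
qed

section \<open>Locality of the minimal weak upper gradient, and truncation\<close>

lemma min_wug_unique:
  assumes "min_wug m p f G" "min_wug m p f G'"
  shows "AE x in m. G x = G' x"
proof -
  have "AE x in m. G x \<le> G' x" "AE x in m. G' x \<le> G x" using assms by (auto simp: min_wug_def)
  then show ?thesis by eventually_elim (rule antisym)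
qed

text \<open>Cutting G off to a set S carrying {f' \<noteq> 0} gives another weak upper gradient, so
  minimality forces G to vanish almost everywhere off S. No measurability of E is involved, since E
  avoids S up to a null set.\<close>

lemma min_wug_locality:
  assumes m: "sets m = sets borel" and p: "0 < p" and G: "min_wug m p f G"
    and E: "AE x in m. x \<in> E \<longrightarrow> f x = 0"
  shows "AE x in m. x \<in> E \<longrightarrow> G x = 0"
proof -
  obtain f' where f'[measurable]: "f' \<in> borel_measurable (completion m)"
    and eq: "AE x in m. f' x = f x" and w: "wug m p f' G"
    using G unfolding min_wug_def cwug_def by blast
  have Gm: "G \<in> borel_measurable borel" and fin: "(\<integral>\<^sup>+ x. epowr (G x) p \<partial>m) < \<infinity>"
    using w by (auto simp: wug_def)
  \<comment> \<open>The representative f' is measurable only for the completion, whereas a gradient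
    must be Borel: {f' \<noteq> 0} is split into a set S in \<open>sets m\<close> and a remainder
    inside a null set, which becomes the N of \<open>path_wug_localize\<close>.\<close>
  have "{x \<in> space (completion m). f' x \<noteq> 0} \<in> sets (completion m)" by measurable
  then obtain S N N' where S: "{x \<in> space (completion m). f' x \<noteq> 0} = S \<union> N" "N \<subseteq> N'" "N' \<in> null_sets m" "S \<in> sets m"
    by (rule sets_completionE)
  have sp: "space m = UNIV" using sets_eq_imp_space_eq[OF m] by simp
  have "(\<integral>\<^sup>+ x. epowr (G x * indicator S x) p \<partial>m) \<le> (\<integral>\<^sup>+ x. epowr (G x) p \<partial>m)"
    using p by (intro nn_integral_mono epowr_mono) (auto simp: indicator_def)
  then have "wug m p f' (\<lambda>x. G x * indicator S x)"
    using S m sp fin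
    by (intro path_wug_localize[OF m wug_imp_path_wug[OF m p w], where N=N']) (auto elim: order.strict_trans1)
  then have "cwug m p f (\<lambda>x. G x * indicator S x)" unfolding cwug_def using f' eq by blast
  then have "AE x in m. G x \<le> G x * indicator S x" using G unfolding min_wug_def by blast
  with E eq show ?thesis
  proof eventually_elim
    case (elim x)
    show ?case
    proof
      assume "x \<in> E"
      then have "f' x = 0" using elim by simp
      then have "x \<notin> S" using S(1) by auto
      then show "G x = 0" using elim by simp
    qed
  qed
qed

text \<open>Truncating at the height of a cone of radius \<open>n\<close> yields a bounded function with
  bounded support, which agrees with the original one on a set that exhausts the space.\<close>

lemma Dsp_Wsp_exhaustion:
  fixes m :: "'a::metric_space measure"
  assumes m: "sets m = sets borel" and bdd: "\<And>B. B \<in> sets borel \<Longrightarrow> bounded B \<Longrightarrow> emeasure m B < \<infinity>"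
    and p: "0 < p" and f: "Dsp m p f"
  shows "\<exists>F :: nat \<Rightarrow> 'a \<Rightarrow> real. (\<forall>n. Wsp m p (F n)) \<and> (AE x in m. \<exists>n. F n x = f x)"
proof -
  note [measurable_cong] = m
  obtain f' \<rho> where f'[measurable]: "f' \<in> borel_measurable (completion m)"
    and eq: "AE x in m. f' x = f x" and w: "wug m p f' \<rho>"
    using f unfolding Dsp_def cwug_def by blast
  have \<rho>[measurable]: "\<rho> \<in> borel_measurable borel" and fin: "(\<integral>\<^sup>+ x. epowr (\<rho> x) p \<partial>m) < \<infinity>"
    using w by (auto simp: wug_def)
  fix x0 :: 'a
  define \<eta> where "\<eta> n x = max 0 (real n - dist x x0)" for n x
  define F where "F n x = max (- \<eta> n x) (min (f' x) (\<eta> n x))" for n x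
  have \<eta>_lip: "\<bar>\<eta> n x - \<eta> n y\<bar> \<le> dist x y" for n x y
    using dist_triangle[of x x0 y] dist_triangle[of y x0 x] by (auto simp: \<eta>_def dist_commute)
  have [measurable]: "\<eta> n \<in> borel_measurable borel" for n
    unfolding \<eta>_def by (intro borel_measurable_continuous_onI continuous_intros)
  have [measurable]: "\<eta> n \<in> borel_measurable m" for n by measurable
  have [measurable]: "\<eta> n \<in> borel_measurable (completion m)" for n
    by (rule measurable_completion) measurable
  have F_meas[measurable]: "F n \<in> borel_measurable (completion m)" for n
    unfolding F_def by measurable
  have F_Wsp: "Wsp m p (F n)" for n
  proof -
    let ?E = "ball x0 (real n)"
    have Efin: "emeasure m ?E < \<infinity>" by (intro bdd) auto
    have E: "?E \<in> sets m" by (simp add: m)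
    have "0 \<le> \<eta> n x" "\<eta> n x \<le> real n * indicator ?E x" for x
      by (auto simp: \<eta>_def indicator_def dist_commute)
    moreover have "\<bar>F n x\<bar> \<le> \<bar>\<eta> n x\<bar>" for x by (auto simp: F_def)
    ultimately have Fn: "\<bar>F n x\<bar> \<le> real n * indicator ?E x" for x
      by (metis abs_of_nonneg order_trans)
    have F0: "x \<in> ?E" if "F n x \<noteq> 0" for x
      using Fn[of x] that by (cases "x \<in> ?E") simp_all
    \<comment> \<open>The gradient \<open>\<rho> + 1\<close> need not be p-integrable over the whole
      space. As \<open>F n\<close> vanishes outside the ball, localization confines the gradient to
      a set of finite measure.\<close>
    have w': "path_wug m p (F n) (\<lambda>x. \<rho> x + 1)"
    proof (rule path_wug_add[OF m wug_imp_path_wug[OF m p w] path_wug_lipschitz[OF \<eta>_lip]])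
      show "\<bar>F n x - F n y\<bar> \<le> \<bar>f' x - f' y\<bar> + \<bar>\<eta> n x - \<eta> n y\<bar>" for x y
        unfolding F_def by (auto simp: max_def min_def abs_if)
    qed
    have "(\<integral>\<^sup>+ x. epowr ((\<rho> x + 1) * indicator ?E x) p \<partial>m)
        \<le> (\<integral>\<^sup>+ x. ennreal (2 powr p) * (epowr (\<rho> x) p + indicator ?E x) \<partial>m)"
    proof (intro nn_integral_mono)
      fix x
      have "epowr 1 p = 1" by (simp add: epowr_def)
      then show "epowr ((\<rho> x + 1) * indicator ?E x) p \<le> ennreal (2 powr p) * (epowr (\<rho> x) p + indicator ?E x)"
        using epowr_add_le[of p "\<rho> x" 1] p by (auto simp: indicator_def)
    qed
    also have "\<dots> = ennreal (2 powr p) * ((\<integral>\<^sup>+ x. epowr (\<rho> x) p \<partial>m) + emeasure m ?E)"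
    proof -
      have [measurable]: "(\<lambda>x. epowr (\<rho> x) p) \<in> borel_measurable m" by measurable
      have [measurable]: "?E \<in> sets m" by (fact E)
      show ?thesis by (subst nn_integral_cmult, measurable, subst nn_integral_add) simp_all
    qed
    also have "\<dots> < \<infinity>" using fin Efin by (simp add: ennreal_mult_less_top)
    finally have "wug m p (F n) (\<lambda>x. (\<rho> x + 1) * indicator ?E x)"
      using F0 by (intro path_wug_localize[OF m w', where N="{}"]) auto
    then have Dsp: "Dsp m p (F n)" unfolding Dsp_def cwug_def using F_meas by blast
    have "(\<integral>\<^sup>+ x. ennreal (\<bar>F n x\<bar> powr p) \<partial>completion m) \<le> (\<integral>\<^sup>+ x. ennreal (real n powr p) * indicator ?E x \<partial>completion m)"
    proof (intro nn_integral_mono)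
      fix x
      have "\<bar>F n x\<bar> powr p \<le> (real n * indicator ?E x) powr p"
        using Fn[of x] p by (intro powr_mono2) auto
      then show "ennreal (\<bar>F n x\<bar> powr p) \<le> ennreal (real n powr p) * indicator ?E x"
        by (cases "x \<in> ?E") (auto intro: ennreal_leI)
    qed
    also have "\<dots> = ennreal (real n powr p) * emeasure m ?E"
      using E by (subst nn_integral_cmult_indicator) auto
    also have "\<dots> < \<infinity>" using Efin by (simp add: ennreal_mult_less_top)
    finally show ?thesis using Dsp by (simp add: Wsp_def)
  qed
  have F_eq: "\<exists>n. F n x = f' x" for x
  proof -
    \<comment> \<open>For such n the height \<open>\<eta> n x\<close> exceeds |f' x|, so the
      truncation leaves the value unchanged.\<close>
    obtain n where "\<bar>f' x\<bar> + dist x x0 < real n" using reals_Archimedean2 by blast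
    then have "F n x = f' x" by (auto simp: F_def \<eta>_def)
    then show ?thesis ..
  qed
  have "AE x in m. \<exists>n. F n x = f x" using eq by eventually_elim (metis F_eq)
  then show ?thesis using F_Wsp by blast
qed

section \<open>Integrability exponents\<close>

lemma Linf_const [simp]: "Linf m (\<lambda>_. c)"
  unfolding Linf_def by (auto intro!: exI[of _ "\<bar>c\<bar>"])

lemma Linf_indicator: "E \<in> sets m \<Longrightarrow> Linf m (indicator E)"
  unfolding Linf_def by (auto intro!: exI[of _ 1] simp: indicator_def)

lemma Linf_add_const: "Linf m h \<Longrightarrow> Linf m (\<lambda>x. h x + c)"
proof -
  assume h: "Linf m h"
  then obtain C where "AE x in m. \<bar>h x\<bar> \<le> C" by (auto simp: Linf_def)
  then have "AE x in m. \<bar>h x + c\<bar> \<le> C + \<bar>c\<bar>" by eventually_elim auto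
  then show ?thesis using h by (auto simp: Linf_def)
qed

section \<open>Limit arguments at a single point\<close>

lemma zero_of_small_bounds:
  fixes r s :: "nat \<Rightarrow> real"
  assumes "0 \<le> K" "\<forall>e>0. \<exists>i. r i < e" "\<forall>e>0. \<exists>i. s i < e" "\<forall>i j. \<bar>a\<bar> \<le> K * (r i + s j)"
  shows "a = (0::real)"
proof (rule ccontr)
  assume "a \<noteq> 0"
  \<comment> \<open>With 2 * K + 1 in place of 2 * K the quotient makes sense for K = 0 and the
    final comparison is strict.\<close>
  define e where "e = \<bar>a\<bar> / (2 * K + 1)"
  have e: "0 < e" using \<open>a \<noteq> 0\<close> assms(1) by (simp add: e_def)
  then obtain i j where "r i < e" "s j < e" using assms by meson
  then have "K * (r i + s j) \<le> K * (2 * e)" using assms(1) by (intro mult_left_mono) auto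
  also have "\<dots> < (2 * K + 1) * e" using e by (simp add: algebra_simps)
  also have "\<dots> = \<bar>a\<bar>" using assms(1) by (simp add: e_def)
  finally show False using assms(4) by (meson not_less)
qed

lemma le_of_small_perturbations:
  fixes r :: "nat \<Rightarrow> real"
  assumes K: "0 \<le> K" and small: "\<forall>e>0. \<exists>i. r i < e" and le: "\<forall>i. a \<le> b + K * r i"
  shows "a \<le> b"
proof (rule field_le_epsilon)
  fix e :: real assume e: "0 < e"
  then have "0 < e / (K + 1)" using K by simp
  then obtain i where "r i < e / (K + 1)" using small by blast
  then have "K * r i \<le> K * (e / (K + 1))" using K by (intro mult_left_mono) auto
  also have "\<dots> \<le> e" using e K by (simp add: field_simps)
  finally show "a \<le> b + e" using le[rule_format, of i] by linarith
qed

text \<open>The McShane estimate at one point: D i and D0 are the values of \<delta> at F i and at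
  h, while r i and r0 are the distances of \<omega> from their differentials. The lower bound holds
  for every term of the infimum; the upper one uses indices with small r i. By the hypothesis on c,
  the maximum changes no term.\<close>

lemma abs_INF_diff_le:
  fixes D r :: "nat \<Rightarrow> real"
  assumes g: "0 \<le> g" and small: "\<forall>e>0. \<exists>i. r i < e" and c: "\<forall>i. c \<le> D i + g * r i"
    and D0: "\<forall>i. \<bar>D i - D0\<bar> \<le> g * (r i + r0)"
  shows "\<bar>(INF i. max c (D i + g * r i)) - D0\<bar> \<le> g * r0"
proof -
  have bdd: "bdd_below (range (\<lambda>i. max c (D i + g * r i)))" by (rule bdd_belowI[of _ c]) auto
  have lo: "D0 - g * r0 \<le> (INF i. max c (D i + g * r i))"
  proof (rule cINF_greatest)
    fix i show "D0 - g * r0 \<le> max c (D i + g * r i)"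
      using D0[rule_format, of i] by (auto simp: algebra_simps abs_le_iff max_def)
  qed simp
  have "(INF i. max c (D i + g * r i)) \<le> D0 + g * r0 + e" if e: "0 < e" for e
  proof -
    have "0 < e / (2 * g + 1)" using e g by simp
    then obtain i where i: "r i < e / (2 * g + 1)" using small by blast
    have "(INF i. max c (D i + g * r i)) \<le> max c (D i + g * r i)" by (rule cINF_lower[OF bdd]) simp
    also have "\<dots> = D i + g * r i" using c by (simp add: max_absorb2)
    also have "\<dots> \<le> D0 + g * r0 + 2 * g * r i"
      using D0[rule_format, of i] by (auto simp: algebra_simps abs_le_iff)
    also have "2 * g * r i \<le> 2 * g * (e / (2 * g + 1))" using i g by (intro mult_left_mono) auto
    also have "\<dots> \<le> e" using e g by (simp add: field_simps)
    finally show ?thesis by simp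
  qed
  then have "(INF i. max c (D i + g * r i)) \<le> D0 + g * r0" by (rule field_le_epsilon)
  with lo show ?thesis by (simp add: abs_le_iff)
qed

section \<open>Sums, multiples and products of functions in \<open>Lq_pos\<close>\<close>

lemma Lq_pos_add:
  assumes f: "Lq_pos m q f" and g: "Lq_pos m q g" and q: "1 < q"
  shows "Lq_pos m q (\<lambda>x. f x + g x)"
proof -
  have [measurable]: "f \<in> borel_measurable m" "g \<in> borel_measurable m" using f g by (auto simp: Lq_pos_def)
  have nn: "AE x in m. 0 \<le> f x" "AE x in m. 0 \<le> g x" using f g by (auto simp: Lq_pos_def)
  have "AE x in m. 0 \<le> f x + g x" using nn by eventually_elim simp
  moreover have "\<exists>C. AE x in m. f x + g x \<le> C" if "q = \<infinity>"
  proof -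
    obtain C D where "AE x in m. f x \<le> C" "AE x in m. g x \<le> D" using f g \<open>q = \<infinity>\<close> by (auto simp: Lq_pos_def)
    then have "AE x in m. f x + g x \<le> C + D" by eventually_elim simp
    then show ?thesis ..
  qed
  moreover have "(\<integral>\<^sup>+ x. ennreal (\<bar>f x + g x\<bar> powr enn2real q) \<partial>m) < \<infinity>" if "q \<noteq> \<infinity>"
  proof -
    define r where "r = enn2real q"
    have r: "0 \<le> r" by (simp add: r_def)
    have "ennreal (\<bar>f x + g x\<bar> powr r) \<le> ennreal (2 powr r) * (ennreal (\<bar>f x\<bar> powr r) + ennreal (\<bar>g x\<bar> powr r))" for x
    proof -
      have "epowr (ennreal \<bar>f x + g x\<bar>) r \<le> epowr (ennreal \<bar>f x\<bar> + ennreal \<bar>g x\<bar>) r"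
        using r by (intro epowr_mono) (simp_all add: ennreal_leI flip: ennreal_plus)
      also have "\<dots> \<le> ennreal (2 powr r) * (epowr (ennreal \<bar>f x\<bar>) r + epowr (ennreal \<bar>g x\<bar>) r)"
        using r by (intro epowr_add_le) simp
      finally show ?thesis by (simp add: epowr_def)
    qed
    then have "(\<integral>\<^sup>+ x. ennreal (\<bar>f x + g x\<bar> powr r) \<partial>m)
        \<le> (\<integral>\<^sup>+ x. ennreal (2 powr r) * (ennreal (\<bar>f x\<bar> powr r) + ennreal (\<bar>g x\<bar> powr r)) \<partial>m)"
      by (intro nn_integral_mono)
    also have "\<dots> = ennreal (2 powr r) * ((\<integral>\<^sup>+ x. ennreal (\<bar>f x\<bar> powr r) \<partial>m) + (\<integral>\<^sup>+ x. ennreal (\<bar>g x\<bar> powr r) \<partial>m))"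
      by (subst nn_integral_cmult) (auto simp: nn_integral_add)
    also have "\<dots> < \<infinity>" using f g that by (simp add: Lq_pos_def r_def ennreal_mult_less_top)
    finally show ?thesis by (simp add: r_def)
  qed
  ultimately show ?thesis unfolding Lq_pos_def by auto
qed

lemma Lq_pos_cmult:
  assumes f: "Lq_pos m q f" and c: "0 \<le> c"
  shows "Lq_pos m q (\<lambda>x. c * f x)"
proof -
  have [measurable]: "f \<in> borel_measurable m" using f by (auto simp: Lq_pos_def)
  have nn: "AE x in m. 0 \<le> f x" using f by (auto simp: Lq_pos_def)
  have "AE x in m. 0 \<le> c * f x" using nn by eventually_elim (simp add: c)
  moreover have "\<exists>C. AE x in m. c * f x \<le> C" if "q = \<infinity>"
  proof -
    obtain C where "AE x in m. f x \<le> C" using f \<open>q = \<infinity>\<close> by (auto simp: Lq_pos_def)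
    then have "AE x in m. c * f x \<le> c * C" by eventually_elim (simp add: c mult_left_mono)
    then show ?thesis ..
  qed
  moreover have "(\<integral>\<^sup>+ x. ennreal (\<bar>c * f x\<bar> powr enn2real q) \<partial>m) < \<infinity>" if "q \<noteq> \<infinity>"
  proof -
    have "(\<integral>\<^sup>+ x. ennreal (\<bar>c * f x\<bar> powr enn2real q) \<partial>m) = (\<integral>\<^sup>+ x. ennreal (\<bar>c\<bar> powr enn2real q) * ennreal (\<bar>f x\<bar> powr enn2real q) \<partial>m)"
      by (simp add: abs_mult powr_mult ennreal_mult)
    also have "\<dots> = ennreal (\<bar>c\<bar> powr enn2real q) * (\<integral>\<^sup>+ x. ennreal (\<bar>f x\<bar> powr enn2real q) \<partial>m)"
      by (intro nn_integral_cmult) measurable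
    also have "\<dots> < \<infinity>" using f that by (simp add: Lq_pos_def ennreal_mult_less_top)
    finally show ?thesis .
  qed
  ultimately show ?thesis unfolding Lq_pos_def by auto
qed

text \<open>Young's inequality stands in for that of Hoelder, since integrability is wanted and no
  norm bound. The pair q = \<infinity>, p = 1 is treated apart.\<close>

lemma integrable_mult_Lq_pos:
  assumes q: "1 < q" and p: "p = (if q = \<infinity> then 1 else enn2real q / (enn2real q - 1))"
    and f: "Lq_pos m q f" and g: "Lq_pos m (ennreal p) g"
  shows "integrable m (\<lambda>x. f x * g x)"
proof -
  have [measurable]: "f \<in> borel_measurable m" "g \<in> borel_measurable m" using f g by (auto simp: Lq_pos_def)
  have nn: "AE x in m. 0 \<le> f x" "AE x in m. 0 \<le> g x" using f g by (auto simp: Lq_pos_def)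
  have "0 \<le> p" 
  proof (cases "q = \<infinity>")
    case False
    then have "1 < enn2real q" using q by (cases q) (auto simp: ennreal_less_iff simp flip: ennreal_1)
    then show ?thesis using p by simp
  qed (simp add: p)
  then have g_int: "integrable m (\<lambda>x. \<bar>g x\<bar> powr p)"
    using g by (intro integrableI_nonneg) (auto simp: Lq_pos_def)
  show ?thesis
  proof (cases "q = \<infinity>")
    case True
    then have p1: "p = 1" using p by simp
    obtain C where C: "AE x in m. f x \<le> C" using f True by (auto simp: Lq_pos_def)
    show ?thesis
    proof (rule Bochner_Integration.integrable_bound)
      show "integrable m (\<lambda>x. C * \<bar>g x\<bar> powr p)" using g_int by (rule integrable_mult_right)
      show "AE x in m. norm (f x * g x) \<le> norm (C * \<bar>g x\<bar> powr p)"
        using C nn by eventually_elim (auto simp: p1 abs_mult mult_right_mono)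
    qed simp
  next
    case False
    define r where "r = enn2real q"
    have r: "1 < r" using q False by (cases q) (auto simp: r_def ennreal_less_iff simp flip: ennreal_1)
    have p1: "p = r / (r - 1)" using p False by (simp add: r_def)
    have conj: "1 / r + 1 / p = 1" "1 < p" using r by (simp_all add: p1 field_simps)
    have f_int: "integrable m (\<lambda>x. \<bar>f x\<bar> powr r)"
      using f False by (intro integrableI_nonneg) (auto simp: Lq_pos_def r_def)
    show ?thesis
    proof (rule Bochner_Integration.integrable_bound)
      show "integrable m (\<lambda>x. \<bar>f x\<bar> powr r / r + \<bar>g x\<bar> powr p / p)" using f_int g_int by simp
      show "AE x in m. norm (f x * g x) \<le> norm (\<bar>f x\<bar> powr r / r + \<bar>g x\<bar> powr p / p)"
        using nn
      proof eventually_elim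
        case (elim x)
        then have "f x * g x \<le> f x powr r / r + g x powr p / p"
          using Youngs_inequality[OF r conj(2) conj(1), of "f x" "g x"] by simp
        then show ?case using elim r conj by (simp add: abs_mult)
      qed
    qed simp
  qed
qed

section \<open>The cotangent module\<close>

locale cotangent =
  fixes m :: "'a::metric_space measure"
    and p :: real
    and add :: "'v \<Rightarrow> 'v \<Rightarrow> 'v" and zero :: 'v
    and mul :: "('a \<Rightarrow> real) \<Rightarrow> 'v \<Rightarrow> 'v"
    and pn :: "'v \<Rightarrow> 'a \<Rightarrow> real"
    and d :: "('a \<Rightarrow> real) \<Rightarrow> 'v"
  assumes borel: "sets m = sets borel"
    and bdd_fin: "\<And>B. B \<in> sets borel \<Longrightarrow> bounded B \<Longrightarrow> emeasure m B < \<infinity>"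
    and p_ge_1: "1 \<le> p"
    and cot: "cotangent_module m p add zero mul pn d"
begin

abbreviation "sub \<equiv> msub add mul"

lemma p_pos: "0 < p" using p_ge_1 by simp

lemma module: "Linf_module m p add zero mul pn"
  using cot by (simp add: cotangent_module_def)

lemmas pn_module_axioms = module[unfolded Linf_module_def]

text \<open>The axioms are extracted by their position in the conjunction. \<open>mul_mul\<close> is
  reversed so that rewriting merges nested multipliers into one.\<close>

lemmas add_assoc = pn_module_axioms[THEN conjunct1, rule_format]
lemmas add_commute = pn_module_axioms[THEN conjunct2, THEN conjunct1, rule_format]
lemmas add_zero = pn_module_axioms[THEN conjunct2, THEN conjunct2, THEN conjunct1, rule_format]
lemmas add_uminus = pn_module_axioms[THEN conjunct2, THEN conjunct2, THEN conjunct2, THEN conjunct1, rule_format]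
lemmas mul_add_left = pn_module_axioms[THEN conjunct2, THEN conjunct2, THEN conjunct2, THEN conjunct2, THEN conjunct1, rule_format]
lemmas mul_add_right = pn_module_axioms[THEN conjunct2, THEN conjunct2, THEN conjunct2, THEN conjunct2, THEN conjunct2, THEN conjunct1, rule_format]
lemmas mul_mul = pn_module_axioms[THEN conjunct2, THEN conjunct2, THEN conjunct2, THEN conjunct2, THEN conjunct2, THEN conjunct2, THEN conjunct1, rule_format, symmetric]
lemmas mul_1 = pn_module_axioms[THEN conjunct2, THEN conjunct2, THEN conjunct2, THEN conjunct2, THEN conjunct2, THEN conjunct2, THEN conjunct2, THEN conjunct1, rule_format]
lemmas pn_Lp = pn_module_axioms[THEN conjunct2, THEN conjunct2, THEN conjunct2, THEN conjunct2, THEN conjunct2, THEN conjunct2, THEN conjunct2, THEN conjunct2, THEN conjunct2, THEN conjunct1, rule_format]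
lemmas pn_add = pn_module_axioms[THEN conjunct2, THEN conjunct2, THEN conjunct2, THEN conjunct2, THEN conjunct2, THEN conjunct2, THEN conjunct2, THEN conjunct2, THEN conjunct2, THEN conjunct2, THEN conjunct2, THEN conjunct1, rule_format]
lemmas pn_mul = pn_module_axioms[THEN conjunct2, THEN conjunct2, THEN conjunct2, THEN conjunct2, THEN conjunct2, THEN conjunct2, THEN conjunct2, THEN conjunct2, THEN conjunct2, THEN conjunct2, THEN conjunct2, THEN conjunct2, THEN conjunct1, rule_format]

lemmas cotangent_axioms' = cot[unfolded cotangent_module_def]

lemmas d_add = cotangent_axioms'[THEN conjunct2, THEN conjunct1, rule_format]
lemmas d_cmult = cotangent_axioms'[THEN conjunct2, THEN conjunct2, THEN conjunct1, rule_format]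
lemmas d_cong_AE = cotangent_axioms'[THEN conjunct2, THEN conjunct2, THEN conjunct2, THEN conjunct1, rule_format]
lemmas pn_d = cotangent_axioms'[THEN conjunct2, THEN conjunct2, THEN conjunct2, THEN conjunct2, THEN conjunct1, rule_format]
lemmas glued_dense = cotangent_axioms'[THEN conjunct2, THEN conjunct2, THEN conjunct2, THEN conjunct2, THEN conjunct2, rule_format]

lemma pn_nonneg: "AE x in m. 0 \<le> pn v x"
  and pn_measurable [measurable]: "pn v \<in> borel_measurable m"
  using pn_Lp[of v] by (auto simp: Lq_pos_def)

lemma mul_0: "mul (\<lambda>_. 0) v = zero"
  using mul_add_left[of "\<lambda>_. 1" "\<lambda>_. -1" v] by (simp add: mul_1 add_uminus)

lemma pn_zero: "AE x in m. pn zero x = 0"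
  using pn_mul[of "\<lambda>_. 0" zero] by (simp add: mul_0)

lemma add_left_commute: "add u (add v w) = add v (add u w)"
  by (metis add_assoc add_commute)

lemmas add_ac' = add_assoc add_commute add_left_commute

lemma sub_self: "sub v v = zero"
  by (simp add: msub_def add_uminus)

lemma uminus_uminus: "mul (\<lambda>_. -1) (mul (\<lambda>_. -1) v) = v"
  by (simp add: mul_mul mul_1)

lemma sub_zero: "sub v zero = v"
proof -
  have "mul (\<lambda>_. -1) zero = zero" using add_uminus[of zero] add_zero add_commute by metis
  then show ?thesis by (simp add: msub_def add_zero)
qed

lemma sub_telescope: "sub u w = add (sub u v) (sub v w)"
proof -
  have "add (sub u v) (sub v w) = add (add u (mul (\<lambda>_. -1) w)) (add v (mul (\<lambda>_. -1) v))"
    unfolding msub_def by (simp add: add_ac')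
  then show ?thesis by (simp add: add_uminus add_zero msub_def)
qed

lemma sub_swap: "sub v u = mul (\<lambda>_. -1) (sub u v)"
  by (simp add: msub_def mul_add_right uminus_uminus add_commute)

lemma sub_add_add: "sub (add u v) (add u' v') = add (sub u u') (sub v v')"
  by (simp add: msub_def mul_add_right add_ac')

lemma mul_sub:
  assumes "Linf m h"
  shows "mul h (sub v w) = sub (mul h v) (mul h w)"
  using assms by (simp add: msub_def mul_add_right mul_mul mult.commute)

lemma pn_sub_triangle: "AE x in m. pn (sub u w) x \<le> pn (sub u v) x + pn (sub v w) x"
  unfolding sub_telescope[of u w v] by (rule pn_add)

lemma pn_sub_commute: "AE x in m. pn (sub u v) x = pn (sub v u) x"
  using pn_mul[of "\<lambda>_. -1" "sub v u"] by (simp add: sub_swap[of u v])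

section \<open>Differentials and their pointwise density\<close>

lemma d_sub:
  assumes "Dsp m p f" "Dsp m p g"
  shows "sub (d f) (d g) = d (\<lambda>x. f x + (-1) * g x)"
  using assms Dsp_cmult[OF borel p_pos, of g "-1"] d_add[of f "\<lambda>x. -1 * g x"] d_cmult[of g "-1"]
  by (simp add: msub_def)

lemma Dsp_zero: "Dsp m p (\<lambda>_. 0)"
proof -
  have "wug m p (\<lambda>_. 0) (\<lambda>_. 0)" unfolding wug_def using Mod_empty[of m p] by auto
  then show ?thesis
    unfolding Dsp_def cwug_def by (intro conjI exI[of _ "\<lambda>_. 0"]) auto
qed

lemma Wsp_zero: "Wsp m p (\<lambda>_. 0)"
  using Dsp_zero by (simp add: Wsp_def)

lemma d_zero: "d (\<lambda>_. 0) = zero"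
  using d_cmult[OF Dsp_zero, of 0] by (simp add: mul_0)

lemma Wsp_Dsp: "Wsp m p f \<Longrightarrow> Dsp m p f"
  by (simp add: Wsp_def)

text \<open>Transfers \<open>min_wug_locality\<close> to the module, as \<open>pn (d f)\<close> is a
  real-valued version of a minimal weak upper gradient.\<close>

lemma pn_d_locality:
  assumes f: "Dsp m p f" and E: "AE x in m. x \<in> E \<longrightarrow> f x = 0"
  shows "AE x in m. x \<in> E \<longrightarrow> pn (d f) x = 0"
proof -
  obtain G where G: "min_wug m p f G" "AE x in m. ennreal (pn (d f) x) = G x"
    using pn_d[OF f] by blast
  show ?thesis
    using min_wug_locality[OF borel p_pos G(1) E] G(2) pn_nonneg[of "d f"]
    by eventually_elim (metis ennreal_eq_0_iff order_antisym)
qed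

text \<open>\<open>Dsp\<close> is a vector space and \<open>d\<close> is linear on it, so the span
  in the density axiom is just the range of \<open>d\<close>.\<close>

lemma in_dspan_imp_d:
  assumes "in_dspan m p add zero mul d \<omega>"
  shows "\<exists>f. Dsp m p f \<and> \<omega> = d f"
proof -
  obtain k c fs where fs: "\<forall>i<k. Dsp m p (fs i)" and \<omega>: "\<omega> = msum add zero (\<lambda>i. mul (\<lambda>_. c i) (d (fs i))) k"
    using assms unfolding in_dspan_def by blast
  have "\<exists>f. Dsp m p f \<and> msum add zero (\<lambda>i. mul (\<lambda>_. c i) (d (fs i))) j = d f" if "j \<le> k" for j
    using that
  proof (induction j)
    case 0
    then show ?case using Dsp_zero d_zero by auto
  next
    case (Suc j)
    then obtain f where f: "Dsp m p f" "msum add zero (\<lambda>i. mul (\<lambda>_. c i) (d (fs i))) j = d f" by auto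
    have g: "Dsp m p (fs j)" using fs Suc by simp
    have "Dsp m p (\<lambda>x. f x + c j * fs j x)"
      by (intro Dsp_add Dsp_cmult borel p_pos f g)
    moreover have "msum add zero (\<lambda>i. mul (\<lambda>_. c i) (d (fs i))) (Suc j) = d (\<lambda>x. f x + c j * fs j x)"
      using f d_add[OF f(1) Dsp_cmult[OF borel p_pos g, of "c j"]] d_cmult[OF g] by simp
    ultimately show ?case by blast
  qed
  then show ?thesis using \<omega> by blast
qed

lemma d_approx_Wsp:
  assumes f: "Dsp m p f"
  shows "\<exists>F :: nat \<Rightarrow> 'a \<Rightarrow> real. (\<forall>n. Wsp m p (F n)) \<and> (AE x in m. \<exists>n. pn (sub (d f) (d (F n))) x = 0)"
proof -
  obtain F :: "nat \<Rightarrow> 'a \<Rightarrow> real" where F: "\<And>n. Wsp m p (F n)" and eq: "AE x in m. \<exists>n. F n x = f x"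
    using Dsp_Wsp_exhaustion[OF borel bdd_fin p_pos f] by blast
  have "AE x in m. x \<in> {x. F n x = f x} \<longrightarrow> pn (sub (d f) (d (F n))) x = 0" for n
    unfolding d_sub[OF f Wsp_Dsp[OF F]]
    by (intro pn_d_locality Dsp_add Dsp_cmult borel p_pos f Wsp_Dsp[OF F]) auto
  then have "AE x in m. \<forall>n. x \<in> {x. F n x = f x} \<longrightarrow> pn (sub (d f) (d (F n))) x = 0"
    by (simp add: AE_all_countable)
  with eq have "AE x in m. \<exists>n. pn (sub (d f) (d (F n))) x = 0" by eventually_elim auto
  then show ?thesis using F by blast
qed

text \<open>On the piece \<open>E n\<close> the pointwise norm of \<open>sub w (\<omega>s n)\<close>
  vanishes, because its product with the indicator is \<open>zero\<close>; and
  \<open>\<omega>s n\<close> is met exactly, at almost every point, by one of countably many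
  differentials. The resulting double sequence is enumerated by \<open>prod_decode\<close>.\<close>

lemma glued_approx_Wsp:
  assumes "glued_dspan m p add zero mul d w"
  shows "\<exists>F :: nat \<Rightarrow> 'a \<Rightarrow> real. (\<forall>n. Wsp m p (F n)) \<and> (AE x in m. \<exists>n. pn (sub w (d (F n))) x = 0)"
proof -
  obtain E \<omega>s where E: "borel_partition m E" and span: "\<And>n. in_dspan m p add zero mul d (\<omega>s n)"
    and glue: "\<And>n. mul (indicator (E n)) w = mul (indicator (E n)) (\<omega>s n)"
    using assms unfolding glued_dspan_def by blast
  have "\<exists>F :: nat \<Rightarrow> 'a \<Rightarrow> real. (\<forall>j. Wsp m p (F j)) \<and> (AE x in m. \<exists>j. pn (sub (\<omega>s n) (d (F j))) x = 0)" for n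
  proof -
    obtain f where "Dsp m p f" "\<omega>s n = d f" using in_dspan_imp_d[OF span[of n]] by blast
    then show ?thesis using d_approx_Wsp[of f] by simp
  qed
  then obtain F :: "nat \<Rightarrow> nat \<Rightarrow> 'a \<Rightarrow> real" where F: "\<And>n j. Wsp m p (F n j)"
    and F0: "\<And>n. AE x in m. \<exists>j. pn (sub (\<omega>s n) (d (F n j))) x = 0" by metis
  have loc: "AE x in m. x \<in> E n \<longrightarrow> pn (sub w (\<omega>s n)) x = 0" for n
  proof -
    have h: "Linf m (indicator (E n))" using E by (auto simp: borel_partition_def intro: Linf_indicator)
    have "mul (indicator (E n)) (sub w (\<omega>s n)) = zero"
      unfolding mul_sub[OF h] glue by (rule sub_self)
    then have "AE x in m. pn zero x = \<bar>indicator (E n) x\<bar> * pn (sub w (\<omega>s n)) x"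
      using pn_mul[OF h, of "sub w (\<omega>s n)"] by simp
    with pn_zero show ?thesis by eventually_elim auto
  qed
  define F' where "F' i = F (fst (prod_decode i)) (snd (prod_decode i))" for i
  have F': "F' (prod_encode (n, j)) = F n j" for n j by (simp add: F'_def)
  have "AE x in m. \<forall>n. \<exists>j. pn (sub (\<omega>s n) (d (F n j))) x = 0" using F0 by (simp add: AE_all_countable)
  moreover have "AE x in m. \<forall>n. x \<in> E n \<longrightarrow> pn (sub w (\<omega>s n)) x = 0" using loc by (simp add: AE_all_countable)
  moreover have "AE x in m. \<forall>n j. pn (sub w (d (F n j))) x \<le> pn (sub w (\<omega>s n)) x + pn (sub (\<omega>s n) (d (F n j))) x"
    unfolding AE_all_countable by (intro allI pn_sub_triangle)
  moreover have "AE x in m. \<forall>n j. 0 \<le> pn (sub w (d (F n j))) x"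
    unfolding AE_all_countable by (intro allI pn_nonneg)
  moreover have "AE x in m. x \<in> space m" by (rule AE_space)
  ultimately have "AE x in m. \<exists>i. pn (sub w (d (F' i))) x = 0"
  proof eventually_elim
    case (elim x)
    then obtain n where n: "x \<in> E n" using E unfolding borel_partition_def by blast
    obtain j where j: "pn (sub (\<omega>s n) (d (F n j))) x = 0" using elim(1) by blast
    have "pn (sub w (d (F n j))) x \<le> 0" using elim(2,3) n j by (metis add_0)
    then have "pn (sub w (d (F n j))) x = 0" using elim(4) by (metis order_antisym)
    then show ?case by (metis F')
  qed
  moreover have "\<forall>i. Wsp m p (F' i)" by (simp add: F'_def F)
  ultimately show ?thesis by blast
qed

text \<open>\<open>mnorm\<close> is built from the Bochner integral, which would be 0 for a
  nonintegrable function. Integrability from \<open>pn_Lp\<close> makes a small \<open>mnorm\<close>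
  genuinely small.\<close>

lemma nn_integral_pn_less:
  assumes "mnorm m p pn v < e"
  shows "(\<integral>\<^sup>+ x. ennreal (\<bar>pn v x\<bar> powr p) \<partial>m) \<le> ennreal (e powr p)"
proof -
  let ?I = "\<integral> x. \<bar>pn v x\<bar> powr p \<partial>m"
  have int: "integrable m (\<lambda>x. \<bar>pn v x\<bar> powr p)"
    using pn_Lp[of v] p_pos by (intro integrableI_nonneg) (auto simp: Lq_pos_def)
  have I: "0 \<le> ?I" by (intro integral_nonneg_AE) auto
  have "?I powr (1 / p) < e" using assms by (simp add: mnorm_def)
  then have "(?I powr (1 / p)) powr p \<le> e powr p" using p_pos by (intro powr_mono2) auto
  then have "?I \<le> e powr p" using I p_pos by (simp add: powr_powr)
  then show ?thesis
    using nn_integral_eq_integral[OF int] by (simp add: ennreal_leI)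
qed

text \<open>The infimum of the pointwise distances over a suitable countable family has vanishing \<open>L\<^sup>p\<close> norm.\<close>

lemma pointwise_dense:
  "\<exists>F :: nat \<Rightarrow> 'a \<Rightarrow> real. (\<forall>i. Wsp m p (F i)) \<and> (AE x in m. \<forall>e>0. \<exists>i. pn (sub \<omega> (d (F i))) x < e)"
proof -
  have "\<exists>w. glued_dspan m p add zero mul d w \<and> mnorm m p pn (sub \<omega> w) < 1 / real (Suc k)" for k
    by (rule glued_dense) simp
  then obtain w where w: "\<And>k. glued_dspan m p add zero mul d (w k)"
    and wn: "\<And>k. mnorm m p pn (sub \<omega> (w k)) < 1 / real (Suc k)" by metis
  obtain F :: "nat \<Rightarrow> nat \<Rightarrow> 'a \<Rightarrow> real" where F: "\<And>k i. Wsp m p (F k i)"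
    and F0: "\<And>k. AE x in m. \<exists>i. pn (sub (w k) (d (F k i))) x = 0"
    using glued_approx_Wsp[OF w] by metis
  define F' where "F' i = F (fst (prod_decode i)) (snd (prod_decode i))" for i
  have F': "F' (prod_encode (n, j)) = F n j" for n j by (simp add: F'_def)
  \<comment> \<open>Taking the infimum in \<open>ennreal\<close> gives measurability without any
    concern about bounds from below.\<close>
  define H where "H x = (INF i. ennreal (pn (sub \<omega> (d (F' i))) x))" for x
  have [measurable]: "H \<in> borel_measurable m" unfolding H_def by measurable
  \<comment> \<open>At almost every point some \<open>F k j\<close> has exactly the differential
    \<open>w k\<close>, so the distance of \<omega> from the family is at most that from
    \<open>w k\<close>.\<close>
  have H_le: "AE x in m. H x \<le> ennreal \<bar>pn (sub \<omega> (w k)) x\<bar>" for k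
  proof -
    have "AE x in m. \<forall>j. pn (sub \<omega> (d (F k j))) x \<le> pn (sub \<omega> (w k)) x + pn (sub (w k) (d (F k j))) x"
      unfolding AE_all_countable by (intro allI pn_sub_triangle)
    with F0[of k] show ?thesis
    proof eventually_elim
      case (elim x)
      then obtain j where j: "pn (sub (w k) (d (F k j))) x = 0" by blast
      have "H x \<le> ennreal (pn (sub \<omega> (d (F' (prod_encode (k, j))))) x)"
        unfolding H_def by (rule INF_lower) simp
      also have "\<dots> \<le> ennreal \<bar>pn (sub \<omega> (w k)) x\<bar>"
        unfolding F' using elim(2)[rule_format, of j] j by (intro ennreal_leI) simp
      finally show ?case .
    qed
  qed
  have le: "(\<integral>\<^sup>+ x. epowr (H x) p \<partial>m) \<le> ennreal ((1 / real (Suc k)) powr p)" for k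
  proof -
    have "(\<integral>\<^sup>+ x. epowr (H x) p \<partial>m) \<le> (\<integral>\<^sup>+ x. ennreal (\<bar>pn (sub \<omega> (w k)) x\<bar> powr p) \<partial>m)"
    proof (intro nn_integral_mono_AE)
      show "AE x in m. epowr (H x) p \<le> ennreal (\<bar>pn (sub \<omega> (w k)) x\<bar> powr p)"
        using H_le[of k]
      proof eventually_elim
        case (elim x)
        then have "epowr (H x) p \<le> epowr (ennreal \<bar>pn (sub \<omega> (w k)) x\<bar>) p"
          using p_pos by (intro epowr_mono) auto
        then show ?case by (simp add: epowr_def)
      qed
    qed
    also have "\<dots> \<le> ennreal ((1 / real (Suc k)) powr p)" by (rule nn_integral_pn_less[OF wn])
    finally show ?thesis .
  qed
  have "(\<lambda>k. (1 / real (Suc k)) powr p) \<longlonglongrightarrow> 0 powr p"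
    using p_pos by (intro tendsto_powr' LIMSEQ_Suc[OF lim_1_over_n] tendsto_const) auto
  then have "(\<lambda>k. ennreal ((1 / real (Suc k)) powr p)) \<longlonglongrightarrow> ennreal 0"
    by (intro tendsto_ennrealI) simp
  then have "(\<integral>\<^sup>+ x. epowr (H x) p \<partial>m) \<le> ennreal 0"
    by (rule LIMSEQ_le_const) (use le in blast)
  then have "(\<integral>\<^sup>+ x. epowr (H x) p \<partial>m) = 0" by simp
  then have "AE x in m. epowr (H x) p = 0" by (subst (asm) nn_integral_0_iff_AE) auto
  then have "AE x in m. \<forall>e>0. \<exists>i. pn (sub \<omega> (d (F' i))) x < e"
  proof eventually_elim
    case (elim x)
    then have "H x = 0"
      by (cases "H x") (auto simp: epowr_def powr_def split: if_splits)
    show ?case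
    proof (intro allI impI)
      fix e :: real assume "0 < e"
      then have "H x < ennreal e" using \<open>H x = 0\<close> by simp
      then obtain i where "ennreal (pn (sub \<omega> (d (F' i))) x) < ennreal e" unfolding H_def INF_less_iff by blast
      then show "\<exists>i. pn (sub \<omega> (d (F' i))) x < e" using \<open>0 < e\<close> by (metis ennreal_leI not_less)
    qed
  qed
  moreover have "\<forall>i. Wsp m p (F' i)" by (simp add: F'_def F)
  ultimately show ?thesis by blast
qed

section \<open>Extension of derivations\<close>

text \<open>Any two minimal weak upper gradients of f agree almost everywhere, also with
  \<open>pn (d f)\<close>, so the \<open>ennreal\<close> bound over all of them becomes one real
  bound. Nonnegativity of g makes the product pass through \<open>ennreal\<close>.\<close>

lemma derivation_bound_iff:
  assumes f: "Wsp m p f" and g: "AE x in m. 0 \<le> g x"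
  shows "(\<forall>G. min_wug m p f G \<longrightarrow> (AE x in m. ennreal \<bar>\<delta> f x\<bar> \<le> ennreal (g x) * G x))
    \<longleftrightarrow> (AE x in m. \<bar>\<delta> f x\<bar> \<le> g x * pn (d f) x)"
proof -
  obtain G where G: "min_wug m p f G" "AE x in m. ennreal (pn (d f) x) = G x"
    using pn_d[OF Wsp_Dsp[OF f]] by blast
  have iff: "(AE x in m. ennreal \<bar>\<delta> f x\<bar> \<le> ennreal (g x) * H x) \<longleftrightarrow> (AE x in m. \<bar>\<delta> f x\<bar> \<le> g x * pn (d f) x)"
    if H: "min_wug m p f H" for H
  proof -
    have "AE x in m. ennreal \<bar>\<delta> f x\<bar> \<le> ennreal (g x) * H x \<longleftrightarrow> \<bar>\<delta> f x\<bar> \<le> g x * pn (d f) x"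
      using min_wug_unique[OF G(1) H] G(2) g pn_nonneg[of "d f"]
    proof eventually_elim
      case (elim x)
      then have "ennreal (g x) * H x = ennreal (g x * pn (d f) x)" by (simp add: ennreal_mult)
      then show ?case using elim(3,4) by simp
    qed
    then show ?thesis by (rule eventually_subst)
  qed
  show ?thesis using iff[OF G(1)] iff G(1) by blast
qed

lemma
  assumes "sobder m p q \<delta>"
  shows sobder_add: "Wsp m p f \<Longrightarrow> Wsp m p h \<Longrightarrow> AE x in m. \<delta> (\<lambda>y. f y + h y) x = \<delta> f x + \<delta> h x"
    and sobder_cmult: "Wsp m p f \<Longrightarrow> AE x in m. \<delta> (\<lambda>y. c * f y) x = c * \<delta> f x"
    and sobder_integrable: "Wsp m p f \<Longrightarrow> integrable m (\<delta> f)"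
  using assms unfolding sobder_def by blast+

lemma sobder_diff_bound:
  assumes \<delta>: "sobder m p q \<delta>" and bound: "\<And>f. Wsp m p f \<Longrightarrow> AE x in m. \<bar>\<delta> f x\<bar> \<le> g x * pn (d f) x"
    and f: "Wsp m p f" and h: "Wsp m p h"
  shows "AE x in m. \<bar>\<delta> f x - \<delta> h x\<bar> \<le> g x * pn (sub (d f) (d h)) x"
proof -
  have h': "Wsp m p (\<lambda>x. (-1) * h x)" by (intro Wsp_cmult borel p_pos h)
  have s: "Wsp m p (\<lambda>x. f x + (-1) * h x)" by (intro Wsp_add borel p_pos f h')
  show ?thesis
    using bound[OF s] sobder_add[OF \<delta> f h'] sobder_cmult[OF \<delta> h, of "-1"]
    unfolding d_sub[OF Wsp_Dsp[OF f] Wsp_Dsp[OF h]] by eventually_elim simp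
qed

text \<open>The McShane formula \<open>inf\<^sub>f (\<delta> f + g |\<omega> - df|)\<close>, over a countable pointwise dense family.
  The truncation by \<open>- g |\<omega>|\<close> is inactive almost everywhere; it keeps the infimum meaningful
  at every point.\<close>

lemma mcshane_extension:
  assumes \<delta>: "sobder m p q \<delta>" and g: "Lq_pos m q g"
    and bound: "\<And>f. Wsp m p f \<Longrightarrow> AE x in m. \<bar>\<delta> f x\<bar> \<le> g x * pn (d f) x"
  shows "\<exists>v. \<forall>\<omega>. v \<omega> \<in> borel_measurable m \<and>
    (\<forall>h. Wsp m p h \<longrightarrow> (AE x in m. \<bar>v \<omega> x - \<delta> h x\<bar> \<le> g x * pn (sub \<omega> (d h)) x))"
\<comment> \<open>Each \<omega> gets its own dense family. No compatibility between the choices is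
  required: the estimate below, over all h in \<open>Wsp\<close>, determines
  \<open>v \<omega>\<close> almost everywhere.\<close>
proof (rule choice, rule allI)
  fix \<omega>
  have [measurable]: "g \<in> borel_measurable m" and g0: "AE x in m. 0 \<le> g x" using g by (auto simp: Lq_pos_def)
  obtain F :: "nat \<Rightarrow> 'a \<Rightarrow> real" where F: "\<And>i. Wsp m p (F i)"
    and dense: "AE x in m. \<forall>e>0. \<exists>i. pn (sub \<omega> (d (F i))) x < e"
    using pointwise_dense by blast
  have [measurable]: "\<delta> (F i) \<in> borel_measurable m" for i using sobder_integrable[OF \<delta> F] by auto
  define v where "v x = (INF i. max (- (g x * pn \<omega> x)) (\<delta> (F i) x + g x * pn (sub \<omega> (d (F i))) x))" for x
  have pair: "AE x in m. \<bar>\<delta> f x - \<delta> h x\<bar> \<le> g x * pn (sub (d f) (d h)) x" if "Wsp m p f" "Wsp m p h" for f h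
    by (rule sobder_diff_bound[OF \<delta> bound that])
  have diff: "AE x in m. \<forall>i. \<bar>\<delta> (F i) x - \<delta> h x\<bar> \<le> g x * (pn (sub \<omega> (d (F i))) x + pn (sub \<omega> (d h)) x)"
    if h: "Wsp m p h" for h
    unfolding AE_all_countable
  proof
    fix i
    show "AE x in m. \<bar>\<delta> (F i) x - \<delta> h x\<bar> \<le> g x * (pn (sub \<omega> (d (F i))) x + pn (sub \<omega> (d h)) x)"
      using pair[OF F h, of i] pn_sub_triangle[of "d (F i)" "d h" \<omega>]
        pn_sub_commute[of "d (F i)" \<omega>] g0
    proof eventually_elim
      case (elim x)
      then have "g x * pn (sub (d (F i)) (d h)) x \<le> g x * (pn (sub \<omega> (d (F i))) x + pn (sub \<omega> (d h)) x)"
        by (intro mult_left_mono) auto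
      then show ?case using elim(1) by linarith
    qed
  qed
  have \<delta>0: "AE x in m. \<delta> (\<lambda>_. 0) x = 0" using sobder_cmult[OF \<delta> Wsp_zero, of 0] by simp
  \<comment> \<open>The case h = 0 of \<open>diff\<close>, where the distance of \<omega> from the
    differential is \<open>pn \<omega>\<close>; it shows that the truncation is inactive.\<close>
  have low: "AE x in m. \<forall>i. - (g x * pn \<omega> x) \<le> \<delta> (F i) x + g x * pn (sub \<omega> (d (F i))) x"
    using diff[OF Wsp_zero] \<delta>0
  proof eventually_elim
    case (elim x)
    show ?case
    proof
      fix i
      have "\<bar>\<delta> (F i) x\<bar> \<le> g x * (pn (sub \<omega> (d (F i))) x + pn \<omega> x)"
        using elim(1)[rule_format, of i] elim(2) by (simp add: d_zero sub_zero)
      then show "- (g x * pn \<omega> x) \<le> \<delta> (F i) x + g x * pn (sub \<omega> (d (F i))) x"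
        by (simp add: algebra_simps abs_le_iff)
    qed
  qed
  have "v \<in> borel_measurable m"
    unfolding v_def
  proof (rule borel_measurable_cINF)
    show "bdd_below ((\<lambda>i. max (- (g x * pn \<omega> x)) (\<delta> (F i) x + g x * pn (sub \<omega> (d (F i))) x)) ` UNIV)" for x
      by (rule bdd_belowI[of _ "- (g x * pn \<omega> x)"]) auto
  qed auto
  moreover have "AE x in m. \<bar>v x - \<delta> h x\<bar> \<le> g x * pn (sub \<omega> (d h)) x" if "Wsp m p h" for h
    using diff[OF that] low dense g0
    by eventually_elim (unfold v_def, rule abs_INF_diff_le)
  ultimately show "\<exists>v. v \<in> borel_measurable m \<and>
    (\<forall>h. Wsp m p h \<longrightarrow> (AE x in m. \<bar>v x - \<delta> h x\<bar> \<le> g x * pn (sub \<omega> (d h)) x))" by blast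
qed

lemma tangent_exists:
  assumes q: "1 < q" and p: "p = (if q = \<infinity> then 1 else enn2real q / (enn2real q - 1))"
    and \<delta>: "sobder m p q \<delta>"
  shows "\<exists>v. tangent m q add mul pn v \<and> (\<forall>f. Wsp m p f \<longrightarrow> (AE x in m. v (d f) x = \<delta> f x))"
proof -
  obtain g where g: "Lq_pos m q g" and "\<forall>f G. Wsp m p f \<longrightarrow> min_wug m p f G \<longrightarrow>
        (AE x in m. ennreal \<bar>\<delta> f x\<bar> \<le> ennreal (g x) * G x)"
    using \<delta> unfolding sobder_def by blast
  moreover have g0: "AE x in m. 0 \<le> g x" using g by (simp add: Lq_pos_def)
  ultimately have bound: "AE x in m. \<bar>\<delta> f x\<bar> \<le> g x * pn (d f) x" if "Wsp m p f" for f
    using derivation_bound_iff[OF that g0] that by blast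
  obtain v where v_meas: "\<And>\<omega>. v \<omega> \<in> borel_measurable m"
    and v: "\<And>\<omega> h. Wsp m p h \<Longrightarrow> AE x in m. \<bar>v \<omega> x - \<delta> h x\<bar> \<le> g x * pn (sub \<omega> (d h)) x"
    using mcshane_extension[OF \<delta> g bound] by blast
  have \<delta>0: "AE x in m. \<delta> (\<lambda>_. 0) x = 0" using sobder_cmult[OF \<delta> Wsp_zero, of 0] by simp
  \<comment> \<open>The estimate for h = 0. The case \<omega> = \<open>d f\<close> below gives the
    prescribed values on differentials.\<close>
  have v_bound: "AE x in m. \<bar>v \<omega> x\<bar> \<le> g x * pn \<omega> x" for \<omega>
    using v[OF Wsp_zero, of \<omega>] \<delta>0 unfolding d_zero sub_zero by eventually_elim simp
  have v_int: "integrable m (v \<omega>)" for \<omega>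
  proof (rule Bochner_Integration.integrable_bound[OF integrable_mult_Lq_pos[OF q p g pn_Lp[of \<omega>]] v_meas])
    show "AE x in m. norm (v \<omega> x) \<le> norm (g x * pn \<omega> x)"
      using v_bound[of \<omega>] by eventually_elim auto
  qed
  have v_d: "AE x in m. v (d f) x = \<delta> f x" if "Wsp m p f" for f
    using v[OF that, of "d f"] pn_zero unfolding sub_self by eventually_elim simp
  \<comment> \<open>\<open>F i + H j\<close> approximates the sum as well as \<open>F i\<close> and
    \<open>H j\<close> approximate the summands. The error bounds for
    \<open>v (add \<omega> \<eta>)\<close> and for the two separate values add up to the factor 2 *
    g x.\<close>
  have v_add: "AE x in m. v (add \<omega> \<eta>) x = v \<omega> x + v \<eta> x" for \<omega> \<eta>
  proof -
    obtain F :: "nat \<Rightarrow> 'a \<Rightarrow> real" where F: "\<And>i. Wsp m p (F i)"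
      and F_dense: "AE x in m. \<forall>e>0. \<exists>i. pn (sub \<omega> (d (F i))) x < e" using pointwise_dense by blast
    obtain H :: "nat \<Rightarrow> 'a \<Rightarrow> real" where H: "\<And>i. Wsp m p (H i)"
      and H_dense: "AE x in m. \<forall>e>0. \<exists>i. pn (sub \<eta> (d (H i))) x < e" using pointwise_dense by blast
    have "AE x in m. \<bar>v (add \<omega> \<eta>) x - v \<omega> x - v \<eta> x\<bar> \<le> (2 * g x) * (pn (sub \<omega> (d (F i))) x + pn (sub \<eta> (d (H j))) x)" for i j
    proof -
      have s: "sub (add \<omega> \<eta>) (d (\<lambda>x. F i x + H j x)) = add (sub \<omega> (d (F i))) (sub \<eta> (d (H j)))"
        using d_add[OF Wsp_Dsp[OF F] Wsp_Dsp[OF H]] by (simp add: sub_add_add)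
      show ?thesis
        using v[OF F, of \<omega> i] v[OF H, of \<eta> j] v[OF Wsp_add[OF borel p_pos F H], of "add \<omega> \<eta>" i j]
          sobder_add[OF \<delta> F H, of i j] pn_add[of "sub \<omega> (d (F i))" "sub \<eta> (d (H j))"] g0
        unfolding s
      proof eventually_elim
        case (elim x)
        have "g x * pn (add (sub \<omega> (d (F i))) (sub \<eta> (d (H j)))) x \<le> g x * (pn (sub \<omega> (d (F i))) x + pn (sub \<eta> (d (H j))) x)"
          using elim by (intro mult_left_mono)
        then show ?case using elim(1-4) by (auto simp: algebra_simps abs_le_iff)
      qed
    qed
    then have "AE x in m. \<forall>i j. \<bar>v (add \<omega> \<eta>) x - v \<omega> x - v \<eta> x\<bar> \<le> (2 * g x) * (pn (sub \<omega> (d (F i))) x + pn (sub \<eta> (d (H j))) x)"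
      unfolding AE_all_countable by blast
    then show ?thesis using F_dense H_dense g0
    proof eventually_elim
      case (elim x)
      then have "v (add \<omega> \<eta>) x - v \<omega> x - v \<eta> x = 0"
        by (intro zero_of_small_bounds[where K="2 * g x"]) auto
      then show ?case by simp
    qed
  qed
  \<comment> \<open>\<delta> is homogeneous only over the reals, so \<open>mul h \<omega>\<close> is
    compared with the differential of \<open>c * F i\<close> for a constant c, at the cost of the
    error |h x - c| * pn \<omega> x.\<close>
  have v_mul: "AE x in m. v (mul h \<omega>) x = h x * v \<omega> x" if h: "Linf m h" for h \<omega>
  proof -
    obtain F :: "nat \<Rightarrow> 'a \<Rightarrow> real" where F: "\<And>i. Wsp m p (F i)"
      and F_dense: "AE x in m. \<forall>e>0. \<exists>i. pn (sub \<omega> (d (F i))) x < e" using pointwise_dense by blast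
    have "AE x in m. \<bar>v (mul h \<omega>) x - c * v \<omega> x\<bar> \<le> g x * (\<bar>h x - c\<bar> * pn \<omega> x + 2 * \<bar>c\<bar> * pn (sub \<omega> (d (F i))) x)" for c i
    proof -
      have s1: "sub (mul h \<omega>) (mul (\<lambda>_. c) \<omega>) = mul (\<lambda>x. h x + (- c)) \<omega>"
        using mul_add_left[OF h Linf_const[of m "- c"], of \<omega>] mul_mul[of "\<lambda>_. -1" "\<lambda>_. c" \<omega>] by (simp add: msub_def)
      have s2: "sub (mul (\<lambda>_. c) \<omega>) (d (\<lambda>x. c * F i x)) = mul (\<lambda>_. c) (sub \<omega> (d (F i)))"
        by (simp add: mul_sub d_cmult[OF Wsp_Dsp[OF F]])
      show ?thesis
        using v[OF F, of \<omega> i] v[OF Wsp_cmult[OF borel p_pos F, of c i], of "mul h \<omega>"] sobder_cmult[OF \<delta> F, of c i]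
          pn_sub_triangle[of "mul h \<omega>" "d (\<lambda>x. c * F i x)" "mul (\<lambda>_. c) \<omega>", unfolded s1 s2]
          pn_mul[OF Linf_add_const[OF h, of "- c"], of \<omega>] pn_mul[OF Linf_const[of m c], of "sub \<omega> (d (F i))"] g0
      proof eventually_elim
        case (elim x)
        have "g x * pn (sub (mul h \<omega>) (d (\<lambda>x. c * F i x))) x \<le> g x * (\<bar>h x - c\<bar> * pn \<omega> x + \<bar>c\<bar> * pn (sub \<omega> (d (F i))) x)"
          using elim by (intro mult_left_mono) auto
        then have 1: "\<bar>v (mul h \<omega>) x - c * \<delta> (F i) x\<bar> \<le> g x * (\<bar>h x - c\<bar> * pn \<omega> x + \<bar>c\<bar> * pn (sub \<omega> (d (F i))) x)"
          using elim by linarith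
        have "\<bar>c * \<delta> (F i) x - c * v \<omega> x\<bar> = \<bar>c\<bar> * \<bar>v \<omega> x - \<delta> (F i) x\<bar>"
          by (metis abs_minus_commute abs_mult right_diff_distrib)
        also have "\<dots> \<le> \<bar>c\<bar> * (g x * pn (sub \<omega> (d (F i))) x)" using elim(1) by (intro mult_left_mono) auto
        finally show ?case using 1 by (simp add: algebra_simps)
      qed
    qed
    \<comment> \<open>Rational constants keep the exceptional sets countable, so that c may be
      chosen depending on x afterwards.\<close>
    then have "AE x in m. \<forall>c\<in>\<rat>. \<forall>i. \<bar>v (mul h \<omega>) x - c * v \<omega> x\<bar> \<le> g x * (\<bar>h x - c\<bar> * pn \<omega> x + 2 * \<bar>c\<bar> * pn (sub \<omega> (d (F i))) x)"
      unfolding AE_ball_countable[OF countable_rat] AE_all_countable by blast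
    then show ?thesis using F_dense g0 pn_nonneg[of \<omega>]
    proof eventually_elim
      case (elim x)
      \<comment> \<open>Order of limits: for fixed c the approximation of \<omega> is improved
        first, and only then does c tend to h x.\<close>
      have c: "\<bar>v (mul h \<omega>) x - c * v \<omega> x\<bar> \<le> g x * (\<bar>h x - c\<bar> * pn \<omega> x)" if "c \<in> \<rat>" for c
      proof (rule le_of_small_perturbations)
        show "0 \<le> g x * (2 * \<bar>c\<bar>)" using elim by simp
        show "\<forall>i. \<bar>v (mul h \<omega>) x - c * v \<omega> x\<bar> \<le> g x * (\<bar>h x - c\<bar> * pn \<omega> x) + g x * (2 * \<bar>c\<bar>) * pn (sub \<omega> (d (F i))) x"
          using elim(1) that by (simp add: algebra_simps)
      qed (fact elim(2))
      obtain c where cQ: "\<And>n. c n \<in> \<rat>" and c_lim: "c \<longlonglongrightarrow> h x"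
      proof -
        have "\<exists>c\<in>\<rat>. h x < c \<and> c < h x + 1 / real (Suc n)" for n by (rule Rats_dense_in_real) simp
        then obtain c where c: "\<And>n. c n \<in> \<rat>" "\<And>n. h x < c n" "\<And>n. c n < h x + 1 / real (Suc n)" by metis
        have "(\<lambda>n. h x + 1 / real (Suc n)) \<longlonglongrightarrow> h x + 0"
          by (intro tendsto_intros LIMSEQ_Suc[OF lim_1_over_n])
        then have "c \<longlonglongrightarrow> h x"
          using c by (intro tendsto_sandwich[of "\<lambda>_. h x" c sequentially "\<lambda>n. h x + 1 / real (Suc n)"]) (auto intro!: always_eventually less_imp_le)
        then show thesis using c(1) that by blast
      qed
      have "(\<lambda>n. \<bar>v (mul h \<omega>) x - c n * v \<omega> x\<bar>) \<longlonglongrightarrow> \<bar>v (mul h \<omega>) x - h x * v \<omega> x\<bar>"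
        by (intro tendsto_intros c_lim)
      moreover have "(\<lambda>n. g x * (\<bar>h x - c n\<bar> * pn \<omega> x)) \<longlonglongrightarrow> g x * (\<bar>h x - h x\<bar> * pn \<omega> x)"
        by (intro tendsto_intros c_lim)
      ultimately have "\<bar>v (mul h \<omega>) x - h x * v \<omega> x\<bar> \<le> g x * (\<bar>h x - h x\<bar> * pn \<omega> x)"
        by (rule LIMSEQ_le) (use c[OF cQ] in blast)
      then show ?case by simp
    qed
  qed
  have "tangent m q add mul pn v"
    unfolding tangent_def using v_int v_add v_mul v_bound g by blast
  then show ?thesis using v_d by blast
qed

text \<open>Additivity gives u \<omega> = u (\<omega> - dF i), which the bound makes small. Asking
  for additivity and a bound, not for \<open>tangent\<close>, allows u to be a difference such as
  I(\<delta> + \<delta>') - I \<delta> - I \<delta>' without first showing that combinations of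
  tangent vectors are tangent vectors.\<close>

lemma vanishes_if_vanishes_on_differentials:
  assumes u_add: "\<And>\<omega> \<eta>. AE x in m. u (add \<omega> \<eta>) x = u \<omega> x + u \<eta> x"
    and bound: "\<And>\<omega>. AE x in m. \<bar>u \<omega> x\<bar> \<le> g x * pn \<omega> x"
    and g0: "AE x in m. 0 \<le> g x"
    and d0: "\<And>f. Wsp m p f \<Longrightarrow> AE x in m. u (d f) x = 0"
  shows "AE x in m. u \<omega> x = (0::real)"
proof -
  obtain F :: "nat \<Rightarrow> 'a \<Rightarrow> real" where F: "\<And>i. Wsp m p (F i)"
    and F_dense: "AE x in m. \<forall>e>0. \<exists>i. pn (sub \<omega> (d (F i))) x < e" using pointwise_dense by blast
  have "AE x in m. \<bar>u \<omega> x\<bar> \<le> g x * pn (sub \<omega> (d (F i))) x" for i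
  proof -
    have "add (d (F i)) (sub \<omega> (d (F i))) = sub \<omega> zero"
      using sub_telescope[of \<omega> zero "d (F i)"] by (simp add: sub_zero add_commute)
    then have "\<omega> = add (d (F i)) (sub \<omega> (d (F i)))" by (simp add: sub_zero)
    then have "AE x in m. u \<omega> x = u (d (F i)) x + u (sub \<omega> (d (F i))) x" using u_add by metis
    then show ?thesis using bound[of "sub \<omega> (d (F i))"] d0[OF F, of i] by eventually_elim simp
  qed
  then have "AE x in m. \<forall>i. \<bar>u \<omega> x\<bar> \<le> g x * pn (sub \<omega> (d (F i))) x" by (simp add: AE_all_countable)
  moreover have "AE x in m. \<forall>i. 0 \<le> pn (sub \<omega> (d (F i))) x"
    unfolding AE_all_countable by (intro allI pn_nonneg)
  ultimately show ?thesis using F_dense g0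
  proof eventually_elim
    case (elim x)
    \<comment> \<open>A second copy of the same family is added to fit the two-sequence form of
      \<open>zero_of_small_bounds\<close>.\<close>
    have "\<bar>u \<omega> x\<bar> \<le> g x * (pn (sub \<omega> (d (F i))) x + pn (sub \<omega> (d (F j))) x)" for i j
    proof -
      have "g x * pn (sub \<omega> (d (F i))) x \<le> g x * (pn (sub \<omega> (d (F i))) x + pn (sub \<omega> (d (F j))) x)"
        using elim by (intro mult_left_mono) auto
      then show ?thesis using elim(1) by (meson order_trans)
    qed
    then show ?case using elim by (intro zero_of_small_bounds[where K="g x"]) auto
  qed
qed

lemma tangentE:
  assumes "tangent m q add mul pn v"
  obtains g where "Lq_pos m q g" "AE x in m. 0 \<le> g x" "\<And>\<omega>. AE x in m. \<bar>v \<omega> x\<bar> \<le> g x * pn \<omega> x"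
    "\<And>\<omega> \<eta>. AE x in m. v (add \<omega> \<eta>) x = v \<omega> x + v \<eta> x"
    "\<And>h \<omega>. Linf m h \<Longrightarrow> AE x in m. v (mul h \<omega>) x = h x * v \<omega> x"
  using assms unfolding tangent_def by (auto simp: Lq_pos_def)

lemma tangent_unique:
  assumes v: "tangent m q add mul pn v" and w: "tangent m q add mul pn w"
    and eq: "\<And>f. Wsp m p f \<Longrightarrow> AE x in m. v (d f) x = w (d f) x"
  shows "tan_eq m v w"
  unfolding tan_eq_def
proof
  fix \<omega>
  obtain g where g: "AE x in m. 0 \<le> g x" "\<And>\<omega>. AE x in m. \<bar>v \<omega> x\<bar> \<le> g x * pn \<omega> x"
    "\<And>\<omega> \<eta>. AE x in m. v (add \<omega> \<eta>) x = v \<omega> x + v \<eta> x" by (rule tangentE[OF v], rule that)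
  obtain k where k: "AE x in m. 0 \<le> k x" "\<And>\<omega>. AE x in m. \<bar>w \<omega> x\<bar> \<le> k x * pn \<omega> x"
    "\<And>\<omega> \<eta>. AE x in m. w (add \<omega> \<eta>) x = w \<omega> x + w \<eta> x" by (rule tangentE[OF w], rule that)
  have "AE x in m. v \<omega> x - w \<omega> x = 0"
  proof (rule vanishes_if_vanishes_on_differentials[where g="\<lambda>x. g x + k x"])
    show "AE x in m. v (add \<omega> \<eta>) x - w (add \<omega> \<eta>) x = v \<omega> x - w \<omega> x + (v \<eta> x - w \<eta> x)" for \<omega> \<eta>
      using g(3)[of \<omega> \<eta>] k(3)[of \<omega> \<eta>] by eventually_elim simp
    show "AE x in m. \<bar>v \<omega> x - w \<omega> x\<bar> \<le> (g x + k x) * pn \<omega> x" for \<omega>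
      using g(2)[of \<omega>] k(2)[of \<omega>] by eventually_elim (simp add: distrib_right)
    show "AE x in m. 0 \<le> g x + k x" using g(1) k(1) by eventually_elim simp
    show "AE x in m. v (d f) x - w (d f) x = 0" if "Wsp m p f" for f
      using eq[OF that] by eventually_elim simp
  qed
  then show "AE x in m. v \<omega> x = w \<omega> x" by eventually_elim simp
qed

text \<open>The core of the isometry. With any bound g of v, k |dF i| + g |\<omega> - dF i|
  dominates |v \<omega>| and is at most k |\<omega>| + (k + g) |\<omega> - dF i|. Density removes
  the last term, so g disappears and k alone survives.\<close>

lemma tangent_bound_iff:
  assumes v: "tangent m q add mul pn v" and eq: "\<And>f. Wsp m p f \<Longrightarrow> AE x in m. v (d f) x = \<delta> f x"
    and k0: "AE x in m. 0 \<le> k x"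
  shows "(\<forall>\<omega>. AE x in m. \<bar>v \<omega> x\<bar> \<le> k x * pn \<omega> x)
    \<longleftrightarrow> (\<forall>f G. Wsp m p f \<longrightarrow> min_wug m p f G \<longrightarrow> (AE x in m. ennreal \<bar>\<delta> f x\<bar> \<le> ennreal (k x) * G x))"
    (is "?L \<longleftrightarrow> ?R")
proof -
  have R: "?R \<longleftrightarrow> (\<forall>f. Wsp m p f \<longrightarrow> (AE x in m. \<bar>\<delta> f x\<bar> \<le> k x * pn (d f) x))"
    using derivation_bound_iff[OF _ k0] by blast
  have "AE x in m. \<bar>\<delta> f x\<bar> \<le> k x * pn (d f) x" if L: ?L and f: "Wsp m p f" for f
    using L[rule_format, of "d f"] eq[OF f] by eventually_elim simp
  moreover have "AE x in m. \<bar>v \<omega> x\<bar> \<le> k x * pn \<omega> x"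
    if \<delta>: "\<And>f. Wsp m p f \<Longrightarrow> AE x in m. \<bar>\<delta> f x\<bar> \<le> k x * pn (d f) x" for \<omega>
  proof -
    obtain g where g: "AE x in m. 0 \<le> g x" "\<And>\<omega>. AE x in m. \<bar>v \<omega> x\<bar> \<le> g x * pn \<omega> x"
      "\<And>\<omega> \<eta>. AE x in m. v (add \<omega> \<eta>) x = v \<omega> x + v \<eta> x" by (rule tangentE[OF v], rule that)
    obtain F :: "nat \<Rightarrow> 'a \<Rightarrow> real" where F: "\<And>i. Wsp m p (F i)"
      and F_dense: "AE x in m. \<forall>e>0. \<exists>i. pn (sub \<omega> (d (F i))) x < e" using pointwise_dense by blast
    have "AE x in m. \<bar>v \<omega> x\<bar> \<le> k x * pn \<omega> x + (k x + g x) * pn (sub \<omega> (d (F i))) x" for i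
    proof -
      have \<omega>: "add (d (F i)) (sub \<omega> (d (F i))) = \<omega>"
        using sub_telescope[of \<omega> zero "d (F i)"] by (simp add: sub_zero add_commute)
      have dF: "AE x in m. pn (d (F i)) x \<le> pn (sub \<omega> (d (F i))) x + pn \<omega> x"
        using pn_sub_triangle[of "d (F i)" zero \<omega>] pn_sub_commute[of "d (F i)" \<omega>]
        unfolding sub_zero by eventually_elim simp
      show ?thesis
        using g(3)[of "d (F i)" "sub \<omega> (d (F i))"] g(2)[of "sub \<omega> (d (F i))"] eq[OF F, of i] \<delta>[OF F, of i] dF k0
        unfolding \<omega>
      proof eventually_elim
        case (elim x)
        have "k x * pn (d (F i)) x \<le> k x * (pn (sub \<omega> (d (F i))) x + pn \<omega> x)"
          using elim by (intro mult_left_mono)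
        then show ?case using elim(1-4) by (simp add: algebra_simps)
      qed
    qed
    then have "AE x in m. \<forall>i. \<bar>v \<omega> x\<bar> \<le> k x * pn \<omega> x + (k x + g x) * pn (sub \<omega> (d (F i))) x"
      by (simp add: AE_all_countable)
    then show ?thesis using F_dense k0 g(1)
    proof eventually_elim
      case (elim x)
      show ?case
        by (rule le_of_small_perturbations[OF _ elim(2,1)]) (use elim(3,4) in simp)
    qed
  qed
  ultimately show ?thesis unfolding R by blast
qed

section \<open>Module operations on derivations, and the isomorphism\<close>

lemma sobder_plus:
  assumes q: "1 < q" and \<delta>: "sobder m p q \<delta>" and \<delta>': "sobder m p q \<delta>'"
  shows "sobder m p q (\<lambda>f x. \<delta> f x + \<delta>' f x)"
proof -
  obtain g where g: "Lq_pos m q g" "\<And>f G. Wsp m p f \<Longrightarrow> min_wug m p f G \<Longrightarrow>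
        AE x in m. ennreal \<bar>\<delta> f x\<bar> \<le> ennreal (g x) * G x" using \<delta> unfolding sobder_def by blast
  obtain k where k: "Lq_pos m q k" "\<And>f G. Wsp m p f \<Longrightarrow> min_wug m p f G \<Longrightarrow>
        AE x in m. ennreal \<bar>\<delta>' f x\<bar> \<le> ennreal (k x) * G x" using \<delta>' unfolding sobder_def by blast
  have nn: "AE x in m. 0 \<le> g x" "AE x in m. 0 \<le> k x" using g k by (auto simp: Lq_pos_def)
  have "AE x in m. ennreal \<bar>\<delta> f x + \<delta>' f x\<bar> \<le> ennreal (g x + k x) * G x"
    if "Wsp m p f" "min_wug m p f G" for f G
    using g(2)[OF that] k(2)[OF that] nn
  proof eventually_elim
    case (elim x)
    have "ennreal \<bar>\<delta> f x + \<delta>' f x\<bar> \<le> ennreal \<bar>\<delta> f x\<bar> + ennreal \<bar>\<delta>' f x\<bar>"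
      by (simp add: ennreal_leI flip: ennreal_plus)
    also have "\<dots> \<le> ennreal (g x) * G x + ennreal (k x) * G x" using elim by (intro add_mono)
    also have "\<dots> = ennreal (g x + k x) * G x" using elim by (simp add: distrib_right)
    finally show ?case .
  qed
  moreover have "AE x in m. \<delta> (\<lambda>y. f y + h y) x + \<delta>' (\<lambda>y. f y + h y) x = (\<delta> f x + \<delta>' f x) + (\<delta> h x + \<delta>' h x)"
    if "Wsp m p f" "Wsp m p h" for f h
    using sobder_add[OF \<delta> that] sobder_add[OF \<delta>' that] by eventually_elim simp
  moreover have "AE x in m. \<delta> (\<lambda>y. c * f y) x + \<delta>' (\<lambda>y. c * f y) x = c * (\<delta> f x + \<delta>' f x)"
    if "Wsp m p f" for f c
    using sobder_cmult[OF \<delta> that, of c] sobder_cmult[OF \<delta>' that, of c] by eventually_elim (simp add: distrib_left)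
  moreover have "AE x in m. \<delta> f x + \<delta>' f x = \<delta> h x + \<delta>' h x"
    if fh: "Wsp m p f" "Wsp m p h" "AE x in m. f x = h x" for f h
  proof -
    have "AE x in m. \<delta> f x = \<delta> h x" "AE x in m. \<delta>' f x = \<delta>' h x"
      using \<delta> \<delta>' fh unfolding sobder_def by blast+
    then show ?thesis by eventually_elim simp
  qed
  moreover have "integrable m (\<lambda>x. \<delta> f x + \<delta>' f x)" if "Wsp m p f" for f
    using sobder_integrable[OF \<delta> that] sobder_integrable[OF \<delta>' that] by simp
  ultimately show ?thesis
    unfolding sobder_def using Lq_pos_add[OF g(1) k(1) q] by blast
qed

lemma sobder_Linf_mult:
  assumes h: "Linf m h" and \<delta>: "sobder m p q \<delta>"
  shows "sobder m p q (\<lambda>f x. h x * \<delta> f x)"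
proof -
  obtain g where g: "Lq_pos m q g" "\<And>f G. Wsp m p f \<Longrightarrow> min_wug m p f G \<Longrightarrow>
        AE x in m. ennreal \<bar>\<delta> f x\<bar> \<le> ennreal (g x) * G x" using \<delta> unfolding sobder_def by blast
  obtain C0 where h_meas[measurable]: "h \<in> borel_measurable m" and C0: "AE x in m. \<bar>h x\<bar> \<le> C0" using h by (auto simp: Linf_def)
  \<comment> \<open>The essential bound C0 can be negative when m is the zero measure.\<close>
  define C where "C = max 0 C0"
  have C: "0 \<le> C" "AE x in m. \<bar>h x\<bar> \<le> C" using C0 by (auto simp: C_def elim!: eventually_mono)
  have nn: "AE x in m. 0 \<le> g x" using g by (auto simp: Lq_pos_def)
  have "AE x in m. ennreal \<bar>h x * \<delta> f x\<bar> \<le> ennreal (C * g x) * G x"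
    if "Wsp m p f" "min_wug m p f G" for f G
    using g(2)[OF that] C(2) nn
  proof eventually_elim
    case (elim x)
    have "ennreal \<bar>h x * \<delta> f x\<bar> \<le> ennreal C * ennreal \<bar>\<delta> f x\<bar>"
      using elim C by (simp add: abs_mult ennreal_leI mult_right_mono flip: ennreal_mult)
    also have "\<dots> \<le> ennreal C * (ennreal (g x) * G x)" using elim by (intro mult_left_mono) auto
    also have "\<dots> = ennreal (C * g x) * G x" using elim C by (simp add: ennreal_mult mult.assoc)
    finally show ?case .
  qed
  moreover have "AE x in m. h x * \<delta> (\<lambda>y. f y + k y) x = h x * \<delta> f x + h x * \<delta> k x"
    if "Wsp m p f" "Wsp m p k" for f k
    using sobder_add[OF \<delta> that] by eventually_elim (simp add: distrib_left)
  moreover have "AE x in m. h x * \<delta> (\<lambda>y. c * f y) x = c * (h x * \<delta> f x)" if "Wsp m p f" for f c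
    using sobder_cmult[OF \<delta> that, of c] by eventually_elim simp
  moreover have "AE x in m. h x * \<delta> f x = h x * \<delta> k x"
    if fk: "Wsp m p f" "Wsp m p k" "AE x in m. f x = k x" for f k
  proof -
    have "AE x in m. \<delta> f x = \<delta> k x" using \<delta> fk unfolding sobder_def by blast
    then show ?thesis by eventually_elim simp
  qed
  moreover have "integrable m (\<lambda>x. h x * \<delta> f x)" if "Wsp m p f" for f
  proof (rule Bochner_Integration.integrable_bound)
    have int: "integrable m (\<delta> f)" by (rule sobder_integrable[OF \<delta> that])
    then show "integrable m (\<lambda>x. C * \<delta> f x)" by simp
    show "(\<lambda>x. h x * \<delta> f x) \<in> borel_measurable m" using int by measurable
    show "AE x in m. norm (h x * \<delta> f x) \<le> norm (C * \<delta> f x)"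
      using C(2) by eventually_elim (simp add: C(1) abs_mult mult_right_mono)
  qed
  ultimately show ?thesis
    unfolding sobder_def using Lq_pos_cmult[OF g(1) C(1)] by blast
qed

text \<open>Composition with \<open>d\<close> is the inverse of I; this supplies
  surjectivity.\<close>

lemma sobder_of_tangent:
  assumes v: "tangent m q add mul pn v"
  shows "sobder m p q (\<lambda>f. v (d f))"
proof -
  obtain g where g: "Lq_pos m q g" "AE x in m. 0 \<le> g x" "\<And>\<omega>. AE x in m. \<bar>v \<omega> x\<bar> \<le> g x * pn \<omega> x"
    and v_add: "\<And>\<omega> \<eta>. AE x in m. v (add \<omega> \<eta>) x = v \<omega> x + v \<eta> x"
    and v_mul: "\<And>h \<omega>. Linf m h \<Longrightarrow> AE x in m. v (mul h \<omega>) x = h x * v \<omega> x"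
    by (rule tangentE[OF v], rule that)
  have "\<forall>f G. Wsp m p f \<longrightarrow> min_wug m p f G \<longrightarrow> (AE x in m. ennreal \<bar>v (d f) x\<bar> \<le> ennreal (g x) * G x)"
    by (rule tangent_bound_iff[OF v _ g(2), THEN iffD1]) (simp_all add: g(3))
  moreover have "AE x in m. v (d (\<lambda>y. f y + h y)) x = v (d f) x + v (d h) x" if "Wsp m p f" "Wsp m p h" for f h
    using v_add d_add[OF Wsp_Dsp Wsp_Dsp, OF that] by simp
  moreover have "AE x in m. v (d (\<lambda>y. c * f y)) x = c * v (d f) x" if "Wsp m p f" for f c
    using v_mul[OF Linf_const] d_cmult[OF Wsp_Dsp, OF that] by simp
  moreover have "AE x in m. v (d f) x = v (d h) x" if "Wsp m p f" "Wsp m p h" "AE x in m. f x = h x" for f h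
    using d_cong_AE[OF Wsp_Dsp Wsp_Dsp, OF that] by simp
  moreover have "integrable m (v \<omega>)" for \<omega> using v by (auto simp: tangent_def)
  ultimately show ?thesis unfolding sobder_def using g(1) by blast
qed

text \<open>I is an arbitrary selection of representatives. Each algebraic identity holds because
  both sides take the same values on differentials of \<open>Wsp\<close>, where the values of I
  \<delta> are prescribed.\<close>

lemma der_to_tan_isoI:
  assumes q: "1 < q"
    and I: "\<And>\<delta>. sobder m p q \<delta> \<Longrightarrow> tangent m q add mul pn (I \<delta>)"
    and Id: "\<And>\<delta> f. sobder m p q \<delta> \<Longrightarrow> Wsp m p f \<Longrightarrow> AE x in m. I \<delta> (d f) x = \<delta> f x"
  shows "der_to_tan_iso m p q add mul pn I"
  unfolding der_to_tan_iso_def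
proof (intro conjI allI impI I)
  fix \<delta> \<delta>' assume \<delta>: "sobder m p q \<delta>" and \<delta>': "sobder m p q \<delta>'"
  show "tan_eq m (I \<delta>) (I \<delta>')" if "der_eq m p \<delta> \<delta>'"
  proof (rule tangent_unique[OF I I, OF \<delta> \<delta>'])
    fix f assume f: "Wsp m p f"
    then have "AE x in m. \<delta> f x = \<delta>' f x" using that by (simp add: der_eq_def)
    then show "AE x in m. I \<delta> (d f) x = I \<delta>' (d f) x"
      using Id[OF \<delta> f] Id[OF \<delta>' f] by eventually_elim simp
  qed
  show "der_eq m p \<delta> \<delta>'" if "tan_eq m (I \<delta>) (I \<delta>')"
    unfolding der_eq_def
  proof (intro allI impI)
    fix f assume f: "Wsp m p f"
    have "AE x in m. I \<delta> (d f) x = I \<delta>' (d f) x" using that by (simp add: tan_eq_def)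
    then show "AE x in m. \<delta> f x = \<delta>' f x"
      using Id[OF \<delta> f] Id[OF \<delta>' f] by eventually_elim simp
  qed
  have \<delta>s: "sobder m p q (\<lambda>f x. \<delta> f x + \<delta>' f x)" by (rule sobder_plus[OF q \<delta> \<delta>'])
  obtain g where g: "AE x in m. 0 \<le> g x" "\<And>\<omega>. AE x in m. \<bar>I \<delta> \<omega> x\<bar> \<le> g x * pn \<omega> x"
    "\<And>\<omega> \<eta>. AE x in m. I \<delta> (add \<omega> \<eta>) x = I \<delta> \<omega> x + I \<delta> \<eta> x" by (rule tangentE[OF I[OF \<delta>]], rule that)
  obtain g' where g': "AE x in m. 0 \<le> g' x" "\<And>\<omega>. AE x in m. \<bar>I \<delta>' \<omega> x\<bar> \<le> g' x * pn \<omega> x"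
    "\<And>\<omega> \<eta>. AE x in m. I \<delta>' (add \<omega> \<eta>) x = I \<delta>' \<omega> x + I \<delta>' \<eta> x" by (rule tangentE[OF I[OF \<delta>']], rule that)
  define w where "w = I (\<lambda>f x. \<delta> f x + \<delta>' f x)"
  have w: "tangent m q add mul pn w" unfolding w_def by (rule I[OF \<delta>s])
  have w_d: "AE x in m. w (d f) x = \<delta> f x + \<delta>' f x" if "Wsp m p f" for f
    unfolding w_def by (rule Id[OF \<delta>s that])
  obtain k where k: "AE x in m. 0 \<le> k x" "\<And>\<omega>. AE x in m. \<bar>w \<omega> x\<bar> \<le> k x * pn \<omega> x"
    "\<And>\<omega> \<eta>. AE x in m. w (add \<omega> \<eta>) x = w \<omega> x + w \<eta> x" by (rule tangentE[OF w], rule that)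
  have "AE x in m. w \<omega> x - (I \<delta> \<omega> x + I \<delta>' \<omega> x) = 0" for \<omega>
  proof (rule vanishes_if_vanishes_on_differentials[where g="\<lambda>x. k x + g x + g' x"])
    show "AE x in m. w (add \<omega> \<eta>) x - (I \<delta> (add \<omega> \<eta>) x + I \<delta>' (add \<omega> \<eta>) x)
        = w \<omega> x - (I \<delta> \<omega> x + I \<delta>' \<omega> x) + (w \<eta> x - (I \<delta> \<eta> x + I \<delta>' \<eta> x))" for \<omega> \<eta>
      using k(3)[of \<omega> \<eta>] g(3)[of \<omega> \<eta>] g'(3)[of \<omega> \<eta>] by eventually_elim simp
    show "AE x in m. \<bar>w \<omega> x - (I \<delta> \<omega> x + I \<delta>' \<omega> x)\<bar> \<le> (k x + g x + g' x) * pn \<omega> x" for \<omega>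
      using k(2)[of \<omega>] g(2)[of \<omega>] g'(2)[of \<omega>] by eventually_elim (simp add: distrib_right)
    show "AE x in m. 0 \<le> k x + g x + g' x" using k(1) g(1) g'(1) by eventually_elim simp
    show "AE x in m. w (d f) x - (I \<delta> (d f) x + I \<delta>' (d f) x) = 0" if "Wsp m p f" for f
      using w_d[OF that] Id[OF \<delta> that] Id[OF \<delta>' that] by eventually_elim simp
  qed
  then show "tan_eq m (I (\<lambda>f x. \<delta> f x + \<delta>' f x)) (\<lambda>\<omega> x. I \<delta> \<omega> x + I \<delta>' \<omega> x)"
    unfolding tan_eq_def w_def[symmetric] by (auto elim!: eventually_mono)
next
  fix \<delta> h assume \<delta>: "sobder m p q \<delta>" and h: "Linf m h"
  have \<delta>h: "sobder m p q (\<lambda>f x. h x * \<delta> f x)" by (rule sobder_Linf_mult[OF h \<delta>])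
  obtain g where g: "AE x in m. 0 \<le> g x" "\<And>\<omega>. AE x in m. \<bar>I \<delta> \<omega> x\<bar> \<le> g x * pn \<omega> x"
    "\<And>\<omega> \<eta>. AE x in m. I \<delta> (add \<omega> \<eta>) x = I \<delta> \<omega> x + I \<delta> \<eta> x" by (rule tangentE[OF I[OF \<delta>]], rule that)
  define w where "w = I (\<lambda>f x. h x * \<delta> f x)"
  have w: "tangent m q add mul pn w" unfolding w_def by (rule I[OF \<delta>h])
  have w_d: "AE x in m. w (d f) x = h x * \<delta> f x" if "Wsp m p f" for f
    unfolding w_def by (rule Id[OF \<delta>h that])
  obtain k where k: "AE x in m. 0 \<le> k x" "\<And>\<omega>. AE x in m. \<bar>w \<omega> x\<bar> \<le> k x * pn \<omega> x"
    "\<And>\<omega> \<eta>. AE x in m. w (add \<omega> \<eta>) x = w \<omega> x + w \<eta> x" by (rule tangentE[OF w], rule that)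
  have "AE x in m. w \<omega> x - h x * I \<delta> \<omega> x = 0" for \<omega>
  proof (rule vanishes_if_vanishes_on_differentials[where g="\<lambda>x. k x + \<bar>h x\<bar> * g x"])
    show "AE x in m. w (add \<omega> \<eta>) x - h x * I \<delta> (add \<omega> \<eta>) x
        = w \<omega> x - h x * I \<delta> \<omega> x + (w \<eta> x - h x * I \<delta> \<eta> x)" for \<omega> \<eta>
      using k(3)[of \<omega> \<eta>] g(3)[of \<omega> \<eta>] by eventually_elim (simp add: distrib_left)
    show "AE x in m. \<bar>w \<omega> x - h x * I \<delta> \<omega> x\<bar> \<le> (k x + \<bar>h x\<bar> * g x) * pn \<omega> x" for \<omega>
      using k(2)[of \<omega>] g(2)[of \<omega>]
    proof eventually_elim
      case (elim x)
      have "\<bar>h x * I \<delta> \<omega> x\<bar> \<le> \<bar>h x\<bar> * (g x * pn \<omega> x)"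
        unfolding abs_mult using elim by (intro mult_left_mono) auto
      then show ?case using elim(1) by (simp add: algebra_simps)
    qed
    show "AE x in m. 0 \<le> k x + \<bar>h x\<bar> * g x" using k(1) g(1) by eventually_elim simp
    show "AE x in m. w (d f) x - h x * I \<delta> (d f) x = 0" if "Wsp m p f" for f
      using w_d[OF that] Id[OF \<delta> that] by eventually_elim simp
  qed
  then show "tan_eq m (I (\<lambda>f x. h x * \<delta> f x)) (\<lambda>\<omega> x. h x * I \<delta> \<omega> x)"
    unfolding tan_eq_def w_def[symmetric] by (auto elim!: eventually_mono)
next
  fix v assume v: "tangent m q add mul pn v"
  have \<delta>: "sobder m p q (\<lambda>f. v (d f))" by (rule sobder_of_tangent[OF v])
  show "\<exists>\<delta>. sobder m p q \<delta> \<and> tan_eq m (I \<delta>) v"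
    by (intro exI[of _ "\<lambda>f. v (d f)"] conjI \<delta> tangent_unique[OF I[OF \<delta>] v] Id[OF \<delta>])
next
  fix \<delta> g assume \<delta>: "sobder m p q \<delta>"
  \<comment> \<open>I \<delta> and \<delta> admit the same bounds k, so a least bound for one is a
    least bound for the other.\<close>
  have bounds: "Lq_pos m q k \<and> (\<forall>\<omega>. AE x in m. \<bar>I \<delta> \<omega> x\<bar> \<le> k x * pn \<omega> x)
      \<longleftrightarrow> Lq_pos m q k \<and> (\<forall>f G. Wsp m p f \<longrightarrow> min_wug m p f G \<longrightarrow>
        (AE x in m. ennreal \<bar>\<delta> f x\<bar> \<le> ennreal (k x) * G x))" for k
  proof (rule conj_cong[OF refl])
    assume "Lq_pos m q k"
    then have "AE x in m. 0 \<le> k x" by (simp add: Lq_pos_def)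
    from tangent_bound_iff[OF I[OF \<delta>] Id[OF \<delta>] this]
    show "(\<forall>\<omega>. AE x in m. \<bar>I \<delta> \<omega> x\<bar> \<le> k x * pn \<omega> x)
      \<longleftrightarrow> (\<forall>f G. Wsp m p f \<longrightarrow> min_wug m p f G \<longrightarrow> (AE x in m. ennreal \<bar>\<delta> f x\<bar> \<le> ennreal (k x) * G x))" .
  qed
  show "der_pnorm m p q \<delta> g \<longleftrightarrow> tan_pnorm m q pn (I \<delta>) g"
    unfolding der_pnorm_def tan_pnorm_def bounds using bounds[of g] by blast
qed

end

theorem theorem4p25:
  fixes m :: "'a::polish_space measure"
    and q :: ennreal and p :: real
    and add :: "'v \<Rightarrow> 'v \<Rightarrow> 'v" and zero :: 'v
    and mul :: "('a \<Rightarrow> real) \<Rightarrow> 'v \<Rightarrow> 'v"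
    and pn :: "'v \<Rightarrow> 'a \<Rightarrow> real"
    and d :: "('a \<Rightarrow> real) \<Rightarrow> 'v"
  assumes borel: "sets m = sets borel"
    and bdd_fin: "\<And>B. B \<in> sets borel \<Longrightarrow> bounded B \<Longrightarrow> emeasure m B < \<infinity>"
    and q: "1 < q"
    and p: "p = (if q = \<infinity> then 1 else enn2real q / (enn2real q - 1))"
    and cot: "cotangent_module m p add zero mul pn d"
  shows "(\<forall>\<delta>. sobder m p q \<delta> \<longrightarrow>
            (\<exists>v. tangent m q add mul pn v \<and> (\<forall>f. Wsp m p f \<longrightarrow> (AE x in m. v (d f) x = \<delta> f x))) \<and>
            (\<forall>v v'. tangent m q add mul pn v \<and> (\<forall>f. Wsp m p f \<longrightarrow> (AE x in m. v (d f) x = \<delta> f x)) \<and>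
                    tangent m q add mul pn v' \<and> (\<forall>f. Wsp m p f \<longrightarrow> (AE x in m. v' (d f) x = \<delta> f x))
                    \<longrightarrow> tan_eq m v v')) \<and>
         (\<forall>I. (\<forall>\<delta>. sobder m p q \<delta> \<longrightarrow> tangent m q add mul pn (I \<delta>) \<and>
                  (\<forall>f. Wsp m p f \<longrightarrow> (AE x in m. I \<delta> (d f) x = \<delta> f x)))
              \<longrightarrow> der_to_tan_iso m p q add mul pn I)"
proof -
  have p1: "1 \<le> p"
  proof (cases "q = \<infinity>")
    case False
    then have "1 < enn2real q" using q by (cases q) (auto simp: ennreal_less_iff simp flip: ennreal_1)
    then show ?thesis using p False by (simp add: field_simps)
  qed (simp add: p)
  interpret cotangent m p add zero mul pn d
    by unfold_locales (use borel bdd_fin p1 cot in auto)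
  show ?thesis
  proof (intro conjI allI impI)
    show "\<exists>v. tangent m q add mul pn v \<and> (\<forall>f. Wsp m p f \<longrightarrow> (AE x in m. v (d f) x = \<delta> f x))"
      if "sobder m p q \<delta>" for \<delta>
      by (rule tangent_exists[OF q p that])
    show "tan_eq m v v'"
      if "tangent m q add mul pn v \<and> (\<forall>f. Wsp m p f \<longrightarrow> (AE x in m. v (d f) x = \<delta> f x)) \<and>
          tangent m q add mul pn v' \<and> (\<forall>f. Wsp m p f \<longrightarrow> (AE x in m. v' (d f) x = \<delta> f x))" for \<delta> v v'
    proof (rule tangent_unique)
      fix f assume "Wsp m p f"
      then have "AE x in m. v (d f) x = \<delta> f x" "AE x in m. v' (d f) x = \<delta> f x" using that by auto
      then show "AE x in m. v (d f) x = v' (d f) x" by eventually_elim simp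
    qed (use that in auto)
    show "der_to_tan_iso m p q add mul pn I"
      if "\<forall>\<delta>. sobder m p q \<delta> \<longrightarrow> tangent m q add mul pn (I \<delta>) \<and>
          (\<forall>f. Wsp m p f \<longrightarrow> (AE x in m. I \<delta> (d f) x = \<delta> f x))" for I
      using that by (intro der_to_tan_isoI q) auto
  qed
qed

end
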